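(* Let $f$ be a smoothly operator-Fenchel liftable generator, with score map $\vartheta$, and let $\rho,\sigma$ be faithful density operators on $\mathbb C^d$. Let $P=(P_j)_{j=1}^d$, $P_j=|j\rangle\langle j|$, be a critical rank-one PVM of $F_f$, and write its score operator as $$\Gamma_P=\sum_{\alpha=1}^m s_\alpha B_\alpha,\qquad t_\alpha=\vartheta^{-1}(s_\alpha),$$ with distinct scores $s_\alpha$ and spectral projections $B_\alpha$. Then $P$ is globally optimal over all POVMs if and only if $$B_\alpha(\rho-t_\alpha\sigma)B_\alpha=0\quad\text{for every }\alpha .$$ If this condition fails, then for some $\alpha$ there are indices $j\neq k$ with $P_j,P_k\le B_\alpha$ and a phase $\phi\in\mathbb R$ such that the two-level rotation $P(\theta)$ of the vectors $|j\rangle,|k\rangle$ with phase $\phi$ satisfies $$\frac{d^2}{d\theta^2}F_f(P(\theta))\Big|_{\theta=0}=4f''(t_\alpha)\,\bigl|\langle j|(\rho-t_\alpha\sigma)|k\rangle\bigr|^2\left(\frac1{q_j}+\frac1{q_k}\right)>0 .$$ Consequently every local maximum of $F_f$ over rank-one PVMs and every second-order stationary rank-one PVM is globally optimal over all POVMs, and for every critical rank-one PVM $P$ that is not globally optimal there are indices $j\ne k$ with $P_j,P_k\le B_\alpha$ for a common $\alpha$ and a phase $\phi\in\mathbb R$ such that the two-level rotation $P(\theta)$ of $|j\rangle,|k\rangle$ with phase $\phi$ satisfies $\frac{d^2}{d\theta^2}F_f(P(\theta))\big|_{\theta=0}>0$.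
   Context: Density operators on $\mathbb C^d$ are positive semidefinite trace-one matrices; faithful means positive definite. A finite POVM is a family $M=(M_y)$ of positive semidefinite matrices with $\sum_yM_y=\mathbf 1$. A rank-one PVM is $P=(P_1,\dots,P_d)$ with $P_j=|e_j\rangle\langle e_j|$ for an orthonormal basis (written $|j\rangle=e_j$); the space of ordered rank-one PVMs is the flag manifold $U(d)/U(1)^d$, with paths $P(\varepsilon)=e^{i\varepsilon K}Pe^{-i\varepsilon K}$, $K=K^*$. For faithful $\rho,\sigma$: $p_j=\mathrm{Tr}(\rho P_j)$, $q_j=\mathrm{Tr}(\sigma P_j)$, $t_j=p_j/q_j$, and $F_f(P)=\sum_j q_jf(t_j)$. For probability vectors, $D_f(p\Vert q)=\sum_yq_yf(p_y/q_y)$ (usual lower-semicontinuous boundary extension). $P$ is globally optimal over all POVMs if $F_f(P)=D_f^{\mathbb M}(\rho\Vert\sigma):=\sup_M D_f\bigl((\mathrm{Tr}\rho M_y)_y\Vert(\mathrm{Tr}\sigma M_y)_y\bigr)$, supremum over finite POVMs. $P$ is critical if the first derivative of $F_f$ at $P$ vanishes along all tangent directions of the flag manifold; second-order stationary means critical with negative semidefinite Riemannian Hessian. A proper lower-semicontinuous convex $f:\mathbb R\to\mathbb R\cup\{+\infty\}$ with $(0,\infty)\subset\mathrm{dom} f$ is smoothly operator-Fenchel liftable if: (1) $f(1)=0$, $f\in C^2(0,\infty)$, $f''>0$ on $(0,\infty)$; (2) the interior $I_f$ of $\mathrm{dom} f^*$ equals $f'((0,\infty))$, where $f^*(z)=\sup_{t\in\mathbb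 R}\{tz-f(t)\}$; (3) there are an open interval $J$ and a $C^2$ diffeomorphism $\psi:J\to I_f$ with $\psi'\neq0$ such that $\psi$ is operator concave and $g:=f^*\circ\psi$ is operator convex on $J$. Such $\psi$ is fixed. The score map is $\vartheta(t)=\psi^{-1}(f'(t))$, $t>0$ (injective), and the score operator is $\Gamma_P=\sum_j\vartheta(t_j)P_j$. Thus $B_\alpha$ is the sum of those $P_j$ with $t_j=t_\alpha$. Two-level rotation of $|j\rangle,|k\rangle$ with phase $\phi$: $|j(\theta)\rangle=\cos\theta|j\rangle+e^{i\phi}\sin\theta|k\rangle$, $|k(\theta)\rangle=-e^{-i\phi}\sin\theta|j\rangle+\cos\theta|k\rangle$, all other basis vectors fixed; $P(\theta)$ is the resulting PVM. *)

theory Defs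
  imports
    "HOL-Analysis.Analysis"
    "Jordan_Normal_Form.Schur_Decomposition"
    "Jordan_Normal_Form.Spectral_Radius"
begin

unbundle no vec_syntax

section \<open>Matrices\<close>

definition hermitian :: "nat \<Rightarrow> complex mat \<Rightarrow> bool" where
  "hermitian n A \<longleftrightarrow> A \<in> carrier_mat n n \<and> mat_adjoint A = A"

definition unitary :: "nat \<Rightarrow> complex mat \<Rightarrow> bool" where
  "unitary n U \<longleftrightarrow> U \<in> carrier_mat n n \<and> mat_adjoint U * U = 1\<^sub>m n"

text \<open>The AFP scalar product is conjugate-linear in its second argument, so this is the Dirac
  bracket \<open>\<langle>u|A|v\<rangle>\<close>.\<close>

definition bracket :: "complex vec \<Rightarrow> complex mat \<Rightarrow> complex vec \<Rightarrow> complex" where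
  "bracket u A v = (A *\<^sub>v v) \<bullet>c u"

definition psd :: "nat \<Rightarrow> complex mat \<Rightarrow> bool" where
  "psd n A \<longleftrightarrow> hermitian n A \<and> (\<forall>v\<in>carrier_vec n. Re (bracket v A v) \<ge> 0)"

definition pos_def :: "nat \<Rightarrow> complex mat \<Rightarrow> bool" where
  "pos_def n A \<longleftrightarrow> hermitian n A \<and> (\<forall>v\<in>carrier_vec n. v \<noteq> 0\<^sub>v n \<longrightarrow> Re (bracket v A v) > 0)"

definition loewner_le :: "nat \<Rightarrow> complex mat \<Rightarrow> complex mat \<Rightarrow> bool" where
  "loewner_le n A B \<longleftrightarrow> A \<in> carrier_mat n n \<and> B \<in> carrier_mat n n \<and> psd n (B - A)"

definition mtrace :: "complex mat \<Rightarrow> complex" where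
  "mtrace A = (\<Sum>i<dim_row A. A $$ (i, i))"

definition msum :: "nat \<Rightarrow> nat \<Rightarrow> (nat \<Rightarrow> complex mat) \<Rightarrow> complex mat" where
  "msum n m M = Matrix.mat n n (\<lambda>(a, b). \<Sum>y<m. M y $$ (a, b))"

definition mexp :: "complex mat \<Rightarrow> complex mat" where
  "mexp A = Matrix.mat (dim_row A) (dim_row A)
     (\<lambda>(a, b). \<Sum>k. (A ^\<^sub>m k) $$ (a, b) / fact k)"

text \<open>Functional calculus \<open>h(A) = U diag(h(l\<^sub>1),\<dots>,h(l\<^sub>n)) U\<^sup>*\<close> for a Hermitian matrix
  \<open>A = U diag(l\<^sub>1,\<dots>,l\<^sub>n) U\<^sup>*\<close>; the result does not depend on the chosen diagonalisation.\<close>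

definition herm_fun :: "nat \<Rightarrow> (real \<Rightarrow> real) \<Rightarrow> complex mat \<Rightarrow> complex mat" where
  "herm_fun n h A = (THE X. \<exists>U l. unitary n U
      \<and> A = U * mat_diag n (\<lambda>i. complex_of_real (l i)) * mat_adjoint U
      \<and> X = U * mat_diag n (\<lambda>i. complex_of_real (h (l i))) * mat_adjoint U)"

definition operator_convex_on :: "real set \<Rightarrow> (real \<Rightarrow> real) \<Rightarrow> bool" where
  "operator_convex_on J h \<longleftrightarrow> (\<forall>n A B. \<forall>u\<in>{0..1}.
      hermitian n A \<and> hermitian n B
      \<and> spectrum A \<subseteq> complex_of_real ` J \<and> spectrum B \<subseteq> complex_of_real ` J \<longrightarrow>
      loewner_le n
        (herm_fun n h (complex_of_real (1 - u) \<cdot>\<^sub>m A + complex_of_real u \<cdot>\<^sub>m B))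
        (complex_of_real (1 - u) \<cdot>\<^sub>m herm_fun n h A + complex_of_real u \<cdot>\<^sub>m herm_fun n h B))"

definition operator_concave_on :: "real set \<Rightarrow> (real \<Rightarrow> real) \<Rightarrow> bool" where
  "operator_concave_on J h \<longleftrightarrow> operator_convex_on J (\<lambda>x. - h x)"

text \<open>\<open>A = \<Sum>\<^sub>\<alpha> s\<^sub>\<alpha> B\<^sub>\<alpha>\<close> with pairwise distinct \<open>s\<^sub>\<alpha>\<close> and nonzero, mutually orthogonal
  orthogonal projections \<open>B\<^sub>\<alpha>\<close> that sum to the identity.\<close>

definition spectral_decomposition ::
  "nat \<Rightarrow> complex mat \<Rightarrow> nat \<Rightarrow> (nat \<Rightarrow> real) \<Rightarrow> (nat \<Rightarrow> complex mat) \<Rightarrow> bool" where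
  "spectral_decomposition n A m s B \<longleftrightarrow>
     inj_on s {..<m}
     \<and> (\<forall>\<alpha><m. hermitian n (B \<alpha>) \<and> B \<alpha> * B \<alpha> = B \<alpha> \<and> B \<alpha> \<noteq> 0\<^sub>m n n)
     \<and> (\<forall>\<alpha><m. \<forall>\<beta><m. \<alpha> \<noteq> \<beta> \<longrightarrow> B \<alpha> * B \<beta> = 0\<^sub>m n n)
     \<and> msum n m B = 1\<^sub>m n
     \<and> A = msum n m (\<lambda>\<alpha>. complex_of_real (s \<alpha>) \<cdot>\<^sub>m B \<alpha>)"

section \<open>Liftable generators\<close>

definition C2_on :: "real set \<Rightarrow> (real \<Rightarrow> real) \<Rightarrow> bool" where
  "C2_on S g \<longleftrightarrow> (\<forall>x\<in>S. g differentiable at x) \<and> (\<forall>x\<in>S. deriv g differentiable at x)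
     \<and> continuous_on S (deriv (deriv g))"

definition has_second_derivative :: "(real \<Rightarrow> real) \<Rightarrow> real \<Rightarrow> real \<Rightarrow> bool" where
  "has_second_derivative g D x \<longleftrightarrow>
     (\<forall>\<^sub>F y in nhds x. g differentiable at y) \<and> (deriv g has_real_derivative D) (at x)"

definition proper_lsc_convex :: "(real \<Rightarrow> ereal) \<Rightarrow> bool" where
  "proper_lsc_convex f \<longleftrightarrow>
     (\<forall>x. f x \<noteq> -\<infinity>) \<and> (\<exists>x. f x \<noteq> \<infinity>)
     \<and> (\<forall>x. f x \<le> Liminf (at x) f)
     \<and> (\<forall>x y. \<forall>u\<in>{0<..<1}. f ((1 - u) * x + u * y) \<le> ereal (1 - u) * f x + ereal u * f y)"

definition finite_part :: "(real \<Rightarrow> ereal) \<Rightarrow> real \<Rightarrow> real" where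
  "finite_part f t = real_of_ereal (f t)"

definition fenchel_conj :: "(real \<Rightarrow> ereal) \<Rightarrow> real \<Rightarrow> ereal" where
  "fenchel_conj f z = (SUP t. ereal (t * z) - f t)"

definition conj_domain_interior :: "(real \<Rightarrow> ereal) \<Rightarrow> real set" where
  "conj_domain_interior f = interior {z. fenchel_conj f z < \<infinity>}"

text \<open>\<open>f\<close> is smoothly operator-Fenchel liftable and \<open>\<psi>\<close>, \<open>J\<close> is the fixed choice of lift.\<close>

definition operator_Fenchel_lift :: "(real \<Rightarrow> ereal) \<Rightarrow> real set \<Rightarrow> (real \<Rightarrow> real) \<Rightarrow> bool" where
  "operator_Fenchel_lift f J \<psi> \<longleftrightarrow>
     proper_lsc_convex f \<and> (\<forall>t>0. f t < \<infinity>)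
     \<and> f 1 = 0 \<and> C2_on {0<..} (finite_part f) \<and> (\<forall>t>0. deriv (deriv (finite_part f)) t > 0)
     \<and> conj_domain_interior f = deriv (finite_part f) ` {0<..}
     \<and> open J \<and> is_interval J
     \<and> bij_betw \<psi> J (conj_domain_interior f)
     \<and> C2_on J \<psi> \<and> C2_on (conj_domain_interior f) (the_inv_into J \<psi>)
     \<and> (\<forall>x\<in>J. deriv \<psi> x \<noteq> 0)
     \<and> operator_concave_on J \<psi>
     \<and> operator_convex_on J (\<lambda>x. real_of_ereal (fenchel_conj f (\<psi> x)))"

definition score_map :: "(real \<Rightarrow> ereal) \<Rightarrow> real set \<Rightarrow> (real \<Rightarrow> real) \<Rightarrow> real \<Rightarrow> real" where
  "score_map f J \<psi> t = the_inv_into J \<psi> (deriv (finite_part f) t)"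

section \<open>States, measurements, divergences\<close>

definition faithful_density :: "nat \<Rightarrow> complex mat \<Rightarrow> bool" where
  "faithful_density d \<rho> \<longleftrightarrow> pos_def d \<rho> \<and> mtrace \<rho> = 1"

definition povm :: "nat \<Rightarrow> nat \<Rightarrow> (nat \<Rightarrow> complex mat) \<Rightarrow> bool" where
  "povm d m M \<longleftrightarrow> (\<forall>y<m. psd d (M y)) \<and> msum d m M = 1\<^sub>m d"

definition born :: "complex mat \<Rightarrow> complex mat \<Rightarrow> real" where
  "born \<rho> M = Re (mtrace (\<rho> * M))"

text \<open>One term \<open>q f(p/q)\<close> of a divergence. At \<open>q = 0 < p\<close> the lower semicontinuous extension is
  \<open>p\<close> times the recession slope of \<open>f\<close>; at \<open>p = 0 < q\<close> no separate case is needed, since \<open>f\<close> is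
  itself lower semicontinuous and convex on the whole line.\<close>

definition div_term :: "(real \<Rightarrow> ereal) \<Rightarrow> real \<Rightarrow> real \<Rightarrow> ereal" where
  "div_term f p q =
     (if q = 0 then (if p = 0 then 0 else ereal p * Lim at_top (\<lambda>t. f t / ereal t))
      else ereal q * f (p / q))"

definition f_divergence ::
  "(real \<Rightarrow> ereal) \<Rightarrow> nat \<Rightarrow> (nat \<Rightarrow> real) \<Rightarrow> (nat \<Rightarrow> real) \<Rightarrow> ereal" where
  "f_divergence f m p q = (\<Sum>y<m. div_term f (p y) (q y))"

definition measured_divergence ::
  "nat \<Rightarrow> (real \<Rightarrow> ereal) \<Rightarrow> complex mat \<Rightarrow> complex mat \<Rightarrow> ereal" where
  "measured_divergence d f \<rho> \<sigma> =
     (SUP (m, M) \<in> {(m, M). povm d m M}.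
        f_divergence f m (\<lambda>y. born \<rho> (M y)) (\<lambda>y. born \<sigma> (M y)))"

definition orthonormal_basis :: "nat \<Rightarrow> (nat \<Rightarrow> complex vec) \<Rightarrow> bool" where
  "orthonormal_basis d e \<longleftrightarrow> (\<forall>j<d. e j \<in> carrier_vec d)
     \<and> (\<forall>j<d. \<forall>k<d. e j \<bullet>c e k = (if j = k then 1 else 0))"

definition basis_pvm :: "nat \<Rightarrow> (nat \<Rightarrow> complex vec) \<Rightarrow> nat \<Rightarrow> complex mat" where
  "basis_pvm d e j = Matrix.mat d d (\<lambda>(a, b). vec_index (e j) a * cnj (vec_index (e j) b))"

definition rank_one_pvm :: "nat \<Rightarrow> (nat \<Rightarrow> complex mat) \<Rightarrow> bool" where
  "rank_one_pvm d P \<longleftrightarrow> (\<exists>e. orthonormal_basis d e \<and> (\<forall>j<d. P j = basis_pvm d e j))"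

definition likelihood_ratio ::
  "complex mat \<Rightarrow> complex mat \<Rightarrow> (nat \<Rightarrow> complex mat) \<Rightarrow> nat \<Rightarrow> real" where
  "likelihood_ratio \<rho> \<sigma> P j = born \<rho> (P j) / born \<sigma> (P j)"

definition pvm_value ::
  "nat \<Rightarrow> (real \<Rightarrow> ereal) \<Rightarrow> complex mat \<Rightarrow> complex mat \<Rightarrow> (nat \<Rightarrow> complex mat) \<Rightarrow> real" where
  "pvm_value d f \<rho> \<sigma> P =
     (\<Sum>j<d. born \<sigma> (P j) * finite_part f (likelihood_ratio \<rho> \<sigma> P j))"

definition globally_optimal ::
  "nat \<Rightarrow> (real \<Rightarrow> ereal) \<Rightarrow> complex mat \<Rightarrow> complex mat \<Rightarrow> (nat \<Rightarrow> complex mat) \<Rightarrow> bool" where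
  "globally_optimal d f \<rho> \<sigma> P \<longleftrightarrow>
     ereal (pvm_value d f \<rho> \<sigma> P) = measured_divergence d f \<rho> \<sigma>"

definition score_operator ::
  "nat \<Rightarrow> (real \<Rightarrow> ereal) \<Rightarrow> real set \<Rightarrow> (real \<Rightarrow> real) \<Rightarrow> complex mat \<Rightarrow> complex mat
    \<Rightarrow> (nat \<Rightarrow> complex mat) \<Rightarrow> complex mat" where
  "score_operator d f J \<psi> \<rho> \<sigma> P =
     msum d d (\<lambda>j. complex_of_real (score_map f J \<psi> (likelihood_ratio \<rho> \<sigma> P j)) \<cdot>\<^sub>m P j)"

section \<open>Variations of rank-one PVMs\<close>

definition conj_path ::
  "(nat \<Rightarrow> complex mat) \<Rightarrow> complex mat \<Rightarrow> real \<Rightarrow> nat \<Rightarrow> complex mat" where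
  "conj_path P K \<epsilon> j =
     mexp ((\<i> * complex_of_real \<epsilon>) \<cdot>\<^sub>m K) * P j * mexp ((- \<i> * complex_of_real \<epsilon>) \<cdot>\<^sub>m K)"

definition critical_pvm ::
  "nat \<Rightarrow> (real \<Rightarrow> ereal) \<Rightarrow> complex mat \<Rightarrow> complex mat \<Rightarrow> (nat \<Rightarrow> complex mat) \<Rightarrow> bool" where
  "critical_pvm d f \<rho> \<sigma> P \<longleftrightarrow> rank_one_pvm d P
     \<and> (\<forall>K. hermitian d K \<longrightarrow>
          ((\<lambda>\<epsilon>. pvm_value d f \<rho> \<sigma> (conj_path P K \<epsilon>)) has_real_derivative 0) (at 0))"

text \<open>For a unitarily invariant (normal) metric on the flag manifold the tangent space at \<open>P\<close>
  is the space of Hermitian \<open>K\<close> with vanishing diagonal in the basis of \<open>P\<close>, and the geodesic with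
  initial velocity \<open>K\<close> is \<open>conj_path P K\<close>. The Riemannian Hessian is evaluated as the second
  derivative along geodesics; at a critical point it does not depend on the metric.\<close>

definition flag_tangent :: "nat \<Rightarrow> (nat \<Rightarrow> complex mat) \<Rightarrow> complex mat \<Rightarrow> bool" where
  "flag_tangent d P K \<longleftrightarrow> hermitian d K \<and> (\<forall>j<d. P j * K * P j = 0\<^sub>m d d)"

definition second_order_stationary ::
  "nat \<Rightarrow> (real \<Rightarrow> ereal) \<Rightarrow> complex mat \<Rightarrow> complex mat \<Rightarrow> (nat \<Rightarrow> complex mat) \<Rightarrow> bool" where
  "second_order_stationary d f \<rho> \<sigma> P \<longleftrightarrow> critical_pvm d f \<rho> \<sigma> P
     \<and> (\<forall>K. flag_tangent d P K \<longrightarrow>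
          (\<exists>D\<le>0. has_second_derivative (\<lambda>\<epsilon>. pvm_value d f \<rho> \<sigma> (conj_path P K \<epsilon>)) D 0))"

text \<open>The flag manifold carries the topology of entrywise convergence of the projections.\<close>

definition local_max_pvm ::
  "nat \<Rightarrow> (real \<Rightarrow> ereal) \<Rightarrow> complex mat \<Rightarrow> complex mat \<Rightarrow> (nat \<Rightarrow> complex mat) \<Rightarrow> bool" where
  "local_max_pvm d f \<rho> \<sigma> P \<longleftrightarrow> rank_one_pvm d P
     \<and> (\<exists>\<delta>>0. \<forall>Q. rank_one_pvm d Q
            \<and> (\<forall>j<d. \<forall>a<d. \<forall>b<d. cmod (Q j $$ (a, b) - P j $$ (a, b)) < \<delta>)
          \<longrightarrow> pvm_value d f \<rho> \<sigma> Q \<le> pvm_value d f \<rho> \<sigma> P)"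

definition two_level_rotation ::
  "(nat \<Rightarrow> complex vec) \<Rightarrow> nat \<Rightarrow> nat \<Rightarrow> real \<Rightarrow> real \<Rightarrow> nat \<Rightarrow> complex vec" where
  "two_level_rotation e j k \<phi> \<theta> l =
     (if l = j then complex_of_real (cos \<theta>) \<cdot>\<^sub>v e j + (cis \<phi> * complex_of_real (sin \<theta>)) \<cdot>\<^sub>v e k
      else if l = k then (- cis (- \<phi>) * complex_of_real (sin \<theta>)) \<cdot>\<^sub>v e j
                          + complex_of_real (cos \<theta>) \<cdot>\<^sub>v e k
      else e l)"

end

theory Submission
  imports Defs
begin

text \<open>
  With \<open>g = f\<^sup>* \<circ> \<psi>\<close>, every score assignment \<open>s\<close> of a POVM \<open>M\<close> has by the operator Jensen inequality
  a value \<open>\<Sum> Tr(\<rho> M\<^sub>y) \<psi>(s\<^sub>y) - Tr(\<sigma> M\<^sub>y) g(s\<^sub>y)\<close> that is at most the concave functional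
  \<open>\<Phi>(\<Gamma>) = Tr \<rho> \<psi>(\<Gamma>) - Tr \<sigma> g(\<Gamma>)\<close> at \<open>\<Gamma> = \<Sum> s\<^sub>y M\<^sub>y\<close>, and for the optimal scores \<open>\<theta>(p\<^sub>y / q\<^sub>y)\<close>
  this value is the divergence; for a rank-one PVM \<open>P\<close> it equals \<open>\<Phi>(\<Gamma>\<^sub>P)\<close>. Hence \<open>P\<close> is globally optimal
  as soon as \<open>\<Phi>\<close> is stationary at \<open>\<Gamma>\<^sub>P\<close>. In the basis of \<open>P\<close> the derivative of \<open>\<Phi>\<close> has the entries
  \<open>\<rho>\<^sub>j\<^sub>k \<psi>\<^sup>[\<^sup>1\<^sup>](s\<^sub>j, s\<^sub>k) - \<sigma>\<^sub>j\<^sub>k g\<^sup>[\<^sup>1\<^sup>](s\<^sub>j, s\<^sub>k)\<close> (divided differences): those with \<open>s\<^sub>j \<noteq> s\<^sub>k\<close> vanish because \<open>P\<close> is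
  critical, and those inside a block vanish exactly under the block condition, since \<open>g'(s\<^sub>j) = t\<^sub>j \<psi>'(s\<^sub>j)\<close>.
  Conversely, rotating two vectors of a block with a nonzero off-diagonal entry of \<open>\<rho> - t\<^sub>\<alpha> \<sigma>\<close>, with the phase that
  makes this entry real, has first derivative zero and the stated positive second derivative.
  Criticality is used only along two-level rotations; these are conjugation paths whose generator \<open>K\<close>
  satisfies \<open>K\<^sup>3 = K\<close>.
\<close>

section \<open>Hermitian matrices\<close>

text \<open>The obstacle is the derivative of \<Phi> at \<open>\<Gamma>\<^sub>P\<close>:
  eigenvectors of a perturbed matrix need not depend continuously on the perturbation. Only
  one-sided difference quotients along a segment starting at \<open>\<Gamma>\<^sub>P\<close> are
  formed, and for each parameter \<open>u\<close> an eigenbasis of the perturbed matrix is chosen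
  arbitrarily. Each term of the increment then carries two overlaps between old and new
  eigenvectors. One of them, multiplied by the eigenvalue shift, is exactly \<open>u\<close> times a
  bounded quantity. The other is small unless the new eigenvalue is close to an old score, and there
  the divided-difference entry is small, being continuous and zero at that score. So the quotient
  tends to zero, and concavity of \<Phi> turns this into a global bound. The relation
  \<open>g' = t \<psi>'\<close> comes from Fenchel duality: the derivative of the conjugate at
  \<open>f' t\<close> is \<open>t\<close>. Positive definiteness of both states gives every nonzero
  effect positive probability, so the boundary conventions of the divergence only concern zero
  effects.\<close>

abbreviation adj :: "complex mat \<Rightarrow> complex mat" where "adj \<equiv> mat_adjoint"

abbreviation rdiag :: "nat \<Rightarrow> (nat \<Rightarrow> real) \<Rightarrow> complex mat" where
  "rdiag n l \<equiv> mat_diag n (\<lambda>i. complex_of_real (l i))"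

abbreviation udiag :: "nat \<Rightarrow> complex mat \<Rightarrow> (nat \<Rightarrow> real) \<Rightarrow> complex mat" where
  "udiag n U l \<equiv> U * rdiag n l * adj U"

section \<open>Adjoints, unitary conjugation and the spectral theorem\<close>

lemma adj_carrier [simp, intro]: "A \<in> carrier_mat n m \<Longrightarrow> adj A \<in> carrier_mat m n"
  by (auto simp: mat_adjoint_def mat_of_rows_def)

lemma adj_dim [simp]: "dim_row (adj A) = dim_col A" "dim_col (adj A) = dim_row A"
  by (auto simp: mat_adjoint_def mat_of_rows_def)

lemma adj_index [simp]:
  "i < dim_col A \<Longrightarrow> j < dim_row A \<Longrightarrow> adj A $$ (i, j) = cnj (A $$ (j, i))"
  by (auto simp: mat_adjoint_def mat_of_rows_def)

lemma adj_adj [simp]: "adj (adj A) = A"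
  by (rule eq_matI) auto

lemma mat_eqI:
  assumes "A \<in> carrier_mat n m" "B \<in> carrier_mat n m"
    and "\<And>i j. i < n \<Longrightarrow> j < m \<Longrightarrow> A $$ (i, j) = B $$ (i, j)"
  shows "A = B"
  by (rule eq_matI) (use assms in auto)

lemma mult_index:
  assumes "A \<in> carrier_mat n m" "B \<in> carrier_mat m p" "i < n" "j < p"
  shows "(A * B) $$ (i, j) = (\<Sum>k<m. A $$ (i, k) * B $$ (k, j))"
  using assms by (auto simp: scalar_prod_def lessThan_atLeast0)

lemma adj_mult:
  assumes "A \<in> carrier_mat n m" "B \<in> carrier_mat m p"
  shows "adj (A * B) = adj B * adj A"
proof (rule eq_matI)
  fix i j assume "i < dim_row (adj B * adj A)" "j < dim_col (adj B * adj A)"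
  then show "adj (A * B) $$ (i, j) = (adj B * adj A) $$ (i, j)"
    using assms
    by (auto simp: scalar_prod_def algebra_simps intro!: sum.cong)
qed (use assms in auto)

lemma adj_smult: "adj (c \<cdot>\<^sub>m A) = cnj c \<cdot>\<^sub>m adj A"
  by (rule eq_matI) auto

lemma adj_rdiag [simp]: "adj (rdiag n l) = rdiag n l"
  by (rule eq_matI) (auto simp: mat_diag_def)

lemma adj_one [simp]: "adj (1\<^sub>m n) = 1\<^sub>m n"
  by (rule eq_matI) auto

lemma hermitian_iff:
  "hermitian n A \<longleftrightarrow> A \<in> carrier_mat n n \<and> (\<forall>i<n. \<forall>j<n. A $$ (i, j) = cnj (A $$ (j, i)))"
  unfolding hermitian_def
proof (intro conj_cong refl iffI allI impI)
  fix i j assume "A \<in> carrier_mat n n" "adj A = A" "i < n" "j < n"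
  then show "A $$ (i, j) = cnj (A $$ (j, i))"
    using adj_index[of i A j] by auto
next
  assume A: "A \<in> carrier_mat n n" and h: "\<forall>i<n. \<forall>j<n. A $$ (i, j) = cnj (A $$ (j, i))"
  show "adj A = A"
  proof (rule eq_matI)
    fix i j assume "i < dim_row A" "j < dim_col A"
    then show "adj A $$ (i, j) = A $$ (i, j)" using A h[rule_format, of i j] by simp
  qed (use A in auto)
qed

lemma hermitianD:
  assumes "hermitian n A" "i < n" "j < n"
  shows "cnj (A $$ (i, j)) = A $$ (j, i)"
  using assms unfolding hermitian_iff by (metis complex_cnj_cnj)

lemma unitaryD:
  assumes "unitary n U"
  shows "U \<in> carrier_mat n n" "adj U \<in> carrier_mat n n" "adj U * U = 1\<^sub>m n" "U * adj U = 1\<^sub>m n"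
  using assms mat_mult_left_right_inverse[of "adj U" n U] by (auto simp: unitary_def)

lemma unitary_mult:
  assumes "unitary n U" "unitary n V"
  shows "unitary n (U * V)"
proof -
  note U = unitaryD[OF assms(1)] and V = unitaryD[OF assms(2)]
  have "adj (U * V) * (U * V) = adj V * ((adj U * U) * V)"
    using U(1,2) V(1,2) by (simp add: adj_mult[of _ n n _ n] assoc_mult_mat[of _ n n _ n _ n])
  then show ?thesis
    using U V by (simp add: unitary_def)
qed

lemma conj_conj:
  fixes P Q :: "complex mat"
  assumes "P \<in> carrier_mat n m" "Q \<in> carrier_mat m k" "A \<in> carrier_mat k l"
    "R \<in> carrier_mat l m'" "S \<in> carrier_mat m' n'"
  shows "P * (Q * A * R) * S = (P * Q) * A * (R * S)"
proof -
  have "P * (Q * A * R) * S = P * (Q * A) * R * S"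
    using assms by (simp add: assoc_mult_mat[of P n m "Q * A" l R m'])
  also have "P * (Q * A) = (P * Q) * A"
    using assms by (simp add: assoc_mult_mat[of P n m Q k A l])
  also have "P * Q * A * R * S = (P * Q) * A * (R * S)"
    using assms by (intro assoc_mult_mat[of "P * Q * A" n l R m' S n']) auto
  finally show ?thesis .
qed

lemma unitary_conj_cancel:
  assumes "unitary n W" "A \<in> carrier_mat n n"
  shows "W * (adj W * A * W) * adj W = A" "adj W * (W * A * adj W) * W = A"
proof -
  note W = unitaryD[OF assms(1)]
  show "W * (adj W * A * W) * adj W = A"
    unfolding conj_conj[OF W(1) W(2) assms(2) W(1) W(2)] W(4) using assms(2) by simp
  show "adj W * (W * A * adj W) * W = A"
    unfolding conj_conj[OF W(2) W(1) assms(2) W(2) W(1)] W(3) using assms(2) by simp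
qed

lemma unitary_adj: "unitary n U \<Longrightarrow> unitary n (adj U)"
  using unitaryD(2,4)[of n U] unfolding unitary_def[of n "adj U"] adj_adj by blast

lemma unitary_col_sum:
  assumes "unitary n U" "i < n" "j < n"
  shows "(\<Sum>k<n. cnj (U $$ (k, i)) * U $$ (k, j)) = (if i = j then 1 else 0)"
proof -
  note U = unitaryD[OF assms(1)]
  have "(adj U * U) $$ (i, j) = (\<Sum>k<n. adj U $$ (i, k) * U $$ (k, j))"
    by (rule mult_index) (use U assms in auto)
  also have "\<dots> = (\<Sum>k<n. cnj (U $$ (k, i)) * U $$ (k, j))"
    by (rule sum.cong) (use U assms in auto)
  finally show ?thesis using U assms by auto
qed

text \<open>Gram-Schmidt applied to a basis that starts with \<open>v\<close> leaves
  \<open>v\<close> in front and returns orthogonal but unnormalised vectors. Dividing each one by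
  its norm gives the columns of \<open>W\<close>, so \<open>c\<close> is the inverse norm of
  \<open>v\<close>.\<close>

lemma unitary_with_first_column:
  assumes v: "v \<in> carrier_vec n" "v \<noteq> 0\<^sub>v n"
  shows "\<exists>W c. unitary n W \<and> c \<noteq> 0 \<and> (\<forall>i<n. W $$ (i, 0) = c * v $ i)"
proof -
  interpret cof_vec_space n "TYPE(complex)" .
  define b where "b = basis_completion v"
  define ws where "ws = gram_schmidt n b"
  from basis_completion[OF v, folded b_def]
  have span_b: "span (set b) = carrier_vec n" and dist_b: "distinct b"
    and indep: "\<not> lin_dep (set b)" and b: "set b \<subseteq> carrier_vec n" and hdb: "hd b = v"
    and len_b: "length b = n" by auto
  have n: "n \<noteq> 0" using v by auto
  from hdb len_b n obtain vs where bv: "b = v # vs" by (cases b, auto)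
  from gram_schmidt_result[OF b dist_b indep refl, folded ws_def]
  have ws: "set ws \<subseteq> carrier_vec n" "corthogonal ws" "length ws = n"
    by (auto simp: len_b)
  from gram_schmidt_hd[OF v(1), of vs, folded bv] have hdws: "hd ws = v" unfolding ws_def .
  have ws0: "ws ! 0 = v" using hdws ws n by (metis hd_conv_nth list.size(3))
  define N where "N w = sqrt (\<Sum>k<n. (cmod (w $ k))\<^sup>2)" for w :: "complex vec"
  have car: "ws ! i \<in> carrier_vec n" if "i < n" for i using ws that by auto
  have ip: "(\<Sum>k<n. cnj (ws ! i $ k) * ws ! j $ k) = (if i = j then complex_of_real ((N (ws!i))\<^sup>2) else 0)"
    and Npos: "N (ws!i) > 0" if "i < n" "j < n" for i j
  proof -
    have e: "ws ! j \<bullet>c ws ! i = (\<Sum>k<n. cnj (ws ! i $ k) * ws ! j $ k)"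
      using car[OF that(1)] car[OF that(2)] by (auto simp: scalar_prod_def lessThan_atLeast0 intro!: sum.cong)
    have N2: "(N (ws!i))\<^sup>2 = (\<Sum>k<n. (cmod (ws!i $ k))\<^sup>2)"
      unfolding N_def by (simp add: sum_nonneg)
    have d: "(\<Sum>k<n. cnj (ws ! i $ k) * ws ! i $ k) = complex_of_real ((N (ws!i))\<^sup>2)"
      unfolding N2 of_real_sum by (rule sum.cong) (auto simp: complex_norm_square[symmetric] mult.commute)
    show "(\<Sum>k<n. cnj (ws ! i $ k) * ws ! j $ k) = (if i = j then complex_of_real ((N (ws!i))\<^sup>2) else 0)"
      using d e corthogonalD[OF ws(2), of j i] that ws(3) by auto
    have "ws ! i \<bullet>c ws ! i \<noteq> 0" using corthogonalD[OF ws(2), of i i] that ws(3) by auto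
    moreover have "ws ! i \<bullet>c ws ! i = (\<Sum>k<n. cnj (ws ! i $ k) * ws ! i $ k)"
      using car[OF that(1)] by (auto simp: scalar_prod_def lessThan_atLeast0 intro!: sum.cong)
    ultimately have "N (ws!i) \<noteq> 0" using d by auto
    moreover have "N (ws!i) \<ge> 0" unfolding N_def by (simp add: sum_nonneg)
    ultimately show "N (ws!i) > 0" by linarith
  qed
  define W where "W = Matrix.mat n n (\<lambda>(i,j). ws ! j $ i / complex_of_real (N (ws!j)))"
  have W: "W \<in> carrier_mat n n" unfolding W_def by auto
  have "adj W * W = 1\<^sub>m n"
  proof (rule eq_matI)
    fix i j assume "i < dim_row (1\<^sub>m n)" "j < dim_col (1\<^sub>m n)"
    hence ij: "i < n" "j < n" by auto
    have "(adj W * W) $$ (i, j) = (\<Sum>k<n. adj W $$ (i, k) * W $$ (k, j))"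
      by (rule mult_index) (use W ij in auto)
    also have "\<dots> = (\<Sum>k<n. (cnj (ws ! i $ k) * ws ! j $ k) / complex_of_real (N (ws!i) * N (ws!j)))"
      by (rule sum.cong) (use W ij in \<open>auto simp: W_def\<close>)
    also have "\<dots> = (\<Sum>k<n. cnj (ws ! i $ k) * ws ! j $ k) / complex_of_real (N (ws!i) * N (ws!j))"
      by (simp add: sum_divide_distrib)
    also have "\<dots> = (if i = j then 1 else 0)"
      using ip[OF ij] Npos[OF ij] by (auto simp: power2_eq_square)
    finally show "(adj W * W) $$ (i, j) = 1\<^sub>m n $$ (i, j)" using ij by auto
  qed (use W in auto)
  then have "unitary n W" using W by (simp add: unitary_def)
  moreover have "inverse (complex_of_real (N v)) \<noteq> 0" using Npos[of 0 0] n ws0 by auto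
  moreover have "\<forall>i<n. W $$ (i, 0) = inverse (of_real (N v)) * v $ i"
    using n ws0 by (auto simp: W_def field_simps)
  ultimately show ?thesis by blast
qed

lemma hermitian_conj:
  assumes "hermitian n A" "W \<in> carrier_mat n m"
  shows "hermitian m (adj W * A * W)"
proof -
  have A: "A \<in> carrier_mat n n" "adj A = A" using assms by (auto simp: hermitian_def)
  show ?thesis using A assms(2) unfolding hermitian_def
    by (simp add: adj_mult[of _ m n _ m] adj_mult[of _ n n _ m] assoc_mult_mat[of _ m n _ n _ m] mult_carrier_mat[of _ n n _ m] mult_carrier_mat[of _ m n _ m])
qed

text \<open>Deflation by induction on the dimension: in a unitary basis that starts with an
  eigenvector the first column is \<open>e\<close> times the first unit vector, hermiticity clears
  the first row as well, and the remaining block is Hermitian of size one less.\<close>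

theorem spectral_theorem:
  "hermitian n A \<Longrightarrow> \<exists>U l. unitary n U \<and> A = udiag n U l"
proof (induction n arbitrary: A)
  case 0
  then show ?case
    by (intro exI[of _ "1\<^sub>m 0"] exI[of _ "\<lambda>_. 0"]) (auto simp: unitary_def hermitian_def)
next
  case (Suc n)
  obtain N where N: "N = Suc n" by blast
  then have N0: "0 < N" by simp
  have hA: "hermitian N A" using Suc.prems N by simp
  then have A: "A \<in> carrier_mat N N" "adj A = A" by (auto simp: hermitian_def)
  obtain e where "eigenvalue A e" using spectrum_non_empty[OF A(1) N0] by (auto simp: spectrum_def)
  then obtain v where v: "v \<in> carrier_vec N" "v \<noteq> 0\<^sub>v N" "A *\<^sub>v v = e \<cdot>\<^sub>v v"
    using A by (auto simp: eigenvalue_def eigenvector_def)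
  obtain W c where W: "unitary N W" and c: "c \<noteq> 0" "\<And>i. i < N \<Longrightarrow> W $$ (i, 0) = c * v $ i"
    using unitary_with_first_column[OF v(1,2)] by blast
  note Wu = unitaryD[OF W]
  define B where "B = adj W * A * W"
  have B: "B \<in> carrier_mat N N" using Wu A by (auto simp: B_def)
  have hB: "hermitian N B" unfolding B_def by (rule hermitian_conj) (use hA Wu in auto)
  have AW0: "(A * W) $$ (i, 0) = e * W $$ (i, 0)" if "i < N" for i
  proof -
    have "(A * W) $$ (i, 0) = (\<Sum>k<N. A $$ (i, k) * W $$ (k, 0))"
      by (rule mult_index) (use A Wu that in auto)
    also have "\<dots> = c * (\<Sum>k<N. A $$ (i, k) * v $ k)"
      by (simp add: c sum_distrib_left algebra_simps)
    also have "(\<Sum>k<N. A $$ (i, k) * v $ k) = (A *\<^sub>v v) $ i"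
      using A v(1) that by (auto simp: scalar_prod_def lessThan_atLeast0)
    also have "\<dots> = e * v $ i" using v that by auto
    finally show ?thesis using c(2)[OF that] by simp
  qed
  have B0: "B $$ (i, 0) = (if i = 0 then e else 0)" if "i < N" for i
  proof -
    have "B = adj W * (A * W)" unfolding B_def
      using Wu A by (simp add: assoc_mult_mat[of _ N N _ N _ N])
    then have "B $$ (i, 0) = (\<Sum>k<N. adj W $$ (i, k) * (A * W) $$ (k, 0))"
      using mult_index[of "adj W" N N "A * W" N i 0] Wu A that by auto
    also have "\<dots> = (\<Sum>k<N. e * (cnj (W $$ (k, i)) * W $$ (k, 0)))"
      by (rule sum.cong) (use Wu that in \<open>auto simp: AW0 simp del: index_mult_mat\<close>)
    also have "\<dots> = e * (\<Sum>k<N. cnj (W $$ (k, i)) * W $$ (k, 0))"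
      by (simp add: sum_distrib_left)
    finally show ?thesis using unitary_col_sum[OF W that, of 0] N0 by auto
  qed
  have e: "cnj e = e" using hermitianD[OF hB, of 0 0] B0[of 0] N0 by simp
  have B0': "B $$ (0, i) = (if i = 0 then e else 0)" if "i < N" for i
    using hermitianD[OF hB that N0] B0[OF that] e by (auto split: if_splits)
  define C where "C = Matrix.mat n n (\<lambda>(i,j). B $$ (Suc i, Suc j))"
  have "hermitian n C" using hB N unfolding hermitian_iff[of n] C_def
    by (auto simp: hermitianD[OF hB])
  from Suc.IH[OF this] obtain U l where U: "unitary n U" and CU: "C = udiag n U l" by blast
  note Uu = unitaryD[OF U]
  \<comment> \<open>The unitary of the smaller block is bordered by a single 1, so indices shift by
    one. The new diagonal entry may be taken as \<open>Re e\<close> because \<open>e\<close> is its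
    own conjugate.\<close>
  define U' where "U' = Matrix.mat N N (\<lambda>(i,j). if i = 0 \<or> j = 0 then (if i = j then 1 else 0)
     else U $$ (i - 1, j - 1))"
  define l' where "l' i = (if i = 0 then Re e else l (i - 1))" for i
  have U'c: "U' \<in> carrier_mat N N" unfolding U'_def by auto
  have U'u: "unitary N U'"
    unfolding unitary_def
  proof (intro conjI U'c eq_matI)
    fix i j assume "i < dim_row (1\<^sub>m N)" "j < dim_col (1\<^sub>m N)"
    hence ij: "i < N" "j < N" by auto
    have "(adj U' * U') $$ (i, j) = (\<Sum>k<N. adj U' $$ (i, k) * U' $$ (k, j))"
      by (rule mult_index) (use U'c ij in auto)
    also have "\<dots> = (\<Sum>k<N. cnj (U' $$ (k, i)) * U' $$ (k, j))"
      by (rule sum.cong) (use U'c ij in auto)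
    also have "\<dots> = cnj (U' $$ (0, i)) * U' $$ (0, j)
       + (\<Sum>k<n. cnj (U' $$ (Suc k, i)) * U' $$ (Suc k, j))"
      unfolding N by (simp only: sum.lessThan_Suc_shift)
    also have "\<dots> = (if i = j then 1 else 0)"
    proof (cases "i = 0 \<or> j = 0")
      case True then show ?thesis using ij N by (auto simp: U'_def)
    next
      case False
      then obtain i' j' where "i = Suc i'" "j = Suc j'" by (metis not0_implies_Suc)
      with ij N unitary_col_sum[OF U, of i' j'] show ?thesis by (auto simp: U'_def)
    qed
    finally show "(adj U' * U') $$ (i, j) = 1\<^sub>m N $$ (i, j)" using ij by auto
  qed (use U'c in auto)
  have BU: "B = udiag N U' l'"
  proof (rule eq_matI)
    fix i j assume "i < dim_row (udiag N U' l')" "j < dim_col (udiag N U' l')"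
    hence ij: "i < N" "j < N" using U'c by auto
    have "(udiag N U' l') $$ (i, j) = (\<Sum>k<N. (U' * rdiag N l') $$ (i, k) * adj U' $$ (k, j))"
      by (rule mult_index) (use U'c ij in auto)
    also have "\<dots> = (\<Sum>k<N. U' $$ (i, k) * l' k * cnj (U' $$ (j, k)))"
      by (rule sum.cong) (use U'c ij in \<open>auto simp: mat_diag_mult_right\<close>)
    also have "\<dots> = U' $$ (i, 0) * Re e * cnj (U' $$ (j, 0))
       + (\<Sum>k<n. U' $$ (i, Suc k) * l k * cnj (U' $$ (j, Suc k)))"
      unfolding N by (simp only: sum.lessThan_Suc_shift) (simp add: l'_def)
    also have "\<dots> = B $$ (i, j)"
    proof (cases "i = 0 \<or> j = 0")
      case True
      have "of_real (Re e) = e" using e by (simp add: complex_eq_iff)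
      then show ?thesis using ij N True B0[OF ij(1)] B0'[OF ij(2)] by (auto simp: U'_def)
    next
      case False
      then obtain i' j' where ij': "i = Suc i'" "j = Suc j'" by (metis not0_implies_Suc)
      have "C $$ (i', j') = (\<Sum>k<n. (U * rdiag n l) $$ (i', k) * adj U $$ (k, j'))"
        unfolding CU by (rule mult_index) (use Uu ij ij' N in auto)
      also have "\<dots> = (\<Sum>k<n. U $$ (i', k) * l k * cnj (U $$ (j', k)))"
        by (rule sum.cong) (use Uu ij ij' N in \<open>auto simp: mat_diag_mult_right\<close>)
      finally show ?thesis using ij ij' N by (auto simp: C_def U'_def)
    qed
    finally show "B $$ (i, j) = (udiag N U' l') $$ (i, j)" by simp
  qed (use B U'c in auto)
  have "A = W * B * adj W" unfolding B_def unfolding unitary_conj_cancel(1)[OF W A(1)] ..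
  also have "\<dots> = (W * U') * rdiag N l' * adj (W * U')"
    unfolding BU adj_mult[OF Wu(1) U'c]
    by (rule conj_conj[OF Wu(1) U'c _ _ Wu(2)]) (use U'c in auto)
  finally show ?case using unitary_mult[OF W U'u] unfolding N by blast
qed

section \<open>Functional calculus and Born probabilities\<close>

lemma mem_carrier_mat: "A \<in> carrier_mat n m \<longleftrightarrow> dim_row A = n \<and> dim_col A = m"
  unfolding carrier_mat_def by blast

text \<open>The side conditions are equations between dimensions, which rewriting can evaluate; with
  carrier sets the inner sizes do not occur in the equation and would have to be supplied each
  time.\<close>

lemma mult_assoc_dim:
  assumes "dim_col A = dim_row B" "dim_col B = dim_row C"
  shows "A * B * C = A * (B * (C :: complex mat))"
  using assoc_mult_mat[of A "dim_row A" "dim_row B" B "dim_row C" C "dim_col C"] assms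
  unfolding mem_carrier_mat by blast

lemma one_mult_dim:
  "dim_row A = n \<Longrightarrow> 1\<^sub>m n * A = (A :: complex mat)" "dim_col A = n \<Longrightarrow> A * 1\<^sub>m n = (A :: complex mat)"
  using left_mult_one_mat[of A n "dim_col A"] right_mult_one_mat[of A "dim_row A" n]
  unfolding mem_carrier_mat by blast+

lemma adj_mult_dim: "dim_col A = dim_row B \<Longrightarrow> adj (A * B) = adj B * adj A"
  by (rule adj_mult) auto

lemma mat_diag_dims [simp]: "dim_row (mat_diag n f) = n" "dim_col (mat_diag n f) = n"
  by (auto simp: mat_diag_def)

lemma mult_mat_vec_assoc_dim:
  assumes "dim_col A = dim_row B" "dim_col B = dim_vec v"
  shows "A * B *\<^sub>v v = A *\<^sub>v (B *\<^sub>v (v :: complex vec))"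
  using assoc_mult_mat_vec[of A "dim_row A" "dim_row B" B "dim_vec v" v] assms carrier_vec_dim_vec[of v]
  unfolding mem_carrier_mat by blast

lemmas mat_dim_simps =
  mult_assoc_dim one_mult_dim adj_mult_dim mem_carrier_mat mult_mat_vec_assoc_dim

text \<open>Products are normalised by nesting to the right, so a pair \<open>adj U\<close>,
  \<open>U\<close> usually stands in front of a further factor \<open>X\<close> instead of forming a
  product of its own.\<close>

lemma unitary_cancel:
  assumes "unitary n U"
  shows "dim_row X = n \<Longrightarrow> adj U * (U * X) = X" "dim_row X = n \<Longrightarrow> U * (adj U * X) = X"
    "dim_vec v = n \<Longrightarrow> adj U *\<^sub>v (U *\<^sub>v v) = v" "dim_vec v = n \<Longrightarrow> U *\<^sub>v (adj U *\<^sub>v v) = v"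
proof -
  note u = unitaryD[OF assms]
  have d: "dim_row U = n" "dim_col U = n" using u(1) by auto
  show "adj U * (U * X) = X" if "dim_row X = n"
    using mult_assoc_dim[of "adj U" U X, symmetric] d that by (simp only: u(3) adj_dim one_mult_dim)
  show "U * (adj U * X) = X" if "dim_row X = n"
    using mult_assoc_dim[of U "adj U" X, symmetric] d that by (simp only: u(4) adj_dim one_mult_dim)
  show "adj U *\<^sub>v (U *\<^sub>v v) = v" if "dim_vec v = n"
    using mult_mat_vec_assoc_dim[of "adj U" U v, symmetric] d that one_mult_mat_vec[of v n]
    by (simp only: u(3) adj_dim carrier_vec_def mem_Collect_eq)
  show "U *\<^sub>v (adj U *\<^sub>v v) = v" if "dim_vec v = n"
    using mult_mat_vec_assoc_dim[of U "adj U" v, symmetric] d that one_mult_mat_vec[of v n]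
    by (simp only: u(4) adj_dim carrier_vec_def mem_Collect_eq)
qed

lemma unitary_dims: "unitary n U \<Longrightarrow> dim_row U = n" "unitary n U \<Longrightarrow> dim_col U = n"
  using unitaryD(1) by auto

lemma udiag_index:
  assumes "U \<in> carrier_mat n m" "i < n" "j < n"
  shows "(udiag m U l) $$ (i, j) = (\<Sum>k<m. U $$ (i, k) * l k * cnj (U $$ (j, k)))"
proof -
  have "(udiag m U l) $$ (i, j) = (\<Sum>k<m. (U * rdiag m l) $$ (i, k) * adj U $$ (k, j))"
    by (rule mult_index) (use assms in auto)
  also have "\<dots> = (\<Sum>k<m. U $$ (i, k) * l k * cnj (U $$ (j, k)))"
    by (rule sum.cong) (use assms in \<open>auto simp: mat_diag_mult_right\<close>)
  finally show ?thesis .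
qed

lemma udiag_diff:
  assumes "U \<in> carrier_mat n m"
  shows "udiag m U l - udiag m U l' = udiag m U (\<lambda>i. l i - l' i)"
proof (rule mat_eqI[of _ n n])
  have c: "udiag m U l \<in> carrier_mat n n" for l using assms by auto
  fix i j assume ij: "i < n" "j < n"
  then have "(udiag m U l - udiag m U l') $$ (i, j)
    = (udiag m U l) $$ (i, j) - (udiag m U l') $$ (i, j)"
    by (intro index_minus_mat(1)) (use carrier_matD[OF c] in auto)
  also have "\<dots> = (udiag m U (\<lambda>i. l i - l' i)) $$ (i, j)"
    unfolding udiag_index[OF assms ij] sum_subtractf[symmetric]
    by (intro sum.cong refl) (simp add: algebra_simps)
  finally show "(udiag m U l - udiag m U l') $$ (i, j)
    = (udiag m U (\<lambda>i. l i - l' i)) $$ (i, j)" .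
qed (use assms in auto)

lemma udiag_carrier [simp]: "U \<in> carrier_mat n m \<Longrightarrow> udiag m U l \<in> carrier_mat n n"
  by auto

lemma udiag_hermitian:
  assumes "U \<in> carrier_mat n m"
  shows "hermitian n (udiag m U l)"
  unfolding hermitian_iff
proof (intro conjI allI impI)
  fix i j assume ij: "i < n" "j < n"
  show "(udiag m U l) $$ (i, j) = cnj ((udiag m U l) $$ (j, i))"
    unfolding udiag_index[OF assms ij] udiag_index[OF assms ij(2,1)]
    by (simp add: mult.commute mult.left_commute)
qed (use assms in auto)

text \<open>Passing to eigenbases, \<open>A\<^sub>1 V = V A\<^sub>2\<close> says \<open>(l\<^sub>1 i - l\<^sub>2 j) w\<^sub>i\<^sub>j = 0\<close>, which survives
  applying \<open>h\<close> to the eigenvalues.\<close>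

lemma functional_calculus_intertwines:
  assumes U1: "unitary n U1" and U2: "unitary m U2" and V: "V \<in> carrier_mat n m"
    and eq: "(udiag n U1 l1) * V = V * (udiag m U2 l2)"
  shows "(udiag n U1 (\<lambda>i. h (l1 i))) * V = V * (udiag m U2 (\<lambda>i. h (l2 i)))"
proof -
  note u1 = unitaryD[OF U1] and u2 = unitaryD[OF U2]
  define W where "W = adj U1 * V * U2"
  have W: "W \<in> carrier_mat n m" using u1 u2 V by (auto simp: W_def)
  have d: "dim_row V = n" "dim_col V = m" using V by auto
  note simps = d unitary_dims[OF U1] unitary_dims[OF U2] mat_dim_simps
  have L: "adj U1 * ((udiag n U1 l) * V) * U2 = rdiag n l * W" for l
    unfolding W_def by (simp add: simps unitary_cancel[OF U1] del: assoc_mult_mat)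
  have R: "adj U1 * (V * (udiag m U2 l)) * U2 = W * rdiag m l" for l
    unfolding W_def by (simp add: simps unitary_cancel[OF U2] u2(3) del: assoc_mult_mat)
  have e: "rdiag n l1 * W = W * rdiag m l2" using L[of l1] R[of l2] eq by simp
  have "rdiag n (\<lambda>i. h (l1 i)) * W = W * rdiag m (\<lambda>i. h (l2 i))"
  proof (rule eq_matI)
    fix i j assume "i < dim_row (W * rdiag m (\<lambda>i. h (l2 i)))" "j < dim_col (W * rdiag m (\<lambda>i. h (l2 i)))"
    then have ij: "i < n" "j < m" using W by (auto simp: mat_diag_mult_right)
    have "l1 i * W $$ (i, j) = W $$ (i, j) * l2 j"
      using arg_cong[OF e, of "\<lambda>M. M $$ (i, j)"] W ij
      by (simp add: mat_diag_mult_left[OF W] mat_diag_mult_right[OF W])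
    then have "W $$ (i, j) = 0 \<or> l1 i = l2 j" by (auto simp: mult.commute)
    then show "(rdiag n (\<lambda>i. h (l1 i)) * W) $$ (i, j) = (W * rdiag m (\<lambda>i. h (l2 i))) $$ (i, j)"
      using ij by (auto simp: mat_diag_mult_left[OF W] mat_diag_mult_right[OF W])
  qed (use W in \<open>auto simp: mat_diag_mult_left[OF W] mat_diag_mult_right[OF W]\<close>)
  then have e': "adj U1 * ((udiag n U1 (\<lambda>i. h (l1 i))) * V) * U2
     = adj U1 * (V * (udiag m U2 (\<lambda>i. h (l2 i)))) * U2"
    unfolding L R .
  have canc: "U1 * (adj U1 * X * U2) * adj U2 = X" if "X \<in> carrier_mat n m" for X
    unfolding conj_conj[OF u1(1) u1(2) that u2(1) u2(2)] u1(4) u2(4) using that by simp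
  let ?X = "(udiag n U1 (\<lambda>i. h (l1 i))) * V"
  let ?Y = "V * (udiag m U2 (\<lambda>i. h (l2 i)))"
  have "?X = U1 * (adj U1 * ?X * U2) * adj U2"
    by (rule canc[symmetric]) (simp add: simps del: assoc_mult_mat)
  also have "\<dots> = U1 * (adj U1 * ?Y * U2) * adj U2" by (simp only: e')
  also have "\<dots> = ?Y"
    by (rule canc) (simp add: simps del: assoc_mult_mat)
  finally show ?thesis .
qed

text \<open>This is the uniqueness that the \<open>THE\<close> in \<open>herm_fun\<close> requires:
  two diagonalisations of one matrix are intertwined by the identity matrix, hence so are their
  images under \<open>h\<close>.\<close>

lemma herm_fun_udiag:
  assumes "unitary n U"
  shows "herm_fun n h (udiag n U l) = udiag n U (\<lambda>i. h (l i))"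
  unfolding herm_fun_def
proof (rule the_equality)
  show "\<exists>U' l'. unitary n U' \<and> udiag n U l = udiag n U' l' \<and>
      udiag n U (\<lambda>i. h (l i)) = udiag n U' (\<lambda>i. h (l' i))"
    using assms by blast
next
  fix X assume "\<exists>U' l'. unitary n U' \<and> udiag n U l = udiag n U' l' \<and>
      X = udiag n U' (\<lambda>i. h (l' i))"
  then obtain U' l' where U': "unitary n U'" "udiag n U l = udiag n U' l'"
    and X: "X = udiag n U' (\<lambda>i. h (l' i))" by blast
  note u = unitaryD[OF assms] and u' = unitaryD[OF U'(1)]
  have c: "udiag n U' k \<in> carrier_mat n n" "udiag n U k \<in> carrier_mat n n" for k
    using u(1) u'(1) by auto
  have "(udiag n U' l') * 1\<^sub>m n = 1\<^sub>m n * (udiag n U l)"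
    using c[of l'] c[of l] U'(2) by (simp only: left_mult_one_mat right_mult_one_mat)
  from functional_calculus_intertwines[OF U'(1) assms one_carrier_mat this, of h]
  show "X = udiag n U (\<lambda>i. h (l i))"
    unfolding X using c[of "\<lambda>i. h (l' i)"] c[of "\<lambda>i. h (l i)"]
    by (simp only: left_mult_one_mat right_mult_one_mat)
qed

section \<open>Brackets, traces and Born probabilities\<close>

lemma bracket_sum:
  assumes "A \<in> carrier_mat n m" "u \<in> carrier_vec n" "v \<in> carrier_vec m"
  shows "bracket u A v = (\<Sum>i<n. \<Sum>j<m. cnj (u $ i) * A $$ (i, j) * v $ j)"
proof -
  have "bracket u A v = (\<Sum>i<n. (\<Sum>j<m. A $$ (i, j) * v $ j) * cnj (u $ i))"
    using assms unfolding bracket_def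
    by (auto simp: scalar_prod_def lessThan_atLeast0 intro!: sum.cong)
  also have "\<dots> = (\<Sum>i<n. \<Sum>j<m. cnj (u $ i) * A $$ (i, j) * v $ j)"
    by (simp add: sum_distrib_left sum_distrib_right mult.commute mult.left_commute)
  finally show ?thesis .
qed

lemma bracket_cols:
  assumes "A \<in> carrier_mat n n" "U \<in> carrier_mat n m" "i < m" "j < m"
  shows "bracket (col U i) A (col U j) = (adj U * A * U) $$ (i, j)"
proof -
  have "(adj U * A * U) $$ (i, j) = (\<Sum>b<n. (adj U * A) $$ (i, b) * U $$ (b, j))"
    by (rule mult_index) (use assms in auto)
  also have "\<dots> = (\<Sum>b<n. (\<Sum>a<n. cnj (U $$ (a, i)) * A $$ (a, b)) * U $$ (b, j))"
  proof (rule sum.cong[OF refl])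
    fix b assume "b \<in> {..<n}"
    then have "(adj U * A) $$ (i, b) = (\<Sum>a<n. adj U $$ (i, a) * A $$ (a, b))"
      by (intro mult_index) (use assms in auto)
    also have "\<dots> = (\<Sum>a<n. cnj (U $$ (a, i)) * A $$ (a, b))"
      by (rule sum.cong) (use assms in auto)
    finally show "(adj U * A) $$ (i, b) * U $$ (b, j) = (\<Sum>a<n. cnj (U $$ (a, i)) * A $$ (a, b)) * U $$ (b, j)"
      by simp
  qed
  also have "\<dots> = (\<Sum>a<n. \<Sum>b<n. cnj (U $$ (a, i)) * A $$ (a, b) * U $$ (b, j))"
    unfolding sum_distrib_right by (rule sum.swap)
  also have "\<dots> = bracket (col U i) A (col U j)"
    by (subst bracket_sum[of _ n n]) (use assms in \<open>auto intro!: sum.cong\<close>)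
  finally show ?thesis by simp
qed

lemma bracket_conj:
  assumes "A \<in> carrier_mat n n" "C \<in> carrier_mat n m" "v \<in> carrier_vec m"
  shows "bracket v (adj C * A * C) v = bracket (C *\<^sub>v v) A (C *\<^sub>v v)"
proof -
  \<comment> \<open>As a one-column matrix the vector turns the bracket into a matrix entry, and the
    identity becomes associativity of products.\<close>
  define V where "V = Matrix.mat m 1 (\<lambda>(i,j). v $ i)"
  have V: "V \<in> carrier_mat m 1" "col V 0 = v" using assms by (auto simp: V_def intro!: eq_vecI)
  have CV: "col (C * V) 0 = C *\<^sub>v v" using V assms by (subst col_mult2[of _ n m _ 1]) auto
  have "bracket v (adj C * A * C) v = (adj V * (adj C * A * C) * V) $$ (0, 0)"
    using bracket_cols[of "adj C * A * C" m V 1 0 0] V(1) assms unfolding V(2) mem_carrier_mat by simp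
  also have "adj V * (adj C * A * C) * V = adj (C * V) * A * (C * V)"
    unfolding adj_mult[OF assms(2) V(1)]
    by (rule conj_conj[of _ 1 m _ n _ n _ m _ 1]) (use V assms in auto)
  also have "\<dots> $$ (0, 0) = bracket (C *\<^sub>v v) A (C *\<^sub>v v)"
    using bracket_cols[of A n "C * V" 1 0 0] V(1) assms CV by auto
  finally show ?thesis .
qed

lemma mtrace_mult:
  assumes "A \<in> carrier_mat n m" "B \<in> carrier_mat m n"
  shows "mtrace (A * B) = (\<Sum>i<n. \<Sum>j<m. A $$ (i, j) * B $$ (j, i))"
  unfolding mtrace_def
  by (rule sum.cong) (use assms in \<open>auto simp del: index_mult_mat(1) simp: mult_index[of A n m B n]\<close>)

lemma mtrace_comm:
  assumes "A \<in> carrier_mat n m" "B \<in> carrier_mat m n"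
  shows "mtrace (A * B) = mtrace (B * A)"
  unfolding mtrace_mult[OF assms] mtrace_mult[OF assms(2,1)]
  by (subst sum.swap) (simp add: mult.commute)

lemma psdD: "psd n A \<Longrightarrow> A \<in> carrier_mat n n" "psd n A \<Longrightarrow> hermitian n A"
  by (auto simp: psd_def hermitian_def)

lemma udiag_diagonal:
  assumes "unitary n U"
  shows "adj U * (udiag n U l) * U = rdiag n l"
  using unitary_conj_cancel(2)[OF assms, of "rdiag n l"] by simp

text \<open>The factor is \<open>sqrt (diag l) * adj U\<close>; the eigenvalues are nonnegative
  because each one is the quadratic form at a column of \<open>U\<close>.\<close>

lemma psd_gram:
  assumes "psd n A"
  shows "\<exists>C \<in> carrier_mat n n. A = adj C * C"
proof -
  obtain U l where U: "unitary n U" and A: "A = udiag n U l"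
    using spectral_theorem[of n A] psdD(2)[OF assms] by blast
  note u = unitaryD[OF U]
  have l: "l i \<ge> 0" if "i < n" for i
  proof -
    have "bracket (col U i) A (col U i) = rdiag n l $$ (i, i)"
      using bracket_cols[OF psdD(1)[OF assms] u(1) that that] udiag_diagonal[OF U, of l] A by simp
    then show ?thesis using assms u(1) that unfolding psd_def
      by (auto simp: mat_diag_def dest!: bspec[of _ _ "col U i"])
  qed
  define C where "C = rdiag n (\<lambda>i. sqrt (l i)) * adj U"
  have "adj C = U * rdiag n (\<lambda>i. sqrt (l i))" unfolding C_def
    by (subst adj_mult[of _ n n _ n]) (use u in auto)
  then have "adj C * C = U * (rdiag n (\<lambda>i. sqrt (l i)) * rdiag n (\<lambda>i. sqrt (l i))) * adj U"
    unfolding C_def by (simp add: unitary_dims[OF U] mat_dim_simps del: mat_diag_diag assoc_mult_mat)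
  also have "rdiag n (\<lambda>i. sqrt (l i)) * rdiag n (\<lambda>i. sqrt (l i)) = rdiag n l"
    unfolding mat_diag_diag using l
    by (intro eq_matI) (auto simp: mat_diag_def simp flip: of_real_mult)
  finally show ?thesis using A by (intro bexI[of _ C]) (simp_all add: C_def mem_carrier_mat unitary_dims[OF U])
qed

lemma col_adj_carrier [simp]: "C \<in> carrier_mat m n \<Longrightarrow> col (adj C) i \<in> carrier_vec n"
  using col_dim[of "adj C" i] by auto

text \<open>Cyclicity of the trace moves \<open>C\<close> to the front, so the Born probability
  becomes a sum of quadratic forms of \<open>A\<close>. Both sign lemmas below read positivity off
  this sum.\<close>

lemma born_gram:
  assumes "A \<in> carrier_mat n n" "C \<in> carrier_mat m n"
  shows "born A (adj C * C) = (\<Sum>i<m. Re (bracket (col (adj C) i) A (col (adj C) i)))"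
proof -
  have "mtrace (A * (adj C * C)) = mtrace (A * adj C * C)"
    using assms by (simp add: assoc_mult_mat[of A n n "adj C" m C n])
  also have "\<dots> = mtrace (C * (A * adj C))"
    by (rule mtrace_comm[of _ n m]) (use assms in auto)
  also have "C * (A * adj C) = adj (adj C) * A * adj C"
    using assms by (simp add: assoc_mult_mat[of C m n A n "adj C" m])
  also have "mtrace \<dots> = (\<Sum>i<m. bracket (col (adj C) i) A (col (adj C) i))"
    unfolding mtrace_def using bracket_cols[OF assms(1), of "adj C" m] assms by simp
  finally show ?thesis by (simp add: born_def)
qed

lemma born_nonneg:
  assumes "psd n A" "psd n B"
  shows "born A B \<ge> 0"
proof -
  obtain C where C: "C \<in> carrier_mat n n" "B = adj C * C" using psd_gram[OF assms(2)] by blast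
  show ?thesis unfolding C(2) born_gram[OF psdD(1)[OF assms(1)] C(1)]
    using assms(1) C(1) by (intro sum_nonneg) (auto simp: psd_def)
qed

lemma pos_def_psd: "pos_def n A \<Longrightarrow> psd n A"
proof -
  assume a: "pos_def n A"
  have "Re (bracket v A v) \<ge> 0" if "v \<in> carrier_vec n" for v
  proof (cases "v = 0\<^sub>v n")
    case True
    have "A \<in> carrier_mat n n" using a by (auto simp: pos_def_def hermitian_def)
    then show ?thesis using True by (subst bracket_sum[of _ n n]) auto
  qed (use a that in \<open>auto simp: pos_def_def intro: less_imp_le\<close>)
  then show "psd n A" using a by (auto simp: psd_def pos_def_def)
qed

text \<open>If every column of \<open>adj C\<close> vanished, then \<open>B\<close> would be zero; a
  nonzero column makes one summand of \<open>born_gram\<close> strictly positive. For faithful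
  states it follows that only zero effects have probability zero.\<close>

lemma born_pos:
  assumes "pos_def n A" "psd n B" "B \<noteq> 0\<^sub>m n n"
  shows "born A B > 0"
proof -
  obtain C where C: "C \<in> carrier_mat n n" "B = adj C * C" using psd_gram[OF assms(2)] by blast
  have A: "A \<in> carrier_mat n n" using assms(1) by (auto simp: pos_def_def hermitian_def)
  let ?c = "\<lambda>i. col (adj C) i"
  have "\<exists>i<n. ?c i \<noteq> 0\<^sub>v n"
  proof (rule ccontr)
    assume "\<not> (\<exists>i<n. ?c i \<noteq> 0\<^sub>v n)"
    then have z: "?c i = 0\<^sub>v n" if "i < n" for i using that by blast
    have "adj C = 0\<^sub>m n n"
    proof (rule eq_matI)
      fix a b assume "a < dim_row (0\<^sub>m n n)" "b < dim_col (0\<^sub>m n n)"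
      then show "adj C $$ (a, b) = 0\<^sub>m n n $$ (a, b)"
        using arg_cong[OF z[of b], of "\<lambda>v. v $ a"] C(1) by auto
    qed (use C in auto)
    then show False using assms(3) C by auto
  qed
  then obtain i where i: "i < n" "?c i \<noteq> 0\<^sub>v n" by blast
  have nn: "Re (bracket (?c i) A (?c i)) \<ge> 0" if "i < n" for i
    using pos_def_psd[OF assms(1)] C(1) by (auto simp: psd_def)
  have "Re (bracket (?c i) A (?c i)) > 0" using assms(1) i C(1) by (auto simp: pos_def_def)
  then show ?thesis unfolding C(2) born_gram[OF A C(1)]
    using i nn by (intro sum_pos2[of _ i]) auto
qed

lemma born_add:
  assumes "A \<in> carrier_mat n n" "B \<in> carrier_mat n n" "C \<in> carrier_mat n n"
  shows "born A (B + C) = born A B + born A C"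
  unfolding born_def
  by (subst (1 2 3) mtrace_mult[of _ n n])
    (use assms in \<open>auto simp: algebra_simps sum.distrib\<close>)

lemma born_diff:
  assumes "A \<in> carrier_mat n n" "B \<in> carrier_mat n n" "C \<in> carrier_mat n n"
  shows "born A (B - C) = born A B - born A C"
  unfolding born_def
  by (subst (1 2 3) mtrace_mult[of _ n n])
    (use assms in \<open>auto simp: algebra_simps sum_subtractf\<close>)

lemma born_smult:
  assumes "A \<in> carrier_mat n n" "B \<in> carrier_mat n n"
  shows "born A (of_real c \<cdot>\<^sub>m B) = c * born A B"
  unfolding born_def
  by (subst (1 2) mtrace_mult[of _ n n])
    (use assms in \<open>auto simp: algebra_simps sum_distrib_left\<close>)

lemma msum_carrier [simp]: "msum n m M \<in> carrier_mat n n"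
  by (simp add: msum_def)

lemma msum_index: "a < n \<Longrightarrow> b < n \<Longrightarrow> msum n m M $$ (a, b) = (\<Sum>y<m. M y $$ (a, b))"
  by (simp add: msum_def)

lemma born_msum:
  assumes "A \<in> carrier_mat n n" "\<And>y. y < m \<Longrightarrow> M y \<in> carrier_mat n n"
  shows "born A (msum n m M) = (\<Sum>y<m. born A (M y))"
proof -
  have "mtrace (A * msum n m M) = (\<Sum>i<n. \<Sum>j<n. \<Sum>y<m. A $$ (i, j) * M y $$ (j, i))"
    by (subst mtrace_mult[OF assms(1)]) (auto simp: msum_index sum_distrib_left)
  also have "\<dots> = (\<Sum>i<n. \<Sum>y<m. \<Sum>j<n. A $$ (i, j) * M y $$ (j, i))"
    by (rule sum.cong[OF refl]) (rule sum.swap)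
  also have "\<dots> = (\<Sum>y<m. \<Sum>i<n. \<Sum>j<n. A $$ (i, j) * M y $$ (j, i))"
    by (rule sum.swap)
  also have "\<dots> = (\<Sum>y<m. mtrace (A * M y))"
    by (rule sum.cong[OF refl]) (use assms in \<open>simp add: mtrace_mult[of _ n n]\<close>)
  finally show ?thesis by (simp add: born_def)
qed

lemma born_mono:
  assumes "psd n A" "loewner_le n B C"
  shows "born A B \<le> born A C"
  using born_nonneg[OF assms(1), of "C - B"] born_diff[OF psdD(1)[OF assms(1)], of C B] assms(2)
  by (simp add: loewner_le_def)

lemma bracket_msum:
  assumes "\<And>y. y < m \<Longrightarrow> M y \<in> carrier_mat n n" "u \<in> carrier_vec n" "v \<in> carrier_vec n"
  shows "bracket u (msum n m M) v = (\<Sum>y<m. bracket u (M y) v)"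
proof -
  have "bracket u (msum n m M) v = (\<Sum>i<n. \<Sum>j<n. \<Sum>y<m. cnj (u $ i) * M y $$ (i, j) * v $ j)"
    by (subst bracket_sum[of _ n n]) (use assms in \<open>auto simp: msum_index sum_distrib_left sum_distrib_right\<close>)
  also have "\<dots> = (\<Sum>y<m. \<Sum>i<n. \<Sum>j<n. cnj (u $ i) * M y $$ (i, j) * v $ j)"
    by (simp only: sum.swap[of _ "{..<m}"])
  also have "\<dots> = (\<Sum>y<m. bracket u (M y) v)"
    by (rule sum.cong[OF refl]) (use assms in \<open>simp add: bracket_sum[of _ n n]\<close>)
  finally show ?thesis .
qed

lemma bracket_add:
  assumes "A \<in> carrier_mat n n" "B \<in> carrier_mat n n" "u \<in> carrier_vec n" "v \<in> carrier_vec n"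
  shows "bracket u (A + B) v = bracket u A v + bracket u B v"
  by (subst (1 2 3) bracket_sum[of _ n n]) (use assms in \<open>auto simp: algebra_simps sum.distrib\<close>)

lemma bracket_diff:
  assumes "A \<in> carrier_mat n n" "B \<in> carrier_mat n n" "u \<in> carrier_vec n" "v \<in> carrier_vec n"
  shows "bracket u (A - B) v = bracket u A v - bracket u B v"
  by (subst (1 2 3) bracket_sum[of _ n n]) (use assms in \<open>auto simp: algebra_simps sum_subtractf\<close>)

lemma bracket_smult:
  assumes "A \<in> carrier_mat n n" "u \<in> carrier_vec n" "v \<in> carrier_vec n"
  shows "bracket u (c \<cdot>\<^sub>m A) v = c * bracket u A v"
  by (subst (1 2) bracket_sum[of _ n n]) (use assms in \<open>auto simp: algebra_simps sum_distrib_left\<close>)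

text \<open>The Rayleigh quotient at a column of \<open>U\<close> is the corresponding eigenvalue.
  This later keeps the eigenvalues of a whole segment of matrices inside one compact
  interval.\<close>

lemma udiag_eigenvalue_bounds:
  assumes U: "unitary n U" and i: "i < n"
    and b: "\<And>v. v \<in> carrier_vec n \<Longrightarrow>
      lo * Re (bracket v (1\<^sub>m n) v) \<le> Re (bracket v (udiag n U l) v) \<and>
      Re (bracket v (udiag n U l) v) \<le> hi * Re (bracket v (1\<^sub>m n) v)"
  shows "l i \<in> {lo..hi}"
proof -
  note u = unitaryD[OF U]
  let ?v = "col U i"
  have v: "?v \<in> carrier_vec n" using u(1) i by auto
  have c: "udiag n U l \<in> carrier_mat n n" using u by auto
  have 1: "bracket ?v (1\<^sub>m n) ?v = 1"
    using bracket_cols[of "1\<^sub>m n" n U n i i] u i by simp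
  have 2: "bracket ?v (udiag n U l) ?v = l i"
    unfolding bracket_cols[OF c u(1) i i] udiag_diagonal[OF U] using i by (simp add: mat_diag_def)
  show ?thesis using b[OF v] unfolding 1 2 by simp
qed

text \<open>In the eigenbasis an eigenvector \<open>w\<close> satisfies
  \<open>l i * w i = z * w i\<close>, and some \<open>w i\<close> is nonzero. The lemma links the
  spectral condition in the definition of operator convexity with explicit diagonalisations.\<close>

lemma udiag_spectrum:
  assumes U: "unitary n U"
  shows "spectrum (udiag n U l) \<subseteq> complex_of_real ` l ` {..<n}"
proof
  fix z assume "z \<in> spectrum (udiag n U l)"
  note u = unitaryD[OF U]
  have D: "dim_row (udiag n U l) = n" using u by auto
  obtain v where v: "v \<in> carrier_vec n" "v \<noteq> 0\<^sub>v n" "(udiag n U l) *\<^sub>v v = z \<cdot>\<^sub>v v"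
    using \<open>z \<in> _\<close> unfolding spectrum_def eigenvalue_def eigenvector_def D by auto
  define w where "w = adj U *\<^sub>v v"
  have w: "w \<in> carrier_vec n" using u(2) unfolding w_def by (rule mult_mat_vec_carrier) (rule v(1))
  have vw: "v = U *\<^sub>v w" unfolding w_def using v(1) by (simp add: unitary_cancel[OF U])
  have "w \<noteq> 0\<^sub>v n" using v(2) vw u(1) by auto
  then obtain i where i: "i < n" "w $ i \<noteq> 0" using w by (metis carrier_vecD dim_vec eq_vecI index_zero_vec(1) index_zero_vec(2))
  have "rdiag n l *\<^sub>v w = (adj U * (udiag n U l) * U) *\<^sub>v w" unfolding udiag_diagonal[OF U] ..
  also have "\<dots> = adj U *\<^sub>v ((udiag n U l) *\<^sub>v (U *\<^sub>v w))"
    using w by (simp add: mat_dim_simps unitary_dims[OF U] unitary_cancel[OF U] del: assoc_mult_mat assoc_mult_mat_vec)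
  also have "\<dots> = z \<cdot>\<^sub>v w" unfolding vw[symmetric] v(3)
    using u v by (simp add: w_def mult_mat_vec[of _ n n])
  finally have "(rdiag n l *\<^sub>v w) $ i = z * w $ i" using i w by simp
  moreover have "(rdiag n l *\<^sub>v w) $ i = (\<Sum>j<n. (if i = j then complex_of_real (l j) else 0) * w $ j)"
    using i w by (auto simp: mat_diag_def scalar_prod_def lessThan_atLeast0 intro!: sum.cong)
  moreover have "\<dots> = l i * w $ i" using i by (simp add: if_distrib[of "\<lambda>x. x * _"] cong: if_cong)
  ultimately have "z = l i" using i by simp
  then show "z \<in> complex_of_real ` l ` {..<n}" using i by auto
qed

section \<open>Operator Jensen inequality\<close>

lemma mult_lin_dim:
  fixes A B C :: "complex mat"
  shows "dim_col A = dim_row B \<Longrightarrow> dim_row B = dim_row C \<Longrightarrow> dim_col B = dim_col C \<Longrightarrow> A * (B + C) = A * B + A * C"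
    "dim_row A = dim_row B \<Longrightarrow> dim_col A = dim_col B \<Longrightarrow> dim_col A = dim_row C \<Longrightarrow> (A + B) * C = A * C + B * C"
    "dim_col A = dim_row B \<Longrightarrow> dim_row B = dim_row C \<Longrightarrow> dim_col B = dim_col C \<Longrightarrow> A * (B - C) = A * B - A * C"
    "dim_row A = dim_row B \<Longrightarrow> dim_col A = dim_col B \<Longrightarrow> dim_col A = dim_row C \<Longrightarrow> (A - B) * C = A * C - B * C"
    "dim_col A = dim_row B \<Longrightarrow> A * (c \<cdot>\<^sub>m B) = c \<cdot>\<^sub>m (A * B)"
    "dim_col A = dim_row B \<Longrightarrow> (c \<cdot>\<^sub>m A) * B = c \<cdot>\<^sub>m (A * B)"
  subgoal using mult_add_distrib_mat[of A "dim_row A" "dim_row B" B "dim_col B" C] unfolding mem_carrier_mat by metis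
  subgoal using add_mult_distrib_mat[of A "dim_row A" "dim_col A" B C "dim_col C"] unfolding mem_carrier_mat by metis
  subgoal using mult_minus_distrib_mat[of A "dim_row A" "dim_row B" B "dim_col B" C] unfolding mem_carrier_mat by metis
  subgoal using minus_mult_distrib_mat[of A "dim_row A" "dim_col A" B C "dim_col C"] unfolding mem_carrier_mat by metis
  subgoal using mult_smult_distrib[of A "dim_row A" "dim_row B" B "dim_col B" c] unfolding mem_carrier_mat by metis
  subgoal using mult_smult_assoc_mat[of A "dim_row A" "dim_col A" B "dim_col B" c] unfolding mem_carrier_mat by metis
  done

lemma adj_lin_dim:
  "dim_row A = dim_row B \<Longrightarrow> dim_col A = dim_col B \<Longrightarrow> adj (A + B) = adj A + adj B"
  "dim_row A = dim_row B \<Longrightarrow> dim_col A = dim_col B \<Longrightarrow> adj (A - B) = adj A - adj B"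
  by (rule eq_matI; simp)+

lemma hermitian_lin:
  assumes "hermitian n A" "hermitian n B"
  shows "hermitian n (A + B)" "hermitian n (A - B)"
  using assms unfolding hermitian_def mem_carrier_mat by (auto simp: adj_lin_dim)

lemma hermitian_smult: "hermitian n A \<Longrightarrow> hermitian n (of_real c \<cdot>\<^sub>m A)"
  unfolding hermitian_def mem_carrier_mat by (auto simp: adj_smult)

lemma hermitian_msum:
  assumes "\<And>y. y < m \<Longrightarrow> hermitian n (M y)"
  shows "hermitian n (msum n m M)"
  unfolding hermitian_iff
proof (intro conjI allI impI)
  fix i j assume "i < n" "j < n"
  then show "msum n m M $$ (i, j) = cnj (msum n m M $$ (j, i))"
    using hermitianD[OF assms, of _ j i] by (simp add: msum_index)
qed auto

lemma hermitian_rdiag: "hermitian n (rdiag n l)"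
  by (simp add: hermitian_def)

text \<open>An index of the dilation space is coded as \<open>k = y * n + i\<close> with outcome
  \<open>y\<close> and coordinate \<open>i < n\<close>.\<close>

lemma sum_block: "(\<Sum>k<m*n. f (k div n) (k mod n)) = (\<Sum>y<m. \<Sum>i<n. (f y i :: complex))" for m n :: nat
proof -
  have "(\<Sum>k<m*n. f (k div n) (k mod n)) = (\<Sum>y<m. \<Sum>k=y*n..<y*n+n. f (k div n) (k mod n))"
    by (rule sum.nat_group[symmetric])
  also have "\<dots> = (\<Sum>y<m. \<Sum>i<n. f y i)"
  proof (rule sum.cong[OF refl])
    fix y
    show "(\<Sum>k=y*n..<y*n+n. f (k div n) (k mod n)) = (\<Sum>i<n. f y i)"
      by (rule sum.reindex_bij_witness[of _ "\<lambda>i. y * n + i" "\<lambda>k. k - y * n"])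
        (auto simp: div_nat_eqI mult.commute minus_div_mult_eq_mod[symmetric])
  qed
  finally show ?thesis .
qed

text \<open>\<open>V\<close> stacks the factors \<open>C y\<close> on top of each other and the
  diagonal matrix is constant on each block, so the compression adds up the scaled Gram matrices of
  the blocks.\<close>

lemma block_compression:
  assumes C: "\<And>y. y < m \<Longrightarrow> C y \<in> carrier_mat n n \<and> M y = adj (C y) * C y"
    and V: "V = Matrix.mat (m * n) n (\<lambda>(k, b). C (k div n) $$ (k mod n, b))"
  shows "adj V * rdiag (m * n) (\<lambda>k. c (k div n)) * V = msum n m (\<lambda>y. of_real (c y) \<cdot>\<^sub>m M y)"
proof (rule mat_eqI[of _ n n])
  let ?R = "msum n m (\<lambda>y. of_real (c y) \<cdot>\<^sub>m M y)"
  have Vc: "V \<in> carrier_mat (m * n) n" unfolding V by auto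
  fix a b assume ab: "a < n" "b < n"
  have "(adj V * rdiag (m * n) (\<lambda>k. c (k div n)) * V) $$ (a, b)
     = (\<Sum>k<m*n. adj V $$ (a, k) * c (k div n) * cnj (adj V $$ (b, k)))"
    using udiag_index[of "adj V" n "m * n" a b] Vc ab by simp
  also have "\<dots> = (\<Sum>k<m*n. cnj (C (k div n) $$ (k mod n, a)) * c (k div n) * C (k div n) $$ (k mod n, b))"
    by (rule sum.cong) (use Vc ab in \<open>auto simp: V\<close>)
  also have "\<dots> = (\<Sum>y<m. \<Sum>i<n. cnj (C y $$ (i, a)) * c y * C y $$ (i, b))"
    by (rule sum_block)
  also have "\<dots> = ?R $$ (a, b)"
    unfolding msum_index[OF ab]
  proof (rule sum.cong[OF refl])
    fix y assume "y \<in> {..<m}"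
    then have Cy: "C y \<in> carrier_mat n n" "M y = adj (C y) * C y" using C by auto
    have "M y $$ (a, b) = (\<Sum>i<n. adj (C y) $$ (a, i) * C y $$ (i, b))"
      unfolding Cy(2) by (rule mult_index) (use Cy ab in auto)
    also have "\<dots> = (\<Sum>i<n. cnj (C y $$ (i, a)) * C y $$ (i, b))"
      by (rule sum.cong) (use Cy ab in auto)
    finally have e: "M y $$ (a, b) = (\<Sum>i<n. cnj (C y $$ (i, a)) * C y $$ (i, b))" .
    have "M y \<in> carrier_mat n n" unfolding Cy(2) using Cy(1) by auto
    then have "(of_real (c y) \<cdot>\<^sub>m M y) $$ (a, b) = c y * M y $$ (a, b)" using ab by simp
    then show "(\<Sum>i<n. cnj (C y $$ (i, a)) * c y * C y $$ (i, b)) = (of_real (c y) \<cdot>\<^sub>m M y) $$ (a, b)"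
      unfolding e by (simp add: sum_distrib_left algebra_simps)
  qed
  finally show "(adj V * rdiag (m * n) (\<lambda>k. c (k div n)) * V) $$ (a, b) = ?R $$ (a, b)" .
qed (auto simp: V)

text \<open>Naimark dilation: \<open>\<Sum> s\<^sub>y M\<^sub>y = V\<^sup>* A V\<close> for an isometry \<open>V\<close> and a diagonal \<open>A\<close>. The
  reflection \<open>W = 1 - 2 V V\<^sup>*\<close> pinches \<open>A\<close>: the midpoint \<open>X\<close> of \<open>A\<close> and \<open>W A W\<close> satisfies
  \<open>X V = V (V\<^sup>* A V)\<close>, so two-point convexity at \<open>A\<close>, \<open>W A W\<close> compresses to the claim.\<close>

theorem operator_jensen_povm:
  assumes conv: "operator_convex_on J h" and povm: "povm n m M" and s: "\<And>y. y < m \<Longrightarrow> s y \<in> J"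
  shows "loewner_le n (herm_fun n h (msum n m (\<lambda>y. of_real (s y) \<cdot>\<^sub>m M y)))
     (msum n m (\<lambda>y. of_real (h (s y)) \<cdot>\<^sub>m M y))"
proof -
  have "\<exists>C. C \<in> carrier_mat n n \<and> M y = adj C * C" if "y < m" for y
    using psd_gram[of n "M y"] povm that by (auto simp: povm_def)
  then obtain C where C: "\<And>y. y < m \<Longrightarrow> C y \<in> carrier_mat n n \<and> M y = adj (C y) * C y" by metis
  define N where "N = m * n"
  define V where "V = Matrix.mat (m * n) n (\<lambda>(k, b). C (k div n) $$ (k mod n, b))"
  have dV: "dim_row V = N" "dim_col V = n" by (auto simp: V_def N_def)
  have comp: "adj V * rdiag N (\<lambda>k. c (k div n)) * V = msum n m (\<lambda>y. of_real (c y) \<cdot>\<^sub>m M y)" for c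
    unfolding N_def by (rule block_compression[OF C V_def])
  have "msum n m (\<lambda>y. of_real 1 \<cdot>\<^sub>m M y) = msum n m M"
  proof (rule mat_eqI[of _ n n])
    fix a b assume ab: "a < n" "b < n"
    have "dim_row (M y) = n" "dim_col (M y) = n" if "y < m" for y
      using povm psdD(1)[of n "M y"] that unfolding povm_def mem_carrier_mat by auto
    with ab show "msum n m (\<lambda>y. of_real 1 \<cdot>\<^sub>m M y) $$ (a, b) = msum n m M $$ (a, b)"
      by (simp add: msum_index)
  qed auto
  \<comment> \<open>Constant scores 1 turn the compression formula into the completeness relation of
    the POVM, which says that \<open>V\<close> is an isometry.\<close>
  then have VV: "adj V * V = 1\<^sub>m n"
    using comp[of "\<lambda>_. 1"] povm by (simp add: povm_def mat_dim_simps dV)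
  have VVX: "adj V * (V * X) = X" if "dim_row X = n" for X
    using mult_assoc_dim[of "adj V" V X, symmetric] dV that by (simp only: VV adj_dim one_mult_dim)
  note simps = dV mat_dim_simps mult_lin_dim VV VVX adj_lin_dim adj_smult
  note [simp del] = assoc_mult_mat
  define W where "W = 1\<^sub>m N + (-2) \<cdot>\<^sub>m (V * adj V)"
  have dW: "dim_row W = N" "dim_col W = N" by (auto simp: W_def dV)
  have adjW: "adj W = W" unfolding W_def by (simp add: simps)
  have "W * W = 1\<^sub>m N + ((-2) \<cdot>\<^sub>m (V * adj V) + (-2) \<cdot>\<^sub>m (V * adj V + (-2) \<cdot>\<^sub>m (V * adj V)))"
    unfolding W_def by (simp add: simps)
  also have "\<dots> = 1\<^sub>m N" by (rule eq_matI) (auto simp: dV simp del: index_mult_mat(1))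
  finally have W: "unitary N W" unfolding unitary_def adjW by (simp add: dW mem_carrier_mat)
  have "W * V = V + (-2) \<cdot>\<^sub>m V" unfolding W_def by (simp add: simps)
  also have "\<dots> = (-1) \<cdot>\<^sub>m V" by (rule eq_matI) auto
  finally have WV: "W * V = (-1) \<cdot>\<^sub>m V" .
  have VW: "adj V * W = (-1) \<cdot>\<^sub>m adj V"
    using arg_cong[OF WV, of adj] by (simp add: simps dW adjW)
  have VWX: "adj V * (W * X) = (-1) \<cdot>\<^sub>m (adj V * X)" if "dim_row X = N" for X
    using mult_assoc_dim[of "adj V" W X, symmetric] dV dW that by (simp add: VW mult_lin_dim)
  define A where "A = rdiag N (\<lambda>k. s (k div n))"
  define hA where "hA = rdiag N (\<lambda>k. h (s (k div n)))"
  define A2 where "A2 = W * A * adj W"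
  define X where "X = of_real (1 - 1/2) \<cdot>\<^sub>m A + of_real (1/2) \<cdot>\<^sub>m A2"
  define G where "G = msum n m (\<lambda>y. of_real (s y) \<cdot>\<^sub>m M y)"
  have dA: "dim_row A = N" "dim_col A = N" "dim_row hA = N" "dim_col hA = N" by (auto simp: A_def hA_def)
  have GA: "G = adj V * A * V" unfolding G_def A_def comp[symmetric] ..
  have HGA: "msum n m (\<lambda>y. of_real (h (s y)) \<cdot>\<^sub>m M y) = adj V * hA * V"
    unfolding hA_def comp[symmetric] ..
  have one: "unitary N (1\<^sub>m N)" by (simp add: unitary_def)
  have sJ: "(\<lambda>k. s (k div n)) ` {..<N} \<subseteq> J"
    using s by (auto simp: N_def intro!: s less_mult_imp_div_less)
  have A1: "A = 1\<^sub>m N * rdiag N (\<lambda>k. s (k div n)) * adj (1\<^sub>m N)" by (simp add: A_def)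
  have hA1: "herm_fun N h A = hA"
    unfolding A1 herm_fun_udiag[OF one] by (simp add: hA_def)
  have hA2: "herm_fun N h A2 = W * hA * adj W"
    unfolding A2_def A_def hA_def by (rule herm_fun_udiag[OF W])
  have herA: "hermitian N A" "hermitian N hA" unfolding A_def hA_def by (rule hermitian_rdiag)+
  have herA2: "hermitian N A2" unfolding A2_def A_def by (rule udiag_hermitian) (simp add: mem_carrier_mat dW)
  have spA: "spectrum A \<subseteq> complex_of_real ` J"
    using udiag_spectrum[OF one, of "\<lambda>k. s (k div n)"] sJ unfolding A1 by blast
  have spA2: "spectrum A2 \<subseteq> complex_of_real ` J"
    using udiag_spectrum[OF W, of "\<lambda>k. s (k div n)"] sJ unfolding A2_def A_def by blast
  define Y where "Y = of_real (1 - 1/2) \<cdot>\<^sub>m hA + of_real (1/2) \<cdot>\<^sub>m (W * hA * adj W)"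
  have le: "loewner_le N (herm_fun N h X) Y"
    using conv[unfolded operator_convex_on_def, rule_format, of "1/2" N A A2] herA herA2 spA spA2
    unfolding X_def Y_def hA1 hA2 by simp
  have herX: "hermitian N X" unfolding X_def by (intro hermitian_lin(1) hermitian_smult herA herA2)
  have herG: "hermitian n G" unfolding GA
    by (rule hermitian_conj[OF herA(1)]) (simp add: mem_carrier_mat dV)
  obtain U1 l1 where U1: "unitary N U1" "X = udiag N U1 l1" using spectral_theorem[OF herX] by blast
  obtain U2 l2 where U2: "unitary n U2" "G = udiag n U2 l2" using spectral_theorem[OF herG] by blast
  \<comment> \<open>Because \<open>W * V = - V\<close>, the reflected half contributes
    \<open>- W * (A * V) / 2\<close>. Expanding the reflection gives \<open>A * V - 2 V * G\<close>
    for \<open>W * (A * V)\<close>, so the terms \<open>A * V\<close> cancel and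
    \<open>V * G\<close> is left.\<close>
  have "X * V = of_real (1 - 1/2) \<cdot>\<^sub>m (A * V) + of_real (1/2) \<cdot>\<^sub>m ((-1) \<cdot>\<^sub>m (W * (A * V)))"
    unfolding X_def A2_def by (simp add: simps dW dA adjW WV)
  also have "W * (A * V) = A * V + (-2) \<cdot>\<^sub>m (V * G)"
    unfolding W_def GA by (simp add: simps dA)
  also have "of_real (1 - 1/2) \<cdot>\<^sub>m (A * V) + of_real (1/2) \<cdot>\<^sub>m ((-1) \<cdot>\<^sub>m (A * V + (-2) \<cdot>\<^sub>m (V * G))) = V * G"
    by (rule eq_matI) (auto simp: dV dA GA algebra_simps simp del: index_mult_mat(1))
  finally have XV: "X * V = V * G" .
  \<comment> \<open>Compression does not commute with \<open>h\<close> in general; for the pinched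
    matrix \<open>X\<close> it does, because \<open>V\<close> intertwines \<open>X\<close> with
    \<open>G\<close> and hence \<open>h(X)\<close> with \<open>h(G)\<close>.\<close>
  have "(udiag N U1 (\<lambda>i. h (l1 i))) * V = V * (udiag n U2 (\<lambda>i. h (l2 i)))"
  proof (rule functional_calculus_intertwines[OF U1(1) U2(1), where h = h and ?l1.0 = l1 and ?l2.0 = l2])
    show "V \<in> carrier_mat N n" by (simp add: mem_carrier_mat dV)
    show "(udiag N U1 l1) * V = V * (udiag n U2 l2)"
      unfolding U1(2)[symmetric] U2(2)[symmetric] by (rule XV)
  qed
  then have hXV: "herm_fun N h X * V = V * herm_fun n h G"
    unfolding U1(2) U2(2) herm_fun_udiag[OF U1(1)] herm_fun_udiag[OF U2(1)] .
  have herhX: "hermitian N (herm_fun N h X)" and herhG: "hermitian n (herm_fun n h G)"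
    unfolding U1(2) U2(2) herm_fun_udiag[OF U1(1)] herm_fun_udiag[OF U2(1)]
    by (rule udiag_hermitian[OF unitaryD(1)[OF U1(1)]], rule udiag_hermitian[OF unitaryD(1)[OF U2(1)]])
  have dX: "dim_row (herm_fun N h X) = N" "dim_col (herm_fun N h X) = N"
    "dim_row (herm_fun n h G) = n" "dim_col (herm_fun n h G) = n"
    using herhX herhG by (auto simp: hermitian_def)
  have dY: "dim_row Y = N" "dim_col Y = N" by (auto simp: Y_def dA dW adjW)
  \<comment> \<open>The two signs from \<open>W * V = - V\<close> cancel, so both halves of
    \<open>Y\<close> compress to the same matrix.\<close>
  have "adj V * Y * V = of_real (1 - 1/2) \<cdot>\<^sub>m (adj V * hA * V) + of_real (1/2) \<cdot>\<^sub>m ((-1) \<cdot>\<^sub>m ((-1) \<cdot>\<^sub>m (adj V * hA * V)))"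
    unfolding Y_def by (simp add: simps dW dA adjW WV VWX)
  also have "\<dots> = adj V * hA * V"
    by (rule eq_matI) (auto simp: dV dA algebra_simps simp del: index_mult_mat(1))
  finally have "adj V * (Y - herm_fun N h X) * V = adj V * hA * V - herm_fun n h G"
    by (simp add: simps dX dY dA hXV)
  moreover have "psd n (adj V * (Y - herm_fun N h X) * V)"
    unfolding psd_def
  proof (intro conjI ballI)
    have Yc: "hermitian N (Y - herm_fun N h X)" using le unfolding loewner_le_def psd_def by blast
    show "hermitian n (adj V * (Y - herm_fun N h X) * V)"
      by (rule hermitian_conj[OF Yc]) (simp add: mem_carrier_mat dV)
    fix v :: "complex vec" assume v: "v \<in> carrier_vec n"
    have e: "bracket v (adj V * (Y - herm_fun N h X) * V) v = bracket (V *\<^sub>v v) (Y - herm_fun N h X) (V *\<^sub>v v)"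
      by (rule bracket_conj[of _ N _ n]) (use v in \<open>simp_all add: mem_carrier_mat dV dX dY\<close>)
    have "V *\<^sub>v v \<in> carrier_vec N" unfolding carrier_vec_def by (simp add: dV)
    then show "0 \<le> Re (bracket v (adj V * (Y - herm_fun N h X) * V) v)"
      unfolding e using le unfolding loewner_le_def psd_def by blast
  qed
  ultimately show ?thesis
    unfolding loewner_le_def G_def[symmetric] HGA by (simp add: mem_carrier_mat dX dV)
qed

section \<open>Liftable generators\<close>

locale Fenchel_lift =
  fixes f :: "real \<Rightarrow> ereal" and J :: "real set" and \<psi> :: "real \<Rightarrow> real"
  assumes lift: "operator_Fenchel_lift f J \<psi>"
begin

abbreviation "F \<equiv> finite_part f"
abbreviation "F' \<equiv> deriv F"
abbreviation "\<theta> \<equiv> score_map f J \<psi>"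
abbreviation "g \<equiv> \<lambda>x. real_of_ereal (fenchel_conj f (\<psi> x))"

lemma f_finite: "t > 0 \<Longrightarrow> f t = ereal (F t)"
proof -
  assume "t > 0"
  then have "f t < \<infinity>" "f t \<noteq> -\<infinity>"
    using lift unfolding operator_Fenchel_lift_def proper_lsc_convex_def by blast+
  then show ?thesis unfolding finite_part_def by (cases "f t") auto
qed

lemma F_deriv: "t > 0 \<Longrightarrow> (F has_real_derivative F' t) (at t)"
  using lift unfolding operator_Fenchel_lift_def C2_on_def
  by (auto simp: DERIV_deriv_iff_real_differentiable)

lemma F'_deriv: "t > 0 \<Longrightarrow> (F' has_real_derivative deriv F' t) (at t)"
  using lift unfolding operator_Fenchel_lift_def C2_on_def
  by (auto simp: DERIV_deriv_iff_real_differentiable)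

lemma F''_pos: "t > 0 \<Longrightarrow> deriv F' t > 0"
  using lift unfolding operator_Fenchel_lift_def by blast

lemma F'_less:
  assumes "0 < a" "a < b"
  shows "F' a < F' b"
proof (rule DERIV_pos_imp_increasing[OF assms(2)])
  fix x assume "a \<le> x" "x \<le> b"
  then show "\<exists>y. (F' has_real_derivative y) (at x) \<and> 0 < y"
    using F'_deriv[of x] F''_pos[of x] assms by auto
qed

lemma F'_inj: "inj_on F' {0<..}"
  using F'_less by (intro linorder_inj_onI) force+

text \<open>The bound is required for all real \<open>x\<close>, since the conjugate is a supremum
  over the whole line, while differentiability is available only at positive points. On the segment
  from \<open>t\<close> to \<open>x\<close> convexity bounds the difference quotient by
  \<open>f x - F t\<close>, and small \<open>u\<close> keep the point positive, so the limit at
  \<open>t\<close> can be taken.\<close>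

lemma tangent_le:
  assumes t: "t > 0"
  shows "ereal (F t + F' t * (x - t)) \<le> f x"
proof (cases "f x")
  case (real c)
  have conv: "\<And>u. 0 < u \<Longrightarrow> u < 1 \<Longrightarrow> f ((1 - u) * t + u * x) \<le> ereal (1 - u) * f t + ereal u * f x"
    using lift unfolding operator_Fenchel_lift_def proper_lsc_convex_def by auto
  have "((\<lambda>u. F (t + u * (x - t))) has_real_derivative F' t * (x - t)) (at 0)"
    by (rule DERIV_chain2[where f = F and g = "\<lambda>u. t + u * (x - t)"])
      (use F_deriv[OF t] in \<open>auto intro!: derivative_eq_intros\<close>)
  then have "((\<lambda>u. (F (t + u * (x - t)) - F t) / u) \<longlongrightarrow> F' t * (x - t)) (at 0)"
    unfolding DERIV_def by simp
  then have lim: "((\<lambda>u. (F (t + u * (x - t)) - F t) / u) \<longlongrightarrow> F' t * (x - t)) (at_right 0)"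
    by (rule filterlim_mono) (auto simp: at_within_le_nhds intro: at_le)
  have ev1: "eventually (\<lambda>u. u < 1) (at_right (0::real))"
    by (rule eventually_at_right_real[of 0 1, THEN eventually_mono]) auto
  have "((\<lambda>u. t + u * (x - t)) \<longlongrightarrow> t) (at_right 0)"
    by (auto intro!: tendsto_eq_intros)
  then have ev2: "eventually (\<lambda>u. t + u * (x - t) > 0) (at_right 0)"
    using t by (rule order_tendstoD)
  have "eventually (\<lambda>u. (F (t + u * (x - t)) - F t) / u \<le> c - F t) (at_right 0)"
    using ev1 ev2 eventually_at_right_less[of 0]
  proof eventually_elim
    case (elim u)
    have e: "(1 - u) * t + u * x = t + u * (x - t)" by (simp add: algebra_simps)
    have "ereal (F (t + u * (x - t))) \<le> ereal ((1 - u) * F t + u * c)"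
      using conv[of u] elim f_finite[OF t] f_finite[of "t + u * (x - t)"] real unfolding e by simp
    then have "F (t + u * (x - t)) - F t \<le> u * (c - F t)" by (simp add: algebra_simps)
    then show ?case using elim by (simp add: field_simps)
  qed
  then have "F' t * (x - t) \<le> c - F t"
    by (intro tendsto_upperbound[OF lim]) auto
  then show ?thesis using real by simp
next
  case MInf
  then show ?thesis using lift unfolding operator_Fenchel_lift_def proper_lsc_convex_def by auto
qed auto

text \<open>Equality case of the Fenchel-Young inequality: the tangent at \<open>t\<close> supports
  \<open>f\<close> everywhere, so the supremum is attained at \<open>t\<close>.\<close>

lemma fenchel_conj_slope:
  assumes "t > 0"
  shows "fenchel_conj f (F' t) = ereal (t * F' t - F t)"
  unfolding fenchel_conj_def
proof (rule antisym)
  show "(SUP x. ereal (x * F' t) - f x) \<le> ereal (t * F' t - F t)"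
  proof (rule SUP_least)
    fix x show "ereal (x * F' t) - f x \<le> ereal (t * F' t - F t)"
      using tangent_le[OF assms, of x] by (cases "f x") (auto simp: algebra_simps)
  qed
  show "ereal (t * F' t - F t) \<le> (SUP x. ereal (x * F' t) - f x)"
    by (rule SUP_upper2[of t]) (use f_finite[OF assms] in auto)
qed

lemma conj_domain_eq: "conj_domain_interior f = F' ` {0<..}"
  and lift_bij: "bij_betw \<psi> J (conj_domain_interior f)"
  and interval_J: "is_interval J"
  and \<psi>_concave: "operator_concave_on J \<psi>" and g_convex: "operator_convex_on J g"
  using lift unfolding operator_Fenchel_lift_def by blast+

lemma score_in: "t > 0 \<Longrightarrow> \<theta> t \<in> J"
  and \<psi>_score: "t > 0 \<Longrightarrow> \<psi> (\<theta> t) = F' t"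
proof -
  assume "t > 0"
  then have "F' t \<in> \<psi> ` J" using lift_bij conj_domain_eq by (auto simp: bij_betw_def)
  moreover have "inj_on \<psi> J" using lift_bij by (auto simp: bij_betw_def)
  ultimately show "\<theta> t \<in> J" "\<psi> (\<theta> t) = F' t"
    unfolding score_map_def by (auto intro: the_inv_into_into f_the_inv_into_f)
qed

lemma score_inj: "inj_on \<theta> {0<..}"
proof (rule inj_onI)
  fix x y assume "x \<in> {0<..}" "y \<in> {0<..}" "\<theta> x = \<theta> y"
  then have "F' x = F' y" using \<psi>_score[of x] \<psi>_score[of y] by simp
  then show "x = y" by (rule inj_onD[OF F'_inj]) fact+
qed

lemma score_eq_iff: "a > 0 \<Longrightarrow> b > 0 \<Longrightarrow> \<theta> a = \<theta> b \<longleftrightarrow> a = b"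
  using inj_on_eq_iff[OF score_inj] by auto

lemma g_score: "t > 0 \<Longrightarrow> g (\<theta> t) = t * F' t - F t"
  by (simp add: \<psi>_score fenchel_conj_slope)

lemma \<psi>_deriv: "x \<in> J \<Longrightarrow> (\<psi> has_real_derivative deriv \<psi> x) (at x)"
  using lift unfolding operator_Fenchel_lift_def C2_on_def
  by (auto simp: DERIV_deriv_iff_real_differentiable)

text \<open>Near \<open>F' t\<close> the conjugate is \<open>\<tau> z * z - F (\<tau> z)\<close>
  with \<tau> the inverse of \<open>F'\<close>. In its derivative the two terms containing the
  derivative of \<tau> cancel because \<open>F' (\<tau> z) = z\<close> there, and
  \<open>\<tau> (F' t) = t\<close> remains.\<close>

lemma conj_deriv:
  assumes t: "t > 0"
  shows "((\<lambda>z. real_of_ereal (fenchel_conj f z)) has_real_derivative t) (at (F' t))"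
proof -
  define \<tau> where "\<tau> = the_inv_into {0<..} F'"
  have \<tau>F': "\<tau> (F' x) = x" if "x > 0" for x
    unfolding \<tau>_def using the_inv_into_f_f[OF F'_inj] that by auto
  \<comment> \<open>The points \<open>t/2\<close> and \<open>2*t\<close> bracket \<open>t\<close>
    inside the positive half-line, so their slopes bound a neighbourhood of \<open>F' t\<close> on
    which \<tau> inverts \<open>F'\<close>.\<close>
  have surj: "\<exists>x>0. z = F' x" if "F' (t/2) < z" "z < F' (2*t)" for z
  proof -
    have "\<exists>x. t/2 \<le> x \<and> x \<le> 2*t \<and> F' x = z"
      by (rule IVT) (use that t in \<open>auto intro!: DERIV_isCont F'_deriv\<close>)
    then show ?thesis using t by (metis half_gt_zero less_le_trans)
  qed
  have lt: "F' (t/2) < F' t" "F' t < F' (2*t)" using F'_less[of "t/2" t] F'_less[of t "2*t"] t by simp_all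
  have cont: "isCont \<tau> (F' t)"
  proof (rule isCont_inverse_function[where d = "t/2" and f = F' and x = t])
    fix z assume "\<bar>z - t\<bar> \<le> t/2"
    then have "z > 0" using t by linarith
    then show "\<tau> (F' z) = z" "isCont F' z" using \<tau>F' F'_deriv by (auto intro: DERIV_isCont)
  qed (use t in auto)
  have "(\<tau> has_real_derivative inverse (deriv F' t)) (at (F' t))"
  proof (rule DERIV_inverse_function[where f = F' and a = "F' (t/2)" and b = "F' (2*t)"])
    show "(F' has_real_derivative deriv F' t) (at (\<tau> (F' t)))" using \<tau>F' F'_deriv t by simp
    fix y assume "F' (t/2) < y" "y < F' (2*t)"
    then show "F' (\<tau> y) = y" using surj[of y] \<tau>F' by force
  qed (use lt cont F''_pos[OF t] in auto)
  then have \<tau>': "(\<tau> has_real_derivative inverse (deriv F' t)) (at (F' t))" .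
  have F\<tau>: "((\<lambda>z. F (\<tau> z)) has_real_derivative F' t * inverse (deriv F' t)) (at (F' t))"
    by (rule DERIV_chain2[where f = F and g = \<tau>]) (use \<tau>F'[OF t] F_deriv[OF t] \<tau>' in auto)
  have "((\<lambda>z. \<tau> z * z - F (\<tau> z)) has_real_derivative t) (at (F' t))"
    by (rule derivative_eq_intros \<tau>' F\<tau> refl)+ (simp add: \<tau>F'[OF t])
  then show ?thesis
  proof (rule DERIV_cong_ev[OF refl _ refl, THEN iffD1, rotated])
    have "eventually (\<lambda>z. z \<in> {F' (t/2)<..<F' (2*t)}) (nhds (F' t))"
      by (rule eventually_nhds_in_open) (use lt in auto)
    then show "eventually (\<lambda>z. \<tau> z * z - F (\<tau> z) = real_of_ereal (fenchel_conj f z)) (nhds (F' t))"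
    proof eventually_elim
      case (elim z)
      then obtain x where "x > 0" "z = F' x" using surj[of z] by auto
      then show ?case by (simp add: \<tau>F' fenchel_conj_slope)
    qed
  qed
qed

lemma g_deriv:
  assumes "t > 0"
  shows "(g has_real_derivative t * deriv \<psi> (\<theta> t)) (at (\<theta> t))"
  by (rule DERIV_chain2[where f = "\<lambda>z. real_of_ereal (fenchel_conj f z)" and g = \<psi>])
    (use conj_deriv[OF assms] \<psi>_deriv[OF score_in[OF assms]] \<psi>_score[OF assms] in auto)

lemma score_surj:
  assumes "x \<in> J"
  shows "\<exists>t>0. x = \<theta> t"
proof -
  have "\<psi> x \<in> F' ` {0<..}" using bij_betwE[OF lift_bij] assms unfolding conj_domain_eq by blast
  then obtain t where t: "t > 0" "\<psi> x = F' t" by auto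
  have "inj_on \<psi> J" using lift_bij by (auto simp: bij_betw_def)
  then have "x = \<theta> t"
    by (rule inj_onD) (simp_all add: t \<psi>_score score_in assms)
  then show ?thesis using t by blast
qed

text \<open>The derivative of \<open>g\<close> is known at scores; by \<open>score_surj\<close>
  every point of \<open>J\<close> is a score.\<close>

lemma g_continuous: "x \<in> J \<Longrightarrow> isCont g x" and \<psi>_continuous: "x \<in> J \<Longrightarrow> isCont \<psi> x"
  using score_surj[of x] g_deriv \<psi>_deriv by (auto intro: DERIV_isCont)

end

section \<open>Two-level rotations\<close>

lemma bracket_lin:
  assumes "A \<in> carrier_mat n n" "u \<in> carrier_vec n" "v \<in> carrier_vec n" "w \<in> carrier_vec n"
  shows "bracket (u + v) A w = bracket u A w + bracket v A w"
    "bracket w A (u + v) = bracket w A u + bracket w A v"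
    "bracket (c \<cdot>\<^sub>v u) A w = cnj c * bracket u A w"
    "bracket w A (c \<cdot>\<^sub>v u) = c * bracket w A u"
  using assms by (simp_all add: bracket_sum[of _ n n] algebra_simps sum.distrib sum_distrib_left)

lemma bracket_cnj:
  assumes "hermitian n A" "u \<in> carrier_vec n" "v \<in> carrier_vec n"
  shows "cnj (bracket u A v) = bracket v A u"
proof -
  have A: "A \<in> carrier_mat n n" using assms by (simp add: hermitian_def)
  have "cnj (bracket u A v) = (\<Sum>i<n. \<Sum>j<n. cnj (v $ j) * A $$ (j, i) * u $ i)"
    unfolding bracket_sum[OF A assms(2,3)]
    by (simp add: hermitianD[OF assms(1)] mult.commute mult.left_commute)
  also have "\<dots> = bracket v A u" unfolding bracket_sum[OF A assms(3,2)] by (rule sum.swap)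
  finally show ?thesis .
qed

lemma basis_pvm_carrier [simp]: "basis_pvm d e l \<in> carrier_mat d d"
  by (simp add: basis_pvm_def)

lemma born_basis_pvm:
  assumes "A \<in> carrier_mat d d" "e l \<in> carrier_vec d"
  shows "born A (basis_pvm d e l) = Re (bracket (e l) A (e l))"
proof -
  have "mtrace (A * basis_pvm d e l) = (\<Sum>i<d. \<Sum>j<d. A $$ (i, j) * basis_pvm d e l $$ (j, i))"
    by (rule mtrace_mult) (use assms in auto)
  also have "\<dots> = bracket (e l) A (e l)"
    unfolding bracket_sum[OF assms(1,2,2)]
    by (intro sum.cong refl) (simp add: basis_pvm_def algebra_simps)
  finally show ?thesis by (simp add: born_def)
qed

lemma orthonormalD:
  assumes "orthonormal_basis d e" "j < d"
  shows "e j \<in> carrier_vec d" "k < d \<Longrightarrow> e j \<bullet>c e k = (if j = k then 1 else 0)" "e j \<noteq> 0\<^sub>v d"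
proof -
  show c: "e j \<in> carrier_vec d" and ip: "k < d \<Longrightarrow> e j \<bullet>c e k = (if j = k then 1 else 0)" for k
    using assms unfolding orthonormal_basis_def by blast+
  show "e j \<noteq> 0\<^sub>v d"
  proof
    assume "e j = 0\<^sub>v d"
    with ip[OF assms(2)] show False by simp
  qed
qed

lemma bracket_one: "u \<in> carrier_vec d \<Longrightarrow> v \<in> carrier_vec d \<Longrightarrow> bracket u (1\<^sub>m d) v = v \<bullet>c u"
  by (simp add: bracket_def)

lemma born_basis_pvm_pos:
  assumes "pos_def d A" "orthonormal_basis d e" "l < d"
  shows "born A (basis_pvm d e l) > 0"
proof -
  have "A \<in> carrier_mat d d" using assms(1) by (auto simp: pos_def_def hermitian_def)
  then show ?thesis
    using assms(1) orthonormalD[OF assms(2,3)] by (simp add: born_basis_pvm pos_def_def)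
qed

text \<open>An outcome probability along a two-level rotation: \<open>p\<close> and
  \<open>p'\<close> are the diagonal entries and \<open>a\<close> is the real part of the
  off-diagonal entry times the phase. The quadratic form of the rotated vector is written in the
  double angle, which makes differentiation immediate.\<close>

definition rot :: "real \<Rightarrow> real \<Rightarrow> real \<Rightarrow> real \<Rightarrow> real" where
  "rot p p' a x = (p + p') / 2 + (p - p') / 2 * cos (2 * x) + a * sin (2 * x)"

definition rot_deriv :: "real \<Rightarrow> real \<Rightarrow> real \<Rightarrow> real \<Rightarrow> real" where
  "rot_deriv p p' a x = (p' - p) * sin (2 * x) + 2 * a * cos (2 * x)"

lemma rot_has_derivative: "(rot p p' a has_real_derivative rot_deriv p p' a x) (at x)"
  unfolding rot_def[abs_def] rot_deriv_def
  by (auto intro!: derivative_eq_intros simp: field_simps)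

lemma rot_deriv_has_derivative: "(rot_deriv p p' a has_real_derivative 2 * (p' - p)) (at 0)"
  unfolding rot_deriv_def[abs_def]
  by (auto intro!: derivative_eq_intros)

lemma rot_0 [simp]: "rot p p' a 0 = p" and rot_deriv_0 [simp]: "rot_deriv p p' a 0 = 2 * a"
  by (auto simp: rot_def rot_deriv_def field_simps)

lemma rot_alt: "rot p p' a x = p * (cos x)\<^sup>2 + p' * (sin x)\<^sup>2 + 2 * (cos x * sin x) * a"
  unfolding rot_def cos_double_sin sin_double cos_squared_eq by (simp add: field_simps)

lemma two_level_carrier:
  assumes "orthonormal_basis d e" "j < d" "k < d" "l < d"
  shows "two_level_rotation e j k \<phi> x l \<in> carrier_vec d"
  using orthonormalD(1)[OF assms(1)] assms by (auto simp: two_level_rotation_def)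

lemma two_level_vec:
  assumes "j \<noteq> k" and r: "r = two_level_rotation e j k \<phi> x"
    and cs: "c = complex_of_real (cos x)" "s = complex_of_real (sin x)" and w: "w = cis \<phi>"
  shows "r j = c \<cdot>\<^sub>v e j + (w * s) \<cdot>\<^sub>v e k" "r k = (- cnj w * s) \<cdot>\<^sub>v e j + c \<cdot>\<^sub>v e k"
  using assms(1) unfolding r two_level_rotation_def cs w by (simp_all add: cis_cnj)

lemma two_level_bracket_left_right:
  assumes e: "orthonormal_basis d e" and jk: "j < d" "k < d" "j \<noteq> k" and A: "A \<in> carrier_mat d d"
    and r: "r = two_level_rotation e j k \<phi> x"
    and cs: "c = complex_of_real (cos x)" "s = complex_of_real (sin x)" and w: "w = cis \<phi>"
    and u: "u \<in> carrier_vec d"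
  shows "bracket u A (r j) = c * bracket u A (e j) + s * w * bracket u A (e k)"
    and "bracket u A (r k) = c * bracket u A (e k) - s * cnj w * bracket u A (e j)"
    and "bracket (r j) A u = c * bracket (e j) A u + s * cnj w * bracket (e k) A u"
    and "bracket (r k) A u = c * bracket (e k) A u - s * w * bracket (e j) A u"
  unfolding two_level_vec[OF jk(3) r cs w]
  using orthonormalD(1)[OF e jk(1)] orthonormalD(1)[OF e jk(2)] u
  by (simp_all add: bracket_lin[OF A]) (simp_all add: cs del: cos_of_real sin_of_real)

lemma cis_cnj_cancel:
  "cis \<phi> * cnj (cis \<phi>) = 1" "cnj (cis \<phi>) * cis \<phi> = 1"
  "cis \<phi> * (cnj (cis \<phi>) * z) = z" "cnj (cis \<phi>) * (cis \<phi> * z) = z"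
  by (simp_all add: cis_cnj cis_mult flip: mult.assoc)

lemma two_level_bracket:
  assumes e: "orthonormal_basis d e" and jk: "j < d" "k < d" "j \<noteq> k" and A: "A \<in> carrier_mat d d"
    and r: "r = two_level_rotation e j k \<phi> x"
    and cs: "c = complex_of_real (cos x)" "s = complex_of_real (sin x)" and w: "w = cis \<phi>"
    and b: "b = (\<lambda>l l'. bracket (e l) A (e l'))"
  shows "bracket (r j) A (r j) = c\<^sup>2 * b j j + s\<^sup>2 * b k k + c * s * (w * b j k + cnj w * b k j)"
    and "bracket (r k) A (r k) = c\<^sup>2 * b k k + s\<^sup>2 * b j j - c * s * (w * b j k + cnj w * b k j)"
    and "bracket (r j) A (r k) = c\<^sup>2 * b j k - (cnj w)\<^sup>2 * s\<^sup>2 * b k j + c * s * cnj w * (b k k - b j j)"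
    and "bracket (r k) A (r j) = c\<^sup>2 * b k j - w\<^sup>2 * s\<^sup>2 * b j k + c * s * w * (b k k - b j j)"
  using two_level_carrier[OF e jk(1,2) jk(1)] two_level_carrier[OF e jk(1,2) jk(2)]
    orthonormalD(1)[OF e jk(1)] orthonormalD(1)[OF e jk(2)] unfolding r
  by (simp_all add: two_level_bracket_left_right[OF e jk A refl cs w] cis_cnj_cancel[of \<phi>, folded w]
      b power2_eq_square algebra_simps)

lemma two_level_other: "l \<noteq> j \<Longrightarrow> l \<noteq> k \<Longrightarrow> two_level_rotation e j k \<phi> x l = e l"
  by (simp add: two_level_rotation_def)

text \<open>Inner products are brackets of the identity matrix, so the general expansion of rotated
  brackets also settles orthonormality.\<close>

lemma two_level_orthonormal:
  assumes e: "orthonormal_basis d e" and jk: "j < d" "k < d" "j \<noteq> k"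
  shows "orthonormal_basis d (two_level_rotation e j k \<phi> x)"
proof -
  let ?r = "two_level_rotation e j k \<phi> x"
  have o: "bracket (e a) (1\<^sub>m d) (e b) = (if a = b then 1 else 0)" if "a < d" "b < d" for a b
    using that orthonormalD[OF e] by (simp add: bracket_one)
  have cs: "(complex_of_real (cos x))\<^sup>2 + (complex_of_real (sin x))\<^sup>2 = 1"
    by (simp only: of_real_add[symmetric] of_real_power[symmetric] sin_cos_squared_add2 of_real_1)
  have r: "bracket (?r a) (1\<^sub>m d) (?r b) = (if a = b then 1 else 0)" if ab: "a < d" "b < d" for a b
  proof -
    note tl = two_level_bracket[OF e jk one_carrier_mat refl refl refl refl refl, where \<phi> = \<phi> and x = x]
      two_level_bracket_left_right[OF e jk one_carrier_mat refl refl refl refl, where \<phi> = \<phi> and x = x]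
    note c = orthonormalD(1)[OF e]
    consider "a = j" "b = j" | "a = j" "b = k" | "a = j" "b \<noteq> j" "b \<noteq> k"
      | "a = k" "b = j" | "a = k" "b = k" | "a = k" "b \<noteq> j" "b \<noteq> k"
      | "a \<noteq> j" "a \<noteq> k" "b = j" | "a \<noteq> j" "a \<noteq> k" "b = k" | "a \<noteq> j" "a \<noteq> k" "b \<noteq> j" "b \<noteq> k" by blast
    then show ?thesis
      by cases (use jk ab cs in \<open>simp_all add: tl o c two_level_other add.commute del: cos_of_real sin_of_real\<close>)
  qed
  show ?thesis unfolding orthonormal_basis_def
    using r two_level_carrier[OF e jk(1,2)] by (simp add: bracket_one)
qed

text \<open>By hermiticity the cross term is a number plus its conjugate, hence
  \<open>2 * a\<close>. The minus sign in the second rotated vector exchanges the diagonal entries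
  and reverses \<open>a\<close>.\<close>

lemma born_two_level:
  assumes e: "orthonormal_basis d e" and jk: "j < d" "k < d" "j \<noteq> k" and A: "hermitian d A"
    and b_def: "b = (\<lambda>l. born A (basis_pvm d e l))" and a_def: "a = Re (cis \<phi> * bracket (e j) A (e k))"
  shows "born A (basis_pvm d (two_level_rotation e j k \<phi> x) j) = rot (b j) (b k) a x"
    and "born A (basis_pvm d (two_level_rotation e j k \<phi> x) k) = rot (b k) (b j) (- a) x"
    and "l < d \<Longrightarrow> l \<noteq> j \<Longrightarrow> l \<noteq> k \<Longrightarrow> born A (basis_pvm d (two_level_rotation e j k \<phi> x) l) = b l"
proof -
  have Ac: "A \<in> carrier_mat d d" using A by (simp add: hermitian_def)
  note c = orthonormalD(1)[OF e jk(1)] orthonormalD(1)[OF e jk(2)]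
  have "cnj (cis \<phi> * bracket (e j) A (e k)) = cnj (cis \<phi>) * bracket (e k) A (e j)"
    by (simp add: bracket_cnj[OF A c])
  then have "Re (cnj (cis \<phi>) * bracket (e k) A (e j)) = a" unfolding a_def by (metis complex_cnj(1) cnj.simps(1))
  then have R: "Re (cis \<phi> * bracket (e j) A (e k) + cnj (cis \<phi>) * bracket (e k) A (e j)) = 2 * a"
    unfolding a_def by (simp only: plus_complex.simps)
  have bj: "Re (bracket (e j) A (e j)) = b j" "Re (bracket (e k) A (e k)) = b k"
    unfolding b_def by (simp_all add: born_basis_pvm Ac c)
  have Rm: "Re (complex_of_real y * z) = y * Re z" for y z by simp
  note tl = two_level_bracket(1,2)[OF e jk Ac refl refl refl refl refl, where \<phi> = \<phi> and x = x,
      folded of_real_power of_real_mult]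
  show "born A (basis_pvm d (two_level_rotation e j k \<phi> x) j) = rot (b j) (b k) a x"
    by (simp only: born_basis_pvm[where e = "two_level_rotation e j k \<phi> x" and l = j, OF Ac two_level_carrier[OF e jk(1,2,1)]] tl
        plus_complex.simps minus_complex.simps Rm R[unfolded plus_complex.simps] bj rot_alt)
       (simp add: algebra_simps)
  show "born A (basis_pvm d (two_level_rotation e j k \<phi> x) k) = rot (b k) (b j) (- a) x"
    by (simp only: born_basis_pvm[where e = "two_level_rotation e j k \<phi> x" and l = k, OF Ac two_level_carrier[OF e jk(1,2,2)]] tl
        plus_complex.simps minus_complex.simps Rm R[unfolded plus_complex.simps] bj rot_alt)
       (simp add: algebra_simps)
  show "l < d \<Longrightarrow> l \<noteq> j \<Longrightarrow> l \<noteq> k \<Longrightarrow> born A (basis_pvm d (two_level_rotation e j k \<phi> x) l) = b l"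
    by (simp add: b_def basis_pvm_def two_level_other)
qed

lemma two_level_0:
  assumes e: "orthonormal_basis d e" and jk: "j < d" "k < d" "j \<noteq> k" and l: "l < d"
  shows "two_level_rotation e j k \<phi> 0 l = e l"
proof -
  note c = orthonormalD(1)[OF e jk(1)] orthonormalD(1)[OF e jk(2)]
  show ?thesis
    by (rule eq_vecI) (use carrier_vecD[OF c(1)] carrier_vecD[OF c(2)] jk in \<open>auto simp: two_level_rotation_def\<close>)
qed

context Fenchel_lift
begin

text \<open>Directional derivative at \<open>(p, q)\<close> of the perspective
  \<open>q * F (p / q)\<close> in the direction \<open>(p', q')\<close>. Its coefficients depend on
  the ratio \<open>p / q\<close> alone.\<close>

definition term_deriv :: "real \<Rightarrow> real \<Rightarrow> real \<Rightarrow> real \<Rightarrow> real" where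
  "term_deriv p q p' q' = q' * (F (p / q) - p / q * F' (p / q)) + p' * F' (p / q)"

lemma div_term_has_derivative:
  assumes p: "(p has_real_derivative p') (at x)" and q: "(q has_real_derivative q') (at x)"
    and pos: "p x > 0" "q x > 0"
  shows "((\<lambda>y. q y * F (p y / q y)) has_real_derivative term_deriv (p x) (q x) p' q') (at x)"
proof -
  have r: "((\<lambda>y. p y / q y) has_real_derivative (p' * q x - p x * q') / (q x * q x)) (at x)"
    by (rule DERIV_divide[OF p q]) (use pos in auto)
  have F: "((\<lambda>y. F (p y / q y)) has_real_derivative F' (p x / q x) * ((p' * q x - p x * q') / (q x * q x))) (at x)"
    by (rule DERIV_chain2[OF F_deriv r]) (use pos in auto)
  show ?thesis
    by (rule DERIV_cong[OF DERIV_mult[OF q F]]) (use pos in \<open>simp add: term_deriv_def field_simps\<close>)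
qed

text \<open>Besides the gradient applied to the second derivatives there is the Hessian of the
  perspective. That Hessian has rank one: it sees the velocity only through
  \<open>p' - t * q'\<close>, with weight \<open>F''(t) / q\<close>.\<close>

lemma term_deriv_has_derivative:
  assumes p: "(p has_real_derivative p' x) (at x)" and q: "(q has_real_derivative q' x) (at x)"
    and p': "(p' has_real_derivative p'') (at x)" and q': "(q' has_real_derivative q'') (at x)"
    and pos: "p x > 0" "q x > 0"
  shows "((\<lambda>y. term_deriv (p y) (q y) (p' y) (q' y)) has_real_derivative
     term_deriv (p x) (q x) p'' q'' + (p' x - p x / q x * q' x)\<^sup>2 / q x * deriv F' (p x / q x)) (at x)"
proof -
  define t where "t = p x / q x"
  define D where "D = (p' x - t * q' x) / q x"
  have t: "t > 0" using pos by (simp add: t_def)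
  have r: "((\<lambda>y. p y / q y) has_real_derivative D) (at x)"
    by (rule DERIV_cong[OF DERIV_divide[OF p q]]) (use pos in \<open>auto simp: D_def t_def field_simps\<close>)
  have F1: "((\<lambda>y. F (p y / q y)) has_real_derivative F' t * D) (at x)"
    by (rule DERIV_chain2[OF _ r]) (use F_deriv[OF t] t_def in auto)
  have F2: "((\<lambda>y. F' (p y / q y)) has_real_derivative deriv F' t * D) (at x)"
    by (rule DERIV_chain2[OF _ r]) (use F'_deriv[OF t] t_def in auto)
  have "((\<lambda>y. term_deriv (p y) (q y) (p' y) (q' y)) has_real_derivative
     q'' * (F t - t * F' t) + (F' t * D - (D * F' t + deriv F' t * D * t)) * q' x
      + (p'' * F' t + deriv F' t * D * p' x)) (at x)"
    unfolding term_deriv_def t_def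
    by (rule DERIV_add DERIV_mult DERIV_diff q' p' F1[unfolded t_def] F2[unfolded t_def] r)+
  moreover have "q'' * (F t - t * F' t) + (F' t * D - (D * F' t + deriv F' t * D * t)) * q' x
      + (p'' * F' t + deriv F' t * D * p' x) = term_deriv (p x) (q x) p'' q'' + (p' x - t * q' x)\<^sup>2 / q x * deriv F' t"
  proof -
    have "(p' x - t * q' x)\<^sup>2 / q x = D * (p' x - t * q' x)" by (simp add: D_def power2_eq_square)
    then show ?thesis unfolding term_deriv_def t_def[symmetric] by (simp only:) (simp add: algebra_simps)
  qed
  ultimately show ?thesis unfolding t_def by simp
qed

end

section \<open>Orthonormal bases as unitary matrices and as POVMs\<close>

definition basis_mat :: "nat \<Rightarrow> (nat \<Rightarrow> complex vec) \<Rightarrow> complex mat" where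
  "basis_mat d e = Matrix.mat d d (\<lambda>(a, l). e l $ a)"

lemma basis_mat_carrier [simp]: "basis_mat d e \<in> carrier_mat d d"
  by (simp add: basis_mat_def)

lemma basis_mat_col:
  assumes "orthonormal_basis d e" "l < d"
  shows "col (basis_mat d e) l = e l"
  using orthonormalD(1)[OF assms] assms(2) by (intro eq_vecI) (auto simp: basis_mat_def)

lemma unitary_basis_mat:
  assumes "orthonormal_basis d e"
  shows "unitary d (basis_mat d e)"
  unfolding unitary_def
proof (intro conjI eq_matI)
  fix i j assume "i < dim_row (1\<^sub>m d)" "j < dim_col (1\<^sub>m d)"
  then have ij: "i < d" "j < d" by auto
  have "(adj (basis_mat d e) * basis_mat d e) $$ (i, j) = (adj (basis_mat d e) * 1\<^sub>m d * basis_mat d e) $$ (i, j)"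
    by (simp add: mat_dim_simps basis_mat_def)
  also have "\<dots> = bracket (e i) (1\<^sub>m d) (e j)"
    using bracket_cols[OF one_carrier_mat basis_mat_carrier ij, of e] ij
    by (simp add: basis_mat_col[OF assms])
  also have "\<dots> = (if i = j then 1 else 0)"
    using orthonormalD[OF assms] ij by (simp add: bracket_one)
  finally show "(adj (basis_mat d e) * basis_mat d e) $$ (i, j) = 1\<^sub>m d $$ (i, j)" using ij by simp
qed (simp_all add: basis_mat_def)

lemma basis_pvm_index:
  "a < d \<Longrightarrow> b < d \<Longrightarrow> basis_pvm d e l $$ (a, b) = e l $ a * cnj (e l $ b)"
  by (simp add: basis_pvm_def)

lemma udiag_basis_mat:
  assumes "orthonormal_basis d e"
  shows "udiag d (basis_mat d e) c = msum d d (\<lambda>l. of_real (c l) \<cdot>\<^sub>m basis_pvm d e l)"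
proof (rule mat_eqI[of _ d d])
  fix a b assume ab: "a < d" "b < d"
  show "(udiag d (basis_mat d e) c) $$ (a, b) = msum d d (\<lambda>l. of_real (c l) \<cdot>\<^sub>m basis_pvm d e l) $$ (a, b)"
    unfolding udiag_index[OF basis_mat_carrier ab] msum_index[OF ab]
    by (rule sum.cong) (use ab in \<open>auto simp: basis_mat_def basis_pvm_def\<close>)
qed auto

lemma basis_pvm_psd:
  assumes "e l \<in> carrier_vec d"
  shows "psd d (basis_pvm d e l)"
  unfolding psd_def
proof (intro conjI ballI)
  show "hermitian d (basis_pvm d e l)"
    unfolding hermitian_iff by (auto simp: basis_pvm_index)
  fix v :: "complex vec" assume v: "v \<in> carrier_vec d"
  have "bracket v (basis_pvm d e l) v = (\<Sum>i<d. \<Sum>j<d. (cnj (v $ i) * e l $ i) * (v $ j * cnj (e l $ j)))"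
    unfolding bracket_sum[OF basis_pvm_carrier v v]
    by (intro sum.cong refl) (simp add: basis_pvm_index)
  also have "\<dots> = (\<Sum>i<d. cnj (v $ i) * e l $ i) * cnj (\<Sum>i<d. cnj (v $ i) * e l $ i)"
    by (simp only: cnj_sum sum_product complex_cnj_mult complex_cnj_cnj)
  also have "\<dots> = complex_of_real ((cmod (\<Sum>i<d. cnj (v $ i) * e l $ i))\<^sup>2)"
    by (rule complex_norm_square[symmetric])
  finally show "0 \<le> Re (bracket v (basis_pvm d e l) v)" by simp
qed

lemma basis_pvm_povm:
  assumes "orthonormal_basis d e"
  shows "povm d d (basis_pvm d e)"
proof -
  have "msum d d (basis_pvm d e) = msum d d (\<lambda>l. of_real 1 \<cdot>\<^sub>m basis_pvm d e l)"
    by (rule arg_cong[where f = "msum d d"]) (auto intro!: ext eq_matI)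
  also have "\<dots> = 1\<^sub>m d"
    unfolding udiag_basis_mat[OF assms, symmetric]
    using unitaryD(4)[OF unitary_basis_mat[OF assms]] by (simp add: mat_dim_simps basis_mat_def)
  finally show ?thesis
    unfolding povm_def using basis_pvm_psd orthonormalD(1)[OF assms] by blast
qed

lemma pos_def_carrier: "pos_def n A \<Longrightarrow> A \<in> carrier_mat n n" "pos_def n A \<Longrightarrow> hermitian n A"
  by (auto simp: pos_def_def hermitian_def)

text \<open>A positive derivative of \<open>G1\<close> at the single point 0, together with
  \<open>G1 0 = 0\<close>, makes \<open>G1\<close> positive on some interval to the right of 0, and
  there \<open>G\<close> increases.\<close>

lemma second_order_increase:
  assumes G: "\<And>x. (G has_real_derivative G1 x) (at x)" and G1: "(G1 has_real_derivative D) (at 0)"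
    and "G1 0 = 0" "D > 0"
  shows "\<exists>\<delta>>0. \<forall>x. 0 < x \<and> x < \<delta> \<longrightarrow> G 0 < G x"
proof -
  obtain \<delta> where \<delta>: "\<delta> > 0" "\<And>h. h > 0 \<Longrightarrow> h < \<delta> \<Longrightarrow> G1 0 < G1 (0 + h)"
    using DERIV_pos_inc_right[OF G1 \<open>D > 0\<close>] by blast
  have "G 0 < G x" if "0 < x" "x < \<delta>" for x
  proof (rule DERIV_pos_imp_increasing_open[OF that(1)])
    fix y assume "0 < y" "y < x"
    then show "\<exists>z. (G has_real_derivative z) (at y) \<and> 0 < z"
      using G[of y] \<delta>(2)[of y] that \<open>G1 0 = 0\<close> by auto
  next
    show "continuous_on {0..x} G"
      by (rule DERIV_continuous_on) (rule has_field_derivative_at_within[OF G])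
  qed
  with \<delta>(1) show ?thesis by blast
qed

lemma cis_minus_Arg: "cis (- Arg z) * z = complex_of_real (cmod z)"
proof -
  have "z = complex_of_real (cmod z) * cis (Arg z)" using rcis_cmod_Arg[of z] by (simp add: rcis_def)
  then have "cis (- Arg z) * z = complex_of_real (cmod z) * (cis (- Arg z) * cis (Arg z))"
    by (metis mult.left_commute)
  then show ?thesis by (simp add: cis_mult)
qed

text \<open>The phase \<open>- Arg z\<close> makes the real part equal to the modulus of
  \<open>z\<close>. Real derivative conditions for all phases thus become one complex
  equation.\<close>

lemma cis_rotation_eq_0: "(\<And>\<phi>. Re (cis \<phi> * z) = 0) \<Longrightarrow> z = 0"
  using cis_minus_Arg[of z] by (metis Re_complex_of_real norm_eq_zero)

section \<open>Values of rank-one PVMs for two faithful states, and their variation\<close>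

locale state_pair = Fenchel_lift +
  fixes d :: nat and \<rho> \<sigma> :: "complex mat"
  assumes rho: "faithful_density d \<rho>" and sigma: "faithful_density d \<sigma>"
begin

lemma states_pos_def: "pos_def d \<rho>" "pos_def d \<sigma>" and states_psd: "psd d \<rho>" "psd d \<sigma>"
  and states_carrier: "\<rho> \<in> carrier_mat d d" "\<sigma> \<in> carrier_mat d d"
  and states_hermitian: "hermitian d \<rho>" "hermitian d \<sigma>"
proof -
  show states_pos_def: "pos_def d \<rho>" "pos_def d \<sigma>" using rho sigma by (auto simp: faithful_density_def)
  show "psd d \<rho>" "psd d \<sigma>" by (intro pos_def_psd states_pos_def)+
  show "\<rho> \<in> carrier_mat d d" "\<sigma> \<in> carrier_mat d d" by (intro pos_def_carrier states_pos_def)+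
  show "hermitian d \<rho>" "hermitian d \<sigma>" by (intro pos_def_carrier states_pos_def)+
qed

abbreviation p :: "(nat \<Rightarrow> complex vec) \<Rightarrow> nat \<Rightarrow> real" where "p e l \<equiv> born \<rho> (basis_pvm d e l)"
abbreviation q :: "(nat \<Rightarrow> complex vec) \<Rightarrow> nat \<Rightarrow> real" where "q e l \<equiv> born \<sigma> (basis_pvm d e l)"
abbreviation t :: "(nat \<Rightarrow> complex vec) \<Rightarrow> nat \<Rightarrow> real" where "t e l \<equiv> p e l / q e l"
abbreviation val :: "(nat \<Rightarrow> complex vec) \<Rightarrow> real" where "val e \<equiv> pvm_value d f \<rho> \<sigma> (basis_pvm d e)"

abbreviation defect :: "(nat \<Rightarrow> complex vec) \<Rightarrow> real \<Rightarrow> nat \<Rightarrow> nat \<Rightarrow> complex" where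
  "defect e \<tau> j k \<equiv> bracket (e j) \<rho> (e k) - complex_of_real \<tau> * bracket (e j) \<sigma> (e k)"
abbreviation rot_val :: "(nat \<Rightarrow> complex vec) \<Rightarrow> nat \<Rightarrow> nat \<Rightarrow> real \<Rightarrow> real \<Rightarrow> real" where
  "rot_val e j k \<phi> x \<equiv> val (two_level_rotation e j k \<phi> x)"

lemma pos:
  assumes "orthonormal_basis d e" "l < d"
  shows "p e l > 0" "q e l > 0" "t e l > 0"
  using born_basis_pvm_pos[OF states_pos_def(1) assms] born_basis_pvm_pos[OF states_pos_def(2) assms] by auto

lemma val_eq: "val e = (\<Sum>l<d. q e l * F (t e l))"
  by (simp add: pvm_value_def likelihood_ratio_def)

lemma div_term_pos: "a > 0 \<Longrightarrow> b > 0 \<Longrightarrow> div_term f a b = ereal (b * F (a / b))"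
  by (simp add: div_term_def f_finite)

lemma val_le_measured:
  assumes e: "orthonormal_basis d e"
  shows "ereal (val e) \<le> measured_divergence d f \<rho> \<sigma>"
proof -
  have "f_divergence f d (p e) (q e) = (\<Sum>l<d. ereal (q e l * F (t e l)))"
    unfolding f_divergence_def by (rule sum.cong) (use pos[OF e] in \<open>auto simp: div_term_pos\<close>)
  also have "\<dots> = ereal (val e)" by (simp add: val_eq)
  finally show ?thesis unfolding measured_divergence_def
    by (intro SUP_upper2[of "(d, basis_pvm d e)"]) (use basis_pvm_povm[OF e] in auto)
qed

text \<open>The derivative of the value along a rotation as an explicit function of the angle, to be
  differentiated once more at 0. Only the two rotated outcomes contribute.\<close>

definition G1 :: "(nat \<Rightarrow> complex vec) \<Rightarrow> nat \<Rightarrow> nat \<Rightarrow> real \<Rightarrow> real \<Rightarrow> real \<Rightarrow> real" where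
  "G1 e j k a b x =
     term_deriv (rot (p e j) (p e k) a x) (rot (q e j) (q e k) b x)
       (rot_deriv (p e j) (p e k) a x) (rot_deriv (q e j) (q e k) b x)
   + term_deriv (rot (p e k) (p e j) (- a) x) (rot (q e k) (q e j) (- b) x)
       (rot_deriv (p e k) (p e j) (- a) x) (rot_deriv (q e k) (q e j) (- b) x)"

context
  fixes e j k \<phi> a b
  assumes e: "orthonormal_basis d e" and jk: "j < d" "k < d" "j \<noteq> k"
    and a: "a = Re (cis \<phi> * bracket (e j) \<rho> (e k))" and b: "b = Re (cis \<phi> * bracket (e j) \<sigma> (e k))"
begin

lemma rot_pos:
  "rot (p e j) (p e k) a x > 0" "rot (p e k) (p e j) (- a) x > 0"
  "rot (q e j) (q e k) b x > 0" "rot (q e k) (q e j) (- b) x > 0"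
  unfolding a b
  using pos[OF two_level_orthonormal[OF e jk, of \<phi> x], of j] pos[OF two_level_orthonormal[OF e jk, of \<phi> x], of k] jk
  unfolding born_two_level[OF e jk states_hermitian(1) refl refl] born_two_level[OF e jk states_hermitian(2) refl refl] by blast+

lemma two_level_value_deriv:
  "(rot_val e j k \<phi> has_real_derivative G1 e j k a b x) (at x)"
proof -
  let ?rest = "\<Sum>l\<in>{..<d} - {j, k}. q e l * F (t e l)"
  have eq: "rot_val e j k \<phi> x = ?rest
     + (rot (q e j) (q e k) b x * F (rot (p e j) (p e k) a x / rot (q e j) (q e k) b x)
     + rot (q e k) (q e j) (- b) x * F (rot (p e k) (p e j) (- a) x / rot (q e k) (q e j) (- b) x))" for x
  proof -
    let ?h = "\<lambda>l. q (two_level_rotation e j k \<phi> x) l * F (t (two_level_rotation e j k \<phi> x) l)"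
    have "rot_val e j k \<phi> x = sum ?h ({..<d} - {j, k}) + sum ?h {j, k}"
      unfolding val_eq by (rule sum.subset_diff) (use jk in auto)
    moreover have "sum ?h ({..<d} - {j, k}) = ?rest"
      by (rule sum.cong) (auto simp: born_two_level[OF e jk states_hermitian(1) refl refl] born_two_level[OF e jk states_hermitian(2) refl refl])
    moreover have "sum ?h {j, k} = ?h j + ?h k" using jk by simp
    ultimately show ?thesis
      unfolding born_two_level[OF e jk states_hermitian(1) refl refl] born_two_level[OF e jk states_hermitian(2) refl refl] a b by simp
  qed
  show ?thesis unfolding eq G1_def
    by (rule DERIV_cong[OF DERIV_add[OF DERIV_const DERIV_add[OF
          div_term_has_derivative[OF rot_has_derivative rot_has_derivative]
          div_term_has_derivative[OF rot_has_derivative rot_has_derivative]]]])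
      (simp_all add: rot_pos)
qed

text \<open>Both velocities at 0 are plus or minus twice a real part with the common phase, so the
  derivative is linear in the phase. The coefficients are the differences of the two partial
  derivatives of the perspective between \<open>t e j\<close> and \<open>t e k\<close>.\<close>

lemma G1_0:
  "G1 e j k a b 0 = 2 * Re (cis \<phi> * (complex_of_real (F' (t e j) - F' (t e k)) * bracket (e j) \<rho> (e k)
     + complex_of_real ((F (t e j) - t e j * F' (t e j)) - (F (t e k) - t e k * F' (t e k))) * bracket (e j) \<sigma> (e k)))"
  (is "_ = 2 * Re (_ * (complex_of_real ?x * _ + complex_of_real ?y * _))")
proof -
  have Rm: "Re (complex_of_real y * z) = y * Re z" for y z by simp
  have "G1 e j k a b 0 = 2 * (?x * a + ?y * b)"
    unfolding G1_def term_deriv_def by (simp add: algebra_simps)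
  also have "\<dots> = 2 * Re (complex_of_real ?x * (cis \<phi> * bracket (e j) \<rho> (e k)) + complex_of_real ?y * (cis \<phi> * bracket (e j) \<sigma> (e k)))"
    by (simp only: plus_complex.simps Rm a b)
  finally show ?thesis by (simp only: distrib_left mult.left_commute)
qed

text \<open>At equal ratios the gradient coefficients of the two outcomes agree while their second
  derivatives are opposite, so these parts cancel. What remains are the two rank-one Hessians at the
  velocities \<open>2 * (a - t * b)\<close> and its negative; the 4 is the square of this 2.\<close>

lemma G1_deriv:
  assumes "t e j = t e k"
  shows "(G1 e j k a b has_real_derivative
     4 * deriv F' (t e j) * (a - t e j * b)\<^sup>2 * (1 / q e j + 1 / q e k)) (at 0)"
proof -
  have "(G1 e j k a b has_real_derivative
     (term_deriv (p e j) (q e j) (2 * (p e k - p e j)) (2 * (q e k - q e j))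
       + (2 * a - t e j * (2 * b))\<^sup>2 / q e j * deriv F' (t e j))
     + (term_deriv (p e k) (q e k) (2 * (p e j - p e k)) (2 * (q e j - q e k))
       + (2 * (- a) - t e k * (2 * (- b)))\<^sup>2 / q e k * deriv F' (t e k))) (at 0)"
    unfolding G1_def[abs_def]
    by (rule DERIV_cong[OF DERIV_add[OF
        term_deriv_has_derivative[OF rot_has_derivative rot_has_derivative rot_deriv_has_derivative rot_deriv_has_derivative]
        term_deriv_has_derivative[OF rot_has_derivative rot_has_derivative rot_deriv_has_derivative rot_deriv_has_derivative]]])
      (simp_all add: rot_pos pos[OF e] jk)
  moreover have "(term_deriv (p e j) (q e j) (2 * (p e k - p e j)) (2 * (q e k - q e j))
       + (2 * a - t e j * (2 * b))\<^sup>2 / q e j * deriv F' (t e j))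
     + (term_deriv (p e k) (q e k) (2 * (p e j - p e k)) (2 * (q e j - q e k))
       + (2 * (- a) - t e k * (2 * (- b)))\<^sup>2 / q e k * deriv F' (t e k))
     = 4 * deriv F' (t e j) * (a - t e j * b)\<^sup>2 * (1 / q e j + 1 / q e k)"
  proof -
    define \<tau> where "\<tau> = t e j"
    have \<tau>: "t e j = \<tau>" "t e k = \<tau>" using assms by (auto simp: \<tau>_def)
    have s: "(2 * a - \<tau> * (2 * b))\<^sup>2 = 4 * (a - \<tau> * b)\<^sup>2" "(2 * (- a) - \<tau> * (2 * (- b)))\<^sup>2 = 4 * (a - \<tau> * b)\<^sup>2"
      by (simp_all add: power2_eq_square algebra_simps)
    show ?thesis unfolding term_deriv_def \<tau> s by (simp add: algebra_simps)
  qed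
  ultimately show ?thesis by simp
qed

end

text \<open>Criticality along two-level rotations of the basis. Critical PVMs and local maxima both
  supply it, so one sufficiency argument serves both.\<close>

definition stationary :: "(nat \<Rightarrow> complex vec) \<Rightarrow> bool" where
  "stationary e \<longleftrightarrow> (\<forall>j<d. \<forall>k<d. \<forall>\<phi>. j \<noteq> k \<longrightarrow>
     (rot_val e j k \<phi> has_real_derivative 0) (at 0))"

text \<open>The first derivative vanishes for every phase, hence so does the complex number in
  \<open>G1_0\<close>; there \<open>F'\<close> is \<psi> at the score and
  \<open>F t - t * F' t\<close> is \<open>- g\<close> at the score.\<close>

lemma stationary_identity:
  assumes e: "orthonormal_basis d e" and st: "stationary e" and jk: "j < d" "k < d" "j \<noteq> k"
  shows "(\<psi> (\<theta> (t e j)) - \<psi> (\<theta> (t e k))) * bracket (e j) \<rho> (e k)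
     = (g (\<theta> (t e j)) - g (\<theta> (t e k))) * bracket (e j) \<sigma> (e k)"
proof -
  have "Re (cis \<phi> * (complex_of_real (F' (t e j) - F' (t e k)) * bracket (e j) \<rho> (e k)
     + complex_of_real ((F (t e j) - t e j * F' (t e j)) - (F (t e k) - t e k * F' (t e k))) * bracket (e j) \<sigma> (e k))) = 0" for \<phi>
  proof -
    have "(rot_val e j k \<phi> has_real_derivative 0) (at 0)"
      using st jk by (simp add: stationary_def)
    from DERIV_unique[OF two_level_value_deriv[OF e jk refl refl, of \<phi> 0] this]
    show ?thesis unfolding G1_0[OF e jk refl refl] by simp
  qed
  from cis_rotation_eq_0[OF this]
  show ?thesis using pos(3)[OF e jk(1)] pos(3)[OF e jk(2)] by (simp add: \<psi>_score fenchel_conj_slope algebra_simps)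
qed

text \<open>The diagonal entries are real and \<open>t e j\<close> is their quotient. A violated
  block condition is therefore always witnessed off the diagonal.\<close>

lemma block_diagonal:
  assumes e: "orthonormal_basis d e" and j: "j < d"
  shows "bracket (e j) \<rho> (e j) - t e j * bracket (e j) \<sigma> (e j) = 0"
proof -
  note c = orthonormalD(1)[OF e j]
  have re: "bracket (e j) A (e j) = complex_of_real (born A (basis_pvm d e j))" if "hermitian d A" for A
  proof -
    have "A \<in> carrier_mat d d" using that by (simp add: hermitian_def)
    then show ?thesis using bracket_cnj[OF that c c] c by (simp add: born_basis_pvm complex_eq_iff)
  qed
  show ?thesis using pos[OF e j] by (simp add: re[OF states_hermitian(1)] re[OF states_hermitian(2)])
qed

text \<open>Equal ratios make both coefficient differences in \<open>G1_0\<close> zero, so the first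
  derivative vanishes for any phase and the second-order term decides.\<close>

lemma increasing_rotation:
  assumes e: "orthonormal_basis d e" and jk: "j < d" "k < d" "j \<noteq> k" and tt: "t e j = t e k"
    and R: "defect e (t e j) j k \<noteq> 0"
  obtains \<phi> D where
    "has_second_derivative (rot_val e j k \<phi>) D 0"
    "D = 4 * deriv F' (t e j) * (cmod (defect e (t e j) j k))\<^sup>2
        * (1 / q e j + 1 / q e k)"
    "D > 0" "\<exists>\<delta>>0. \<forall>x. 0 < x \<and> x < \<delta> \<longrightarrow> val e < rot_val e j k \<phi> x"
proof -
  define R where "R = defect e (t e j) j k"
  \<comment> \<open>With this phase \<open>a - t * b\<close> equals the modulus of \<open>R\<close>,
    its largest possible value, which gives the stated second derivative.\<close>
  define \<phi> where "\<phi> = - Arg R"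
  define a where "a = Re (cis \<phi> * bracket (e j) \<rho> (e k))"
  define b where "b = Re (cis \<phi> * bracket (e j) \<sigma> (e k))"
  let ?G = "\<lambda>x. rot_val e j k \<phi> x"
  have "cis \<phi> * R = complex_of_real (cmod R)" unfolding \<phi>_def by (rule cis_minus_Arg)
  moreover have "cis \<phi> * R = cis \<phi> * bracket (e j) \<rho> (e k) - complex_of_real (t e j) * (cis \<phi> * bracket (e j) \<sigma> (e k))"
    by (simp add: R_def algebra_simps)
  ultimately have "Re (cis \<phi> * bracket (e j) \<rho> (e k) - complex_of_real (t e j) * (cis \<phi> * bracket (e j) \<sigma> (e k))) = cmod R"
    by simp
  moreover have Rm: "Re (complex_of_real y * z) = y * Re z" for y z by simp
  ultimately have ab: "a - t e j * b = cmod R" unfolding a_def b_def by (simp only: minus_complex.simps)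
  define D where "D = 4 * deriv F' (t e j) * (cmod R)\<^sup>2 * (1 / q e j + 1 / q e k)"
  note jk' = e jk a_def b_def
  have G: "(?G has_real_derivative G1 e j k a b x) (at x)" for x by (rule two_level_value_deriv[OF jk'])
  have G1: "(G1 e j k a b has_real_derivative D) (at 0)"
    using G1_deriv[OF jk' tt] unfolding ab D_def .
  have D: "D > 0" using F''_pos[OF pos(3)[OF e jk(1)]] pos(2)[OF e jk(1)] pos(2)[OF e jk(2)] R
    unfolding D_def R_def by (simp add: add_pos_pos)
  have z: "G1 e j k a b 0 = 0" unfolding G1_0[OF jk'] tt by simp
  have G0: "?G 0 = val e"
    unfolding val_eq by (rule sum.cong) (auto simp: two_level_0[OF e jk] basis_pvm_def)
  have dG: "deriv ?G = G1 e j k a b" using G by (auto intro!: ext DERIV_imp_deriv)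
  show thesis
  proof (rule that)
    show "has_second_derivative ?G D 0"
      unfolding has_second_derivative_def dG
      using G G1 by (auto simp: real_differentiable_def intro!: always_eventually)
    show "\<exists>\<delta>>0. \<forall>x. 0 < x \<and> x < \<delta> \<longrightarrow> val e < ?G x"
      using second_order_increase[OF G G1 z D] unfolding G0 .
    show "D > 0" by (rule D)
    show "D = 4 * deriv F' (t e j) * (cmod (defect e (t e j) j k))\<^sup>2
        * (1 / q e j + 1 / q e k)" unfolding D_def R_def ..
  qed
qed

end

section \<open>Perturbation of eigenbases\<close>

text \<open>The trace is evaluated in the columns of \<open>U\<close>; the vectors of
  \<open>V\<close> enter only through the overlaps \<open>adj V * U\<close>.\<close>

lemma born_udiag:
  assumes A: "A \<in> carrier_mat n n" and U: "unitary n U" and V: "V \<in> carrier_mat n n"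
  shows "born A (udiag n V c) = Re (\<Sum>a<n. \<Sum>b<n. (adj U * A * U) $$ (a, b) *
     (\<Sum>j<n. cnj ((adj V * U) $$ (j, b)) * c j * (adj V * U) $$ (j, a)))"
proof -
  define W where "W = adj V * U"
  define B where "B = adj U * A * U"
  have d: "dim_row A = n" "dim_col A = n" "dim_row V = n" "dim_col V = n" using A V by auto
  note simps = d unitary_dims[OF U] mat_dim_simps
  have W: "W \<in> carrier_mat n n" and B: "B \<in> carrier_mat n n"
    unfolding W_def B_def by (simp_all add: simps)
  have "mtrace (A * (udiag n V c)) = mtrace (U * (adj U * (A * (V * (rdiag n c * adj V)))))"
    by (simp add: simps unitary_cancel[OF U] del: assoc_mult_mat)
  also have "\<dots> = mtrace ((adj U * (A * (V * (rdiag n c * adj V)))) * U)"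
    by (rule mtrace_comm[of _ n n]) (simp_all add: simps del: assoc_mult_mat)
  also have "(adj U * (A * (V * (rdiag n c * adj V)))) * U = B * (adj W * rdiag n c * adj (adj W))"
    unfolding B_def W_def by (simp add: simps unitary_cancel[OF U] del: assoc_mult_mat)
  also have "mtrace \<dots> = (\<Sum>a<n. \<Sum>b<n. B $$ (a, b) * (adj W * rdiag n c * adj (adj W)) $$ (b, a))"
    by (rule mtrace_mult) (use W B in auto)
  also have "\<dots> = (\<Sum>a<n. \<Sum>b<n. B $$ (a, b) * (\<Sum>j<n. cnj (W $$ (j, b)) * c j * W $$ (j, a)))"
  proof (intro sum.cong refl arg_cong2[where f = times])
    fix a b assume "a \<in> {..<n}" "b \<in> {..<n}"
    then show "(adj W * rdiag n c * adj (adj W)) $$ (b, a) = (\<Sum>j<n. cnj (W $$ (j, b)) * c j * W $$ (j, a))"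
      using W by (subst udiag_index[of _ n n]) auto
  qed
  finally show ?thesis by (simp add: born_def W_def B_def)
qed

text \<open>The columns of the overlap matrix are orthonormal, so the second trace can be written
  with the same products of overlaps. Every term then carries a difference
  \<open>c j - c' a\<close>, the form in which divided differences can be factored out.\<close>

lemma born_udiag_diff:
  assumes A: "A \<in> carrier_mat n n" and U: "unitary n U" and V: "unitary n V"
  shows "born A (udiag n V c) - born A (udiag n U c')
     = Re (\<Sum>a<n. \<Sum>b<n. \<Sum>j<n. cnj ((adj V * U) $$ (j, b)) * (adj V * U) $$ (j, a)
          * ((adj U * A * U) $$ (a, b) * (of_real (c j) - of_real (c' a))))"
proof -
  define W where "W = adj V * U"
  define B where "B = adj U * A * U"
  note u = unitaryD[OF U] and v = unitaryD[OF V]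
  have W: "unitary n W" unfolding W_def by (intro unitary_mult unitary_adj U V)
  have 1: "born A (udiag n V c) = Re (\<Sum>a<n. \<Sum>b<n. B $$ (a, b) * (\<Sum>j<n. cnj (W $$ (j, b)) * c j * W $$ (j, a)))"
    unfolding W_def B_def by (rule born_udiag[OF A U v(1)])
  have "born A (udiag n U c') = Re (\<Sum>a<n. \<Sum>b<n. B $$ (a, b) *
     (\<Sum>j<n. cnj ((adj U * U) $$ (j, b)) * c' j * (adj U * U) $$ (j, a)))"
    unfolding B_def by (rule born_udiag[OF A U u(1)])
  also have "(\<Sum>a<n. \<Sum>b<n. B $$ (a, b) * (\<Sum>j<n. cnj ((adj U * U) $$ (j, b)) * c' j * (adj U * U) $$ (j, a)))
     = (\<Sum>a<n. \<Sum>b<n. B $$ (a, b) * (c' a * (\<Sum>j<n. cnj (W $$ (j, b)) * W $$ (j, a))))"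
  proof (intro sum.cong refl arg_cong2[where f = times])
    fix a b assume ab: "a \<in> {..<n}" "b \<in> {..<n}"
    have "(\<Sum>j<n. cnj ((adj U * U) $$ (j, b)) * c' j * (adj U * U) $$ (j, a))
       = (\<Sum>j<n. if j = a then (if a = b then complex_of_real (c' a) else 0) else 0)"
      unfolding u(3) by (rule sum.cong) (use ab in auto)
    also have "\<dots> = c' a * (if b = a then 1 else 0)" using ab by simp
    also have "\<dots> = c' a * (\<Sum>j<n. cnj (W $$ (j, b)) * W $$ (j, a))"
      using unitary_col_sum[OF W, of b a] ab by simp
    finally show "(\<Sum>j<n. cnj ((adj U * U) $$ (j, b)) * c' j * (adj U * U) $$ (j, a))
       = c' a * (\<Sum>j<n. cnj (W $$ (j, b)) * W $$ (j, a))" .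
  qed
  finally have 2: "born A (udiag n U c')
     = Re (\<Sum>a<n. \<Sum>b<n. B $$ (a, b) * (c' a * (\<Sum>j<n. cnj (W $$ (j, b)) * W $$ (j, a))))" .
  have "(\<Sum>a<n. \<Sum>b<n. B $$ (a, b) * (\<Sum>j<n. cnj (W $$ (j, b)) * c j * W $$ (j, a)))
      - (\<Sum>a<n. \<Sum>b<n. B $$ (a, b) * (c' a * (\<Sum>j<n. cnj (W $$ (j, b)) * W $$ (j, a))))
     = (\<Sum>a<n. \<Sum>b<n. \<Sum>j<n. cnj (W $$ (j, b)) * W $$ (j, a) * (B $$ (a, b) * (of_real (c j) - of_real (c' a))))"
    unfolding sum_distrib_left sum_subtractf[symmetric]
    by (intro sum.cong refl) (simp add: algebra_simps)
  then show ?thesis unfolding 1 2 minus_complex.simps(1)[symmetric] W_def[symmetric] B_def[symmetric] by simp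
qed

lemma unitary_entry_le_1:
  assumes "unitary n W" "i < n" "j < n"
  shows "cmod (W $$ (i, j)) \<le> 1"
proof -
  have "(\<Sum>k<n. (cmod (W $$ (k, j)))\<^sup>2) = 1"
  proof -
    have "of_real (\<Sum>k<n. (cmod (W $$ (k, j)))\<^sup>2) = (\<Sum>k<n. cnj (W $$ (k, j)) * W $$ (k, j))"
      unfolding of_real_sum by (rule sum.cong) (simp_all add: complex_norm_square mult.commute del: of_real_power)
    also have "\<dots> = 1" using unitary_col_sum[OF assms(1,3,3)] by simp
    finally show ?thesis by (simp only: of_real_eq_1_iff)
  qed
  moreover have "(cmod (W $$ (i, j)))\<^sup>2 \<le> (\<Sum>k<n. (cmod (W $$ (k, j)))\<^sup>2)"
    by (rule member_le_sum) (use assms in auto)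
  ultimately show ?thesis by (simp add: abs_square_le_1)
qed

text \<open>Eigenvector overlaps between \<open>U diag(s) U\<^sup>*\<close> and a perturbation of size \<open>u\<close> are of order
  \<open>u\<close> divided by the eigenvalue gap.\<close>

lemma overlap_equation:
  assumes U: "unitary n U" and V: "unitary n V" and H: "H \<in> carrier_mat n n"
    and eq: "udiag n V \<mu> = udiag n U s + of_real u \<cdot>\<^sub>m H"
    and ja: "j < n" "a < n"
  shows "(of_real (\<mu> j) - of_real (s a)) * (adj V * U) $$ (j, a)
     = of_real u * (\<Sum>b<n. (adj V * U) $$ (j, b) * (adj U * H * U) $$ (b, a))"
proof -
  define W where "W = adj V * U"
  have d: "dim_row H = n" "dim_col H = n" using H by auto
  note simps = d unitary_dims[OF U] unitary_dims[OF V] mat_dim_simps mult_lin_dim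
  have W: "W \<in> carrier_mat n n" and K: "adj U * H * U \<in> carrier_mat n n"
    unfolding W_def by (simp_all add: simps del: assoc_mult_mat)
  \<comment> \<open>Multiplying the perturbed matrix by \<open>adj V\<close> on the left and
    \<open>U\<close> on the right diagonalises it on one side and the unperturbed matrix on the
    other.\<close>
  have "rdiag n \<mu> * W = adj V * (udiag n V \<mu>) * U"
    unfolding W_def by (simp add: simps unitary_cancel[OF V] del: assoc_mult_mat)
  also have "\<dots> = W * rdiag n s + of_real u \<cdot>\<^sub>m (W * (adj U * H * U))"
    unfolding eq W_def
    by (simp add: simps unitary_cancel[OF U] unitaryD(3)[OF U] del: assoc_mult_mat)
  finally have "(rdiag n \<mu> * W) $$ (j, a) = (W * rdiag n s + of_real u \<cdot>\<^sub>m (W * (adj U * H * U))) $$ (j, a)"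
    by (rule arg_cong)
  moreover define Q where "Q = W * (adj U * H * U)"
  moreover have "dim_row Q = n" "dim_col Q = n" unfolding Q_def using W K by auto
  ultimately have "of_real (\<mu> j) * W $$ (j, a) = W $$ (j, a) * of_real (s a) + of_real u * Q $$ (j, a)"
    using ja by (simp add: mat_diag_mult_left[OF W] mat_diag_mult_right[OF W] del: index_mult_mat(1) assoc_mult_mat)
  then have "of_real (\<mu> j) * W $$ (j, a) = W $$ (j, a) * of_real (s a)
      + of_real u * (W * (adj U * H * U)) $$ (j, a)"
    unfolding Q_def .
  then show ?thesis
    unfolding mult_index[OF W K ja] unfolding W_def[symmetric] by (simp add: algebra_simps)
qed

text \<open>Nothing is said about how \<mu> and \<open>w\<close> vary with \<open>u\<close>, since
  eigenvectors are chosen separately for each \<open>u\<close>. Either \<mu> is close to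
  \<open>s\<close>, where \<kappa> is small, or the gap forces \<open>w\<close> to be of order
  \<open>u\<close>.\<close>

lemma overlap_vanishes:
  fixes \<kappa> :: "real \<Rightarrow> complex" and w :: "real \<Rightarrow> complex"
  assumes \<kappa>: "continuous_on K \<kappa>" "compact K" "s \<in> K" "\<kappa> s = 0"
    and l: "\<And>u. 0 < u \<Longrightarrow> u < 1 \<Longrightarrow> \<mu> u \<in> K"
    and w: "\<And>u. 0 < u \<Longrightarrow> u < 1 \<Longrightarrow> cmod (w u) \<le> 1"
      "\<And>u. 0 < u \<Longrightarrow> u < 1 \<Longrightarrow> cmod (w u) * \<bar>\<mu> u - s\<bar> \<le> u * B"
  shows "((\<lambda>u. w u * \<kappa> (\<mu> u)) \<longlongrightarrow> 0) (at_right 0)"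
proof (rule tendstoI)
  fix \<epsilon> :: real assume \<epsilon>: "\<epsilon> > 0"
  obtain \<delta> where \<delta>: "\<delta> > 0" "\<And>x. x \<in> K \<Longrightarrow> \<bar>x - s\<bar> < \<delta> \<Longrightarrow> cmod (\<kappa> x) < \<epsilon> / 2"
    using \<kappa>(1,3,4) \<epsilon> unfolding continuous_on_iff
    by (metis dist_real_def dist_0_norm dist_commute half_gt_zero)
  obtain C where C: "C > 0" "\<And>x. x \<in> K \<Longrightarrow> cmod (\<kappa> x) \<le> C"
    using compact_imp_bounded[OF compact_continuous_image[OF \<kappa>(1,2)]] by (auto simp: bounded_pos)
  \<comment> \<open>The two alternatives are merged into one affine bound: continuity at
    \<open>s\<close> gives the constant part, boundedness on \<open>K\<close> with the gap \<delta>
    gives the slope \<open>C / \<delta>\<close>.\<close>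
  have le: "cmod (\<kappa> x) \<le> \<epsilon> / 2 + C / \<delta> * \<bar>x - s\<bar>" if "x \<in> K" for x
  proof (cases "\<bar>x - s\<bar> < \<delta>")
    case True
    then show ?thesis using \<delta>(2)[OF that] \<delta>(1) C(1) by (smt (verit) divide_nonneg_pos mult_nonneg_nonneg)
  next
    case False
    have "C \<le> C / \<delta> * \<bar>x - s\<bar>" using False \<delta>(1) C(1) by (simp add: field_simps)
    then show ?thesis using C(2)[OF that] \<epsilon> by linarith
  qed
  have "((\<lambda>u. C / \<delta> * (u * B)) \<longlongrightarrow> C / \<delta> * (0 * B)) (at_right 0)"
    by (intro tendsto_intros)
  then have "eventually (\<lambda>u. C / \<delta> * (u * B) < \<epsilon> / 2) (at_right 0)"
    using \<epsilon> by (intro order_tendstoD(2)[where y = "C / \<delta> * (0 * B)"]) auto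
  moreover have "eventually (\<lambda>u. 0 < u \<and> u < 1) (at_right (0::real))"
    by (rule eventually_at_right_real[of 0 1, THEN eventually_mono]) auto
  ultimately show "eventually (\<lambda>u. dist (w u * \<kappa> (\<mu> u)) 0 < \<epsilon>) (at_right 0)"
  proof eventually_elim
    case (elim u)
    have "cmod (w u * \<kappa> (\<mu> u)) \<le> cmod (w u) * (\<epsilon> / 2 + C / \<delta> * \<bar>\<mu> u - s\<bar>)"
      unfolding norm_mult using le[OF l, of u] elim by (intro mult_left_mono) auto
    also have "\<dots> = cmod (w u) * (\<epsilon> / 2) + C / \<delta> * (cmod (w u) * \<bar>\<mu> u - s\<bar>)" by (simp add: algebra_simps)
    also have "\<dots> \<le> 1 * (\<epsilon> / 2) + C / \<delta> * (u * B)"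
      using w[of u] elim \<epsilon> C(1) \<delta>(1) by (intro add_mono mult_right_mono mult_left_mono) auto
    also have "\<dots> < \<epsilon>" using elim by linarith
    finally show ?case by simp
  qed
qed

lemma difference_quotient_continuous:
  assumes J: "x \<in> J" "s \<in> J" and h: "\<And>x. x \<in> J \<Longrightarrow> isCont h x"
    and h': "(h has_real_derivative D) (at s)"
  shows "isCont (\<lambda>x. if x = s then D else (h x - h s) / (x - s)) x"
proof (cases "x = s")
  case True
  have "((\<lambda>x. (h x - h s) / (x - s)) \<longlongrightarrow> D) (at s)"
    using h' by (simp add: has_field_derivative_iff)
  then have "((\<lambda>x. if x = s then D else (h x - h s) / (x - s)) \<longlongrightarrow> D) (at s)"
    by (rule Lim_transform_eventually) (auto simp: eventually_at_filter)
  then show ?thesis by (simp add: isCont_def True)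
next
  case False
  have "isCont (\<lambda>x. (h x - h s) / (x - s)) x"
    using h[OF J(1)] False by (auto intro!: continuous_intros)
  moreover have "eventually (\<lambda>y. (if y = s then D else (h y - h s) / (y - s)) = (h y - h s) / (y - s)) (nhds x)"
    using False by (intro eventually_mono[OF eventually_nhds_in_open[of "- {s}" x]]) auto
  ultimately show ?thesis by (subst isCont_cong) auto
qed

section \<open>Sufficiency of the block condition\<close>

lemma herm_fun_carrier:
  assumes "hermitian n A"
  shows "herm_fun n h A \<in> carrier_mat n n"
proof -
  obtain U l where "unitary n U" "A = udiag n U l" using spectral_theorem[OF assms] by blast
  then show ?thesis using unitaryD(1) by (auto simp: herm_fun_udiag)
qed

lemma born_udiag_neg:
  assumes "A \<in> carrier_mat n n" "unitary n V"
  shows "born A (udiag n V (\<lambda>i. - c i)) = - born A (udiag n V c)"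
  unfolding born_udiag[OF assms(1,2) unitaryD(1)[OF assms(2)]]
  by (simp add: sum_negf sum_distrib_left)

lemma hermitian_povm_sum:
  assumes "povm n m M"
  shows "hermitian n (msum n m (\<lambda>y. of_real (s y) \<cdot>\<^sub>m M y))"
  using assms by (intro hermitian_msum hermitian_smult) (auto simp: povm_def intro: psdD)

lemma povm_sum_bounds:
  assumes M: "povm n m M" and s: "\<And>y. y < m \<Longrightarrow> s y \<in> {lo..hi}" and v: "v \<in> carrier_vec n"
  shows "lo * Re (bracket v (1\<^sub>m n) v) \<le> Re (bracket v (msum n m (\<lambda>y. of_real (s y) \<cdot>\<^sub>m M y)) v)"
    "Re (bracket v (msum n m (\<lambda>y. of_real (s y) \<cdot>\<^sub>m M y)) v) \<le> hi * Re (bracket v (1\<^sub>m n) v)"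
proof -
  have Mc: "M y \<in> carrier_mat n n" and nn: "0 \<le> Re (bracket v (M y) v)" if "y < m" for y
    using M that v by (auto simp: povm_def psd_def hermitian_def)
  have 1: "Re (bracket v (1\<^sub>m n) v) = (\<Sum>y<m. Re (bracket v (M y) v))"
    using bracket_msum[of m M n v v] Mc v M by (simp add: povm_def)
  have "bracket v (msum n m (\<lambda>y. of_real (s y) \<cdot>\<^sub>m M y)) v = (\<Sum>y<m. s y * bracket v (M y) v)"
    by (subst bracket_msum) (use Mc v in \<open>auto simp: bracket_smult[of _ n] intro!: sum.cong\<close>)
  then have 2: "Re (bracket v (msum n m (\<lambda>y. of_real (s y) \<cdot>\<^sub>m M y)) v) = (\<Sum>y<m. s y * Re (bracket v (M y) v))"
    by simp
  show "lo * Re (bracket v (1\<^sub>m n) v) \<le> Re (bracket v (msum n m (\<lambda>y. of_real (s y) \<cdot>\<^sub>m M y)) v)"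
    "Re (bracket v (msum n m (\<lambda>y. of_real (s y) \<cdot>\<^sub>m M y)) v) \<le> hi * Re (bracket v (1\<^sub>m n) v)"
    unfolding 1 2 sum_distrib_left using s nn by (auto intro!: sum_mono mult_right_mono)
qed

context state_pair
begin

text \<open>The dual functional \<open>\<Gamma> \<mapsto> Tr \<rho> \<psi>(\<Gamma>) - Tr \<sigma> g(\<Gamma>)\<close>, written with \<open>- \<psi>\<close> because operator concavity is
  defined through it.\<close>

definition dual :: "complex mat \<Rightarrow> real" where
  "dual A = - born \<rho> (herm_fun d (\<lambda>x. - \<psi> x) A) - born \<sigma> (herm_fun d g A)"

lemma dual_udiag:
  assumes "unitary d V"
  shows "dual (udiag d V \<mu>)
     = born \<rho> (udiag d V (\<lambda>i. \<psi> (\<mu> i))) - born \<sigma> (udiag d V (\<lambda>i. g (\<mu> i)))"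
  unfolding dual_def herm_fun_udiag[OF assms] born_udiag_neg[OF states_carrier(1) assms] by simp

lemma povm_le_dual:
  assumes M: "povm d m M" and s: "\<And>y. y < m \<Longrightarrow> s y \<in> J"
  shows "(\<Sum>y<m. born \<rho> (M y) * \<psi> (s y) - born \<sigma> (M y) * g (s y))
     \<le> dual (msum d m (\<lambda>y. of_real (s y) \<cdot>\<^sub>m M y))"
proof -
  have Mc: "M y \<in> carrier_mat d d" if "y < m" for y
    using M that psdD(1) by (auto simp: povm_def)
  have b: "born A (msum d m (\<lambda>y. of_real (c y) \<cdot>\<^sub>m M y)) = (\<Sum>y<m. c y * born A (M y))"
    if "A \<in> carrier_mat d d" for A c
    by (subst born_msum) (use that Mc in \<open>auto simp: born_smult\<close>)
  have "born \<rho> (herm_fun d (\<lambda>x. - \<psi> x) (msum d m (\<lambda>y. of_real (s y) \<cdot>\<^sub>m M y))) \<le> (\<Sum>y<m. - \<psi> (s y) * born \<rho> (M y))"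
    unfolding b[OF states_carrier(1), symmetric]
    by (rule born_mono[OF states_psd(1) operator_jensen_povm[OF \<psi>_concave[unfolded operator_concave_on_def] M s]])
  moreover have "born \<sigma> (herm_fun d g (msum d m (\<lambda>y. of_real (s y) \<cdot>\<^sub>m M y))) \<le> (\<Sum>y<m. g (s y) * born \<sigma> (M y))"
    unfolding b[OF states_carrier(2), symmetric]
    by (rule born_mono[OF states_psd(2) operator_jensen_povm[OF g_convex M s]])
  ultimately show ?thesis unfolding dual_def by (simp add: sum_subtractf sum_negf mult.commute)
qed

lemma dual_concave:
  assumes AB: "hermitian d A" "hermitian d B" "spectrum A \<subseteq> complex_of_real ` J" "spectrum B \<subseteq> complex_of_real ` J"
    and u: "u \<in> {0..1}"
  shows "(1 - u) * dual A + u * dual B \<le> dual (of_real (1 - u) \<cdot>\<^sub>m A + of_real u \<cdot>\<^sub>m B)"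
proof -
  have b: "born C (herm_fun d h (of_real (1 - u) \<cdot>\<^sub>m A + of_real u \<cdot>\<^sub>m B))
      \<le> (1 - u) * born C (herm_fun d h A) + u * born C (herm_fun d h B)"
    if C: "psd d C" and conv: "operator_convex_on J h" for C h
  proof -
    note c = herm_fun_carrier[OF AB(1), of h] herm_fun_carrier[OF AB(2), of h] psdD(1)[OF C]
    have "loewner_le d (herm_fun d h (of_real (1 - u) \<cdot>\<^sub>m A + of_real u \<cdot>\<^sub>m B))
      (of_real (1 - u) \<cdot>\<^sub>m herm_fun d h A + of_real u \<cdot>\<^sub>m herm_fun d h B)"
      using conv[unfolded operator_convex_on_def, rule_format, OF u conjI[OF AB(1) conjI[OF AB(2) conjI[OF AB(3,4)]]]] .
    from born_mono[OF C this] show ?thesis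
      using c by (simp only: born_add[OF c(3) smult_carrier_mat[OF c(1)] smult_carrier_mat[OF c(2)]]
          born_smult[OF c(3) c(1)] born_smult[OF c(3) c(2)])
  qed
  show ?thesis
    using b[OF states_psd(1) \<psi>_concave[unfolded operator_concave_on_def]] b[OF states_psd(2) g_convex]
    unfolding dual_def by (simp add: algebra_simps)
qed

text \<open>A trace equal to one excludes dimension zero. The minimum and maximum over all scores
  below are thus taken over a nonempty set.\<close>

lemma d_pos: "d > 0"
proof (rule ccontr)
  assume "\<not> d > 0"
  then have "mtrace \<rho> = 0" using states_carrier(1) by (auto simp: mtrace_def)
  then show False using rho by (simp add: faithful_density_def)
qed

definition score_mat :: "(nat \<Rightarrow> complex vec) \<Rightarrow> complex mat" where
  "score_mat e = udiag d (basis_mat d e) (\<lambda>l. \<theta> (t e l))"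

text \<open>Fenchel-Young holds with equality at the scores: with \<open>p = t * q\<close>, each
  term \<open>F' t * p - (t * F' t - F t) * q\<close> reduces to \<open>q * F t\<close>.\<close>

lemma dual_score_mat:
  assumes e: "orthonormal_basis d e"
  shows "dual (score_mat e) = val e"
proof -
  have b: "born A (udiag d (basis_mat d e) c) = (\<Sum>l<d. c l * born A (basis_pvm d e l))"
    if "A \<in> carrier_mat d d" for A c
    unfolding udiag_basis_mat[OF e] by (subst born_msum) (use that in \<open>auto simp: born_smult\<close>)
  have "dual (score_mat e) = (\<Sum>l<d. \<psi> (\<theta> (t e l)) * p e l - g (\<theta> (t e l)) * q e l)"
    unfolding score_mat_def dual_udiag[OF unitary_basis_mat[OF e]] b[OF states_carrier(1)] b[OF states_carrier(2)]
    by (simp add: sum_subtractf)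
  also have "\<dots> = val e"
    unfolding val_eq
  proof (rule sum.cong[OF refl])
    fix l assume "l \<in> {..<d}"
    then have l: "p e l > 0" "q e l > 0" "t e l > 0" using pos[OF e] by auto
    show "\<psi> (\<theta> (t e l)) * p e l - g (\<theta> (t e l)) * q e l = q e l * F (t e l)"
      using g_score[OF l(3)] \<psi>_score[OF l(3)] l(2) by (simp add: field_simps)
  qed
  finally show ?thesis .
qed

context
  fixes e :: "nat \<Rightarrow> complex vec"
  assumes e: "orthonormal_basis d e" and st: "stationary e"
    and blk: "\<And>j k. j < d \<Longrightarrow> k < d \<Longrightarrow> t e j = t e k \<Longrightarrow>
      bracket (e j) \<rho> (e k) = t e j * bracket (e j) \<sigma> (e k)"
begin

text \<open>First divided difference of \<open>h\<close> between \<open>x\<close> and the score of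
  \<open>a\<close>; \<open>D\<close> fills in the diagonal value.\<close>

definition diff_quot :: "(real \<Rightarrow> real) \<Rightarrow> real \<Rightarrow> nat \<Rightarrow> real \<Rightarrow> real" where
  "diff_quot h D a x = (if x = \<theta> (t e a) then D else (h x - h (\<theta> (t e a))) / (x - \<theta> (t e a)))"

text \<open>At \<open>x\<close> equal to the score of \<open>b\<close> this is the entry
  \<open>(a, b)\<close> of the derivative of the dual functional. The argument stays free because
  perturbed eigenvalues are inserted for it.\<close>

definition kernel :: "nat \<Rightarrow> nat \<Rightarrow> real \<Rightarrow> complex" where
  "kernel a b x = bracket (e a) \<rho> (e b) * diff_quot \<psi> (deriv \<psi> (\<theta> (t e a))) a x
     - bracket (e a) \<sigma> (e b) * diff_quot g (t e a * deriv \<psi> (\<theta> (t e a))) a x"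

lemma kernel_continuous: "a < d \<Longrightarrow> K \<subseteq> J \<Longrightarrow> continuous_on K (kernel a b)"
proof (rule continuous_at_imp_continuous_on, rule ballI)
  fix x assume a: "a < d" and K: "K \<subseteq> J" "x \<in> K"
  note t = pos(3)[OF e a]
  have "isCont (diff_quot \<psi> (deriv \<psi> (\<theta> (t e a))) a) x"
    unfolding diff_quot_def[abs_def]
    by (rule difference_quotient_continuous[of _ J]) (use K score_in[OF t] \<psi>_continuous \<psi>_deriv in auto)
  moreover have "isCont (diff_quot g (t e a * deriv \<psi> (\<theta> (t e a))) a) x"
    unfolding diff_quot_def[abs_def]
    by (rule difference_quotient_continuous[of _ J]) (use K score_in[OF t] g_continuous g_deriv[OF t] in auto)
  ultimately show "isCont (kernel a b) x" unfolding kernel_def[abs_def]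
    by (intro continuous_intros)
qed

lemma kernel_diff:
  "(of_real x - of_real (\<theta> (t e a))) * kernel a b x
   = bracket (e a) \<rho> (e b) * (complex_of_real (\<psi> x) - complex_of_real (\<psi> (\<theta> (t e a))))
     - bracket (e a) \<sigma> (e b) * (complex_of_real (g x) - complex_of_real (g (\<theta> (t e a))))"
proof -
  let ?x = "complex_of_real x - complex_of_real (\<theta> (t e a))"
  have dq: "?x * complex_of_real (diff_quot h D a x) = complex_of_real (h x) - complex_of_real (h (\<theta> (t e a)))" for h D
    unfolding of_real_diff[symmetric] of_real_mult[symmetric] by (simp add: diff_quot_def)
  have "?x * kernel a b x = bracket (e a) \<rho> (e b) * (?x * of_real (diff_quot \<psi> (deriv \<psi> (\<theta> (t e a))) a x))
     - bracket (e a) \<sigma> (e b) * (?x * complex_of_real (diff_quot g (t e a * deriv \<psi> (\<theta> (t e a))) a x))"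
    unfolding kernel_def by (simp only: right_diff_distrib mult.left_commute)
  then show ?thesis unfolding dq .
qed

lemma kernel_zero:
  assumes ab: "a < d" "b < d"
  shows "kernel a b (\<theta> (t e b)) = 0"
proof (cases "\<theta> (t e b) = \<theta> (t e a)")
  case True
  then have "t e a = t e b" using score_eq_iff pos(3)[OF e ab(1)] pos(3)[OF e ab(2)] by metis
  from blk[OF ab this] show ?thesis
    unfolding kernel_def diff_quot_def using True by simp
next
  case False
  then have "a \<noteq> b" by auto
  with stationary_identity[OF e st ab]
  have "(of_real (\<theta> (t e b)) - of_real (\<theta> (t e a))) * kernel a b (\<theta> (t e b)) = 0"
    unfolding kernel_diff by (simp add: algebra_simps)
  then show ?thesis using False by simp
qed

text \<open>In the increment, the eigenvalue shift from \<open>s a\<close> times the overlap of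
  \<open>j\<close> with \<open>a\<close> equals \<open>u * Z\<close>, with \<open>Z\<close> bounded
  uniformly in \<open>u\<close>. The other overlap times the kernel tends to zero by
  \<open>overlap_vanishes\<close> around \<open>s b\<close>. Condition \<open>ev\<close> keeps all
  eigenvalues in the compact set on which this is applied.\<close>

lemma dual_derivative_zero:
  assumes H: "hermitian d H" and K: "compact K" "K \<subseteq> J" "\<And>a. a < d \<Longrightarrow> \<theta> (t e a) \<in> K"
    and ev: "\<And>u V \<mu> i. 0 < u \<Longrightarrow> u < 1 \<Longrightarrow> unitary d V \<Longrightarrow> i < d \<Longrightarrow>
       udiag d V \<mu> = score_mat e + of_real u \<cdot>\<^sub>m H \<Longrightarrow> \<mu> i \<in> K"
  shows "((\<lambda>u. (dual (score_mat e + of_real u \<cdot>\<^sub>m H) - dual (score_mat e)) / u) \<longlongrightarrow> 0) (at_right 0)"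
proof -
  define U where "U = basis_mat d e"
  define s where "s a = \<theta> (t e a)" for a
  have U: "unitary d U" unfolding U_def by (rule unitary_basis_mat[OF e])
  note Uc = unitaryD(1)[OF U]
  have Hc: "H \<in> carrier_mat d d" using H by (simp add: hermitian_def)
  have S: "score_mat e = udiag d U s" by (simp add: score_mat_def U_def s_def)
  have "hermitian d (score_mat e + of_real u \<cdot>\<^sub>m H)" for u
    unfolding S by (intro hermitian_lin hermitian_smult H udiag_hermitian Uc)
  then have "\<forall>u. \<exists>V \<mu>. unitary d V \<and> score_mat e + of_real u \<cdot>\<^sub>m H = udiag d V \<mu>"
    using spectral_theorem by blast
  then obtain V \<mu> where V: "\<And>u. unitary d (V u)"
    and eq: "\<And>u. score_mat e + of_real u \<cdot>\<^sub>m H = udiag d (V u) (\<mu> u)"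
    by metis
  have \<mu>: "\<mu> u i \<in> K" if "0 < u" "u < 1" "i < d" for u i
    by (rule ev[OF that(1,2) V that(3) eq[symmetric]])
  define W where "W u = adj (V u) * U" for u
  have W: "unitary d (W u)" for u unfolding W_def by (intro unitary_mult unitary_adj U V)
  define Z where "Z u j a = (\<Sum>b<d. W u $$ (j, b) * (adj U * H * U) $$ (b, a))" for u j a
  have ov: "(of_real (\<mu> u j) - of_real (s a)) * W u $$ (j, a) = of_real u * Z u j a"
    if "j < d" "a < d" for u j a
    unfolding W_def Z_def
    by (rule overlap_equation[OF U V Hc eq[of u, symmetric, unfolded S] that])
  define B where "B = (\<Sum>a<d. \<Sum>b<d. cmod ((adj U * H * U) $$ (b, a)))"
  have Z: "cmod (Z u j a) \<le> B" if "j < d" "a < d" for u j a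
  proof -
    have "cmod (Z u j a) \<le> (\<Sum>b<d. cmod (W u $$ (j, b) * (adj U * H * U) $$ (b, a)))"
      unfolding Z_def by (rule norm_sum)
    also have "\<dots> \<le> (\<Sum>b<d. 1 * cmod ((adj U * H * U) $$ (b, a)))"
      unfolding norm_mult by (intro sum_mono mult_right_mono unitary_entry_le_1[OF W]) (use that in auto)
    also have "\<dots> \<le> B"
      unfolding B_def mult_1
      by (rule member_le_sum[of a "{..<d}" "\<lambda>a. \<Sum>b<d. cmod ((adj U * H * U) $$ (b, a))"])
        (use that in \<open>auto intro: sum_nonneg\<close>)
    finally show ?thesis .
  qed
  have bU: "(adj U * A * U) $$ (a, b) = bracket (e a) A (e b)" if "A \<in> carrier_mat d d" "a < d" "b < d" for A a b
    using bracket_cols[OF that(1) Uc that(2,3)] basis_mat_col[OF e] that by (simp add: U_def)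
  \<comment> \<open>One term of the difference quotient: the factor \<open>u\<close> has been split
    off, using up the overlap of \<open>j\<close> with \<open>a\<close>.\<close>
  define T where "T u a b j = cnj (W u $$ (j, b)) * kernel a b (\<mu> u j) * Z u j a" for u a b j
  have diff: "dual (score_mat e + of_real u \<cdot>\<^sub>m H) - dual (score_mat e)
     = u * Re (\<Sum>a<d. \<Sum>b<d. \<Sum>j<d. T u a b j)" for u
  proof -
    let ?S = "\<lambda>A h. \<Sum>a<d. \<Sum>b<d. \<Sum>j<d. cnj (W u $$ (j, b)) * W u $$ (j, a)
          * (bracket (e a) A (e b) * (complex_of_real (h (\<mu> u j)) - complex_of_real (h (s a))))"
    have bd: "born A (udiag d (V u) (\<lambda>i. h (\<mu> u i))) - born A (udiag d U (\<lambda>i. h (s i))) = Re (?S A h)"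
      if "A \<in> carrier_mat d d" for A h
    proof -
      have "(\<Sum>a<d. \<Sum>b<d. \<Sum>j<d. cnj (W u $$ (j, b)) * W u $$ (j, a)
          * ((adj U * A * U) $$ (a, b) * (of_real (h (\<mu> u j)) - of_real (h (s a))))) = ?S A h"
        by (intro sum.cong refl) (simp add: bU[OF that] del: assoc_mult_mat index_mult_mat)
      then show ?thesis using born_udiag_diff[OF that U V, where c = "\<lambda>i. h (\<mu> u i)" and c' = "\<lambda>i. h (s i)"]
        unfolding W_def by (simp only:)
    qed
    let ?b = "\<lambda>A h. born A (udiag d (V u) (\<lambda>i. h (\<mu> u i))) - born A (udiag d U (\<lambda>i. h (s i)))"
    have "dual (score_mat e + of_real u \<cdot>\<^sub>m H) - dual (score_mat e) = ?b \<rho> \<psi> - ?b \<sigma> g"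
      unfolding eq unfolding S dual_udiag[OF V] dual_udiag[OF U] by simp
    also have "\<dots> = Re (?S \<rho> \<psi>) - Re (?S \<sigma> g)"
      by (simp only: bd[OF states_carrier(1), of \<psi>] bd[OF states_carrier(2), of g])
    also have "\<dots> = Re (?S \<rho> \<psi> - ?S \<sigma> g)" by simp
    also have "?S \<rho> \<psi> - ?S \<sigma> g = complex_of_real u * (\<Sum>a<d. \<Sum>b<d. \<Sum>j<d. T u a b j)"
      unfolding sum_subtractf[symmetric] sum_distrib_left
    proof (intro sum.cong refl)
      fix a b j assume ab: "a \<in> {..<d}" "b \<in> {..<d}" "j \<in> {..<d}"
      let ?w = "cnj (W u $$ (j, b)) * W u $$ (j, a)"
      let ?h = "\<lambda>A h. bracket (e a) A (e b) * (complex_of_real (h (\<mu> u j)) - complex_of_real (h (s a)))"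
      have "?w * ?h \<rho> \<psi> - ?w * ?h \<sigma> g = ?w * ((of_real (\<mu> u j) - of_real (s a)) * kernel a b (\<mu> u j))"
        unfolding s_def kernel_diff right_diff_distrib[symmetric] ..
      also have "\<dots> = cnj (W u $$ (j, b)) * kernel a b (\<mu> u j) * ((of_real (\<mu> u j) - of_real (s a)) * W u $$ (j, a))"
        by (simp add: mult.commute mult.left_commute)
      also have "\<dots> = complex_of_real u * T u a b j"
        using ab by (simp add: ov T_def)
      finally show "?w * ?h \<rho> \<psi> - ?w * ?h \<sigma> g = complex_of_real u * T u a b j" .
    qed
    finally show ?thesis by simp
  qed
  have T0: "((\<lambda>u. T u a b j) \<longlongrightarrow> 0) (at_right 0)" if ab: "a < d" "b < d" "j < d" for a b j
  proof -
    have "((\<lambda>u. cnj (W u $$ (j, b)) * kernel a b (\<mu> u j)) \<longlongrightarrow> 0) (at_right 0)"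
    proof (rule overlap_vanishes[where K = K and s = "s b" and B = B])
      fix u :: real assume u: "0 < u" "u < 1"
      show "\<mu> u j \<in> K" by (rule \<mu>[OF u ab(3)])
      show "cmod (cnj (W u $$ (j, b))) \<le> 1" using unitary_entry_le_1[OF W ab(3,2)] by simp
      have "cmod (W u $$ (j, b)) * \<bar>\<mu> u j - s b\<bar> = cmod ((of_real (\<mu> u j) - of_real (s b)) * W u $$ (j, b))"
        unfolding norm_mult of_real_diff[symmetric] norm_of_real by (rule mult.commute)
      also have "\<dots> = u * cmod (Z u j b)" unfolding ov[OF ab(3,2)] norm_mult using u by simp
      also have "\<dots> \<le> u * B" using Z[OF ab(3,2)] u by (intro mult_left_mono) auto
      finally show "cmod (cnj (W u $$ (j, b))) * \<bar>\<mu> u j - s b\<bar> \<le> u * B" by simp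
    qed (use kernel_continuous[OF ab(1) K(2)] kernel_zero[OF ab(1,2)] K(1) K(3)[OF ab(2)] in \<open>auto simp: s_def\<close>)
    then show ?thesis
    proof (rule tendsto_0_le[where K = B])
      show "eventually (\<lambda>u. norm (T u a b j) \<le> norm (cnj (W u $$ (j, b)) * kernel a b (\<mu> u j)) * B) (at_right 0)"
        unfolding T_def norm_mult[of _ "Z _ _ _"] using Z[OF ab(3,1)]
        by (intro always_eventually allI mult_left_mono) auto
    qed
  qed
  have "((\<lambda>u. Re (\<Sum>a<d. \<Sum>b<d. \<Sum>j<d. T u a b j)) \<longlongrightarrow> Re (\<Sum>a<d. \<Sum>b<d. \<Sum>j<d. 0)) (at_right 0)"
    by (intro tendsto_Re tendsto_sum T0) auto
  then have "((\<lambda>u. Re (\<Sum>a<d. \<Sum>b<d. \<Sum>j<d. T u a b j)) \<longlongrightarrow> 0) (at_right 0)" by simp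
  then show ?thesis
    by (rule Lim_transform_eventually) (auto simp: diff eventually_at_filter)
qed

text \<open>The score assignment is bounded by the dual functional at its average \<open>G\<close>.
  Along the segment from the score matrix \<open>S\<close> to \<open>G\<close> concavity bounds
  \<open>dual G - dual S\<close> by difference quotients whose limit is zero.\<close>

lemma povm_value_le:
  assumes M: "povm d m M" and s: "\<And>y. y < m \<Longrightarrow> s y \<in> J"
  shows "(\<Sum>y<m. born \<rho> (M y) * \<psi> (s y) - born \<sigma> (M y) * g (s y)) \<le> val e"
proof -
  define G where "G = msum d m (\<lambda>y. of_real (s y) \<cdot>\<^sub>m M y)"
  define S where "S = score_mat e"
  define H where "H = G - S"
  \<comment> \<open>The interval spanned by all scores involved lies in \<open>J\<close>. Both
    \<open>S\<close> and \<open>G\<close> are averages over a POVM of points of \<open>X\<close>, so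
    every mixture of them has its eigenvalues in this interval.\<close>
  define X where "X = s ` {..<m} \<union> (\<lambda>a. \<theta> (t e a)) ` {..<d}"
  have X: "finite X" "X \<noteq> {}" "X \<subseteq> J"
    using d_pos s score_in[OF pos(3)[OF e]] by (auto simp: X_def)
  define K where "K = {Min X..Max X}"
  have XK: "x \<in> K" if "x \<in> X" for x using X that by (auto simp: K_def)
  have sK: "s y \<in> {Min X..Max X}" if "y < m" for y
    using XK[of "s y"] that by (auto simp: X_def K_def)
  have tK: "\<theta> (t e a) \<in> {Min X..Max X}" if "a < d" for a
    using XK[of "\<theta> (t e a)"] that by (auto simp: X_def K_def)
  have KJ: "K \<subseteq> J"
  proof
    fix x assume "x \<in> K"
    then have x: "Min X \<le> x" "x \<le> Max X" by (auto simp: K_def)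
    have "Min X \<in> J" "Max X \<in> J" using X(3) Min_in[OF X(1,2)] Max_in[OF X(1,2)] by blast+
    then show "x \<in> J" using x by (rule mem_is_interval_1_I[OF interval_J])
  qed
  have hG: "hermitian d G" unfolding G_def by (rule hermitian_povm_sum[OF M])
  have U: "unitary d (basis_mat d e)" by (rule unitary_basis_mat[OF e])
  have hS: "hermitian d S" unfolding S_def score_mat_def by (rule udiag_hermitian) simp
  have hH: "hermitian d H" unfolding H_def by (intro hermitian_lin hG hS)
  have Gc: "G \<in> carrier_mat d d" and Sc: "S \<in> carrier_mat d d"
    using hG hS unfolding hermitian_def by blast+
  note dims = carrier_matD[OF Gc] carrier_matD[OF Sc]
  have Gb: "Min X * Re (bracket v (1\<^sub>m d) v) \<le> Re (bracket v G v)" "Re (bracket v G v) \<le> Max X * Re (bracket v (1\<^sub>m d) v)"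
    if "v \<in> carrier_vec d" for v
    unfolding G_def by (rule povm_sum_bounds[OF M sK that], assumption)+
  have Sb: "Min X * Re (bracket v (1\<^sub>m d) v) \<le> Re (bracket v S v)" "Re (bracket v S v) \<le> Max X * Re (bracket v (1\<^sub>m d) v)"
    if "v \<in> carrier_vec d" for v
    unfolding S_def score_mat_def udiag_basis_mat[OF e]
    by (rule povm_sum_bounds[OF basis_pvm_povm[OF e] tK that], assumption)+
  have mix: "of_real (1 - u) \<cdot>\<^sub>m S + of_real u \<cdot>\<^sub>m G = S + of_real u \<cdot>\<^sub>m H" for u
    by (rule eq_matI) (simp_all add: dims H_def algebra_simps)
  have spS: "spectrum S \<subseteq> complex_of_real ` J"
    using udiag_spectrum[OF U, of "\<lambda>l. \<theta> (t e l)"] score_in[OF pos(3)[OF e]]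
    unfolding S_def score_mat_def by blast
  obtain V0 \<mu>0 where V0: "unitary d V0" "G = udiag d V0 \<mu>0" using spectral_theorem[OF hG] by blast
  have "\<mu>0 i \<in> K" if "i < d" for i
    unfolding K_def by (rule udiag_eigenvalue_bounds[OF V0(1) that]) (use Gb V0(2) in auto)
  then have spG: "spectrum G \<subseteq> complex_of_real ` J"
    using udiag_spectrum[OF V0(1), of \<mu>0] KJ unfolding V0(2) by blast
  have lim: "((\<lambda>u. (dual (S + of_real u \<cdot>\<^sub>m H) - dual S) / u) \<longlongrightarrow> 0) (at_right 0)"
    unfolding S_def
  proof (rule dual_derivative_zero[OF hH, of K])
    show "compact K" unfolding K_def by simp
    show "K \<subseteq> J" by (rule KJ)
    show "\<theta> (t e a) \<in> K" if "a < d" for a by (rule XK) (use that in \<open>auto simp: X_def\<close>)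
    fix u :: real and V \<mu> i
    assume u: "0 < u" "u < 1" and V: "unitary d V" and i: "i < d"
      and eq: "udiag d V \<mu> = score_mat e + of_real u \<cdot>\<^sub>m H"
    have eq': "udiag d V \<mu> = of_real (1 - u) \<cdot>\<^sub>m S + of_real u \<cdot>\<^sub>m G"
      unfolding eq mix unfolding S_def ..
    show "\<mu> i \<in> K" unfolding K_def
    proof (rule udiag_eigenvalue_bounds[OF V i])
      fix v :: "complex vec" assume v: "v \<in> carrier_vec d"
      have "bracket v (udiag d V \<mu>) v = complex_of_real (1 - u) * bracket v S v + complex_of_real u * bracket v G v"
        unfolding eq' using Sc Gc v by (simp add: bracket_add[of _ d] bracket_smult[of _ d])
      then have r: "Re (bracket v (udiag d V \<mu>) v) = (1 - u) * Re (bracket v S v) + u * Re (bracket v G v)"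
        by simp
      let ?N = "Re (bracket v (1\<^sub>m d) v)"
      have "(1 - u) * (Min X * ?N) + u * (Min X * ?N) \<le> Re (bracket v (udiag d V \<mu>) v)"
        unfolding r using u Gb[OF v] Sb[OF v] by (intro add_mono mult_left_mono) auto
      moreover have "Re (bracket v (udiag d V \<mu>) v) \<le> (1 - u) * (Max X * ?N) + u * (Max X * ?N)"
        unfolding r using u Gb[OF v] Sb[OF v] by (intro add_mono mult_left_mono) auto
      ultimately show "Min X * ?N \<le> Re (bracket v (udiag d V \<mu>) v) \<and>
        Re (bracket v (udiag d V \<mu>) v) \<le> Max X * ?N"
        by (simp add: algebra_simps)
    qed
  qed
  have "eventually (\<lambda>u. u \<in> {0<..<1}) (at_right (0::real))"
    by (rule eventually_at_right_real) simp
  then have "eventually (\<lambda>u. dual G - dual S \<le> (dual (S + of_real u \<cdot>\<^sub>m H) - dual S) / u) (at_right 0)"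
  proof eventually_elim
    case (elim u)
    have "(1 - u) * dual S + u * dual G \<le> dual (S + of_real u \<cdot>\<^sub>m H)"
      unfolding mix[symmetric] by (rule dual_concave[OF hS hG spS spG]) (use elim in auto)
    then have "(dual G - dual S) * u \<le> dual (S + of_real u \<cdot>\<^sub>m H) - dual S" by (simp add: algebra_simps)
    then show ?case using elim by (simp add: pos_le_divide_eq)
  qed
  then have "dual G - dual S \<le> 0" by (rule tendsto_lowerbound[OF lim]) simp
  moreover have "(\<Sum>y<m. born \<rho> (M y) * \<psi> (s y) - born \<sigma> (M y) * g (s y)) \<le> dual G"
    unfolding G_def by (rule povm_le_dual[OF M s])
  ultimately show ?thesis using dual_score_mat[OF e] unfolding S_def by linarith
qed

theorem stationary_block_optimal: "ereal (val e) = measured_divergence d f \<rho> \<sigma>"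
proof (rule antisym[OF val_le_measured[OF e]])
  show "measured_divergence d f \<rho> \<sigma> \<le> ereal (val e)"
    unfolding measured_divergence_def
  proof (rule SUP_least, clarify)
    fix m M assume M: "povm d m M"
    \<comment> \<open>For a zero effect both probabilities vanish, so its score only has to lie in
      \<open>J\<close>; \<open>\<theta> 1\<close> is an arbitrary choice.\<close>
    define s where "s y = (if M y = 0\<^sub>m d d then \<theta> 1 else \<theta> (born \<rho> (M y) / born \<sigma> (M y)))" for y
    have bp: "born \<rho> (M y) > 0" "born \<sigma> (M y) > 0" if "y < m" "M y \<noteq> 0\<^sub>m d d" for y
      using born_pos[OF states_pos_def(1)] born_pos[OF states_pos_def(2)] M that by (auto simp: povm_def)
    have b0: "born A (0\<^sub>m d d) = 0" if "A \<in> carrier_mat d d" for A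
      unfolding born_def mtrace_mult[OF that zero_carrier_mat] by simp
    have "s y \<in> J" if "y < m" for y
      using bp[OF that] score_in[of 1] score_in[of "born \<rho> (M y) / born \<sigma> (M y)"]
      by (cases "M y = 0\<^sub>m d d") (simp_all add: s_def)
    from povm_value_le[OF M this]
    have le: "(\<Sum>y<m. born \<rho> (M y) * \<psi> (s y) - born \<sigma> (M y) * g (s y)) \<le> val e" .
    have "div_term f (born \<rho> (M y)) (born \<sigma> (M y)) = ereal (born \<rho> (M y) * \<psi> (s y) - born \<sigma> (M y) * g (s y))"
      if "y < m" for y
    proof (cases "M y = 0\<^sub>m d d")
      case True
      then show ?thesis by (simp add: b0 states_carrier div_term_def)
    next
      case False
      note b = bp[OF that False]
      have "div_term f (born \<rho> (M y)) (born \<sigma> (M y)) = ereal (born \<sigma> (M y) * F (born \<rho> (M y) / born \<sigma> (M y)))"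
        by (rule div_term_pos[OF b])
      moreover have "born \<rho> (M y) / born \<sigma> (M y) > 0" using b by simp
      moreover have "s y = \<theta> (born \<rho> (M y) / born \<sigma> (M y))" using False by (simp add: s_def)
      ultimately show ?thesis using g_score[of "born \<rho> (M y) / born \<sigma> (M y)"] \<psi>_score[of "born \<rho> (M y) / born \<sigma> (M y)"] b
        by (simp add: field_simps)
    qed
    then have "f_divergence f m (\<lambda>y. born \<rho> (M y)) (\<lambda>y. born \<sigma> (M y))
       = ereal (\<Sum>y<m. born \<rho> (M y) * \<psi> (s y) - born \<sigma> (M y) * g (s y))"
      unfolding f_divergence_def by simp
    then show "f_divergence f m (\<lambda>y. born \<rho> (M y)) (\<lambda>y. born \<sigma> (M y)) \<le> ereal (val e)"
      using le by simp
  qed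
qed

end

end

section \<open>Rotations as conjugation paths\<close>

definition outer :: "nat \<Rightarrow> complex vec \<Rightarrow> complex vec \<Rightarrow> complex mat" where
  "outer n u v = Matrix.mat n n (\<lambda>(a, b). u $ a * cnj (v $ b))"

lemma outer_dims [simp]: "dim_row (outer n u v) = n" "dim_col (outer n u v) = n"
  "outer n u v \<in> carrier_mat n n"
  by (auto simp: outer_def)

lemma outer_index [simp]: "a < n \<Longrightarrow> b < n \<Longrightarrow> outer n u v $$ (a, b) = u $ a * cnj (v $ b)"
  by (simp add: outer_def)

lemma basis_pvm_outer: "basis_pvm d e l = outer d (e l) (e l)"
  by (simp add: basis_pvm_def outer_def)

lemma adj_outer: "adj (outer n u v) = outer n v u"
  by (rule eq_matI) auto

lemma outer_mult_vec:
  assumes "u \<in> carrier_vec n" "v \<in> carrier_vec n" "x \<in> carrier_vec n"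
  shows "outer n u v *\<^sub>v x = (x \<bullet>c v) \<cdot>\<^sub>v u"
proof (rule eq_vecI)
  fix a assume "a < dim_vec ((x \<bullet>c v) \<cdot>\<^sub>v u)"
  then have a: "a < n" using assms by auto
  have "(outer n u v *\<^sub>v x) $ a = (\<Sum>b<n. u $ a * cnj (v $ b) * x $ b)"
    using a assms by (auto simp: scalar_prod_def lessThan_atLeast0 intro!: sum.cong)
  also have "\<dots> = (x \<bullet>c v) * u $ a"
    using assms by (auto simp: scalar_prod_def lessThan_atLeast0 sum_distrib_left algebra_simps intro!: sum.cong)
  finally show "(outer n u v *\<^sub>v x) $ a = ((x \<bullet>c v) \<cdot>\<^sub>v u) $ a" using a assms by simp
qed (use assms in auto)

lemma smult_mat_vec:
  "A \<in> carrier_mat n m \<Longrightarrow> v \<in> carrier_vec m \<Longrightarrow> (c \<cdot>\<^sub>m A) *\<^sub>v v = c \<cdot>\<^sub>v (A *\<^sub>v (v :: complex vec))"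
  by (rule eq_vecI) auto

lemma smult_smult_mat: "a \<cdot>\<^sub>m (b \<cdot>\<^sub>m A) = (a * b) \<cdot>\<^sub>m (A :: complex mat)"
  by (rule eq_matI) auto

lemma mult_outer:
  assumes "A \<in> carrier_mat n n" "u \<in> carrier_vec n"
  shows "A * outer n u v = outer n (A *\<^sub>v u) v"
proof (rule mat_eqI[of _ n n])
  fix a b assume ab: "a < n" "b < n"
  have "(A * outer n u v) $$ (a, b) = (\<Sum>c<n. A $$ (a, c) * outer n u v $$ (c, b))"
    by (rule mult_index) (use assms ab in auto)
  also have "\<dots> = (\<Sum>c<n. A $$ (a, c) * u $ c) * cnj (v $ b)"
    using ab by (simp add: sum_distrib_right mult.assoc)
  also have "(\<Sum>c<n. A $$ (a, c) * u $ c) = (A *\<^sub>v u) $ a"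
    using ab assms by (auto simp: scalar_prod_def lessThan_atLeast0 intro!: sum.cong)
  finally show "(A * outer n u v) $$ (a, b) = outer n (A *\<^sub>v u) v $$ (a, b)" using ab by simp
qed (use assms in auto)

lemma outer_mult_adj:
  assumes "B \<in> carrier_mat n n" "v \<in> carrier_vec n"
  shows "outer n u v * adj B = outer n u (B *\<^sub>v v)"
proof -
  have "adj (outer n u v * adj B) = B * outer n v u"
    by (subst adj_mult[of _ n n _ n]) (use assms in \<open>auto simp: adj_outer\<close>)
  then have "adj (adj (outer n u v * adj B)) = adj (outer n (B *\<^sub>v v) u)" unfolding mult_outer[OF assms] by simp
  then show ?thesis by (simp add: adj_outer)
qed

lemma pow_mat_smult:
  fixes K :: "complex mat"
  assumes "K \<in> carrier_mat n n"
  shows "(c \<cdot>\<^sub>m K) ^\<^sub>m i = c ^ i \<cdot>\<^sub>m (K ^\<^sub>m i)"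
proof (induction i)
  case 0
  then show ?case using assms by (intro eq_matI) auto
next
  case (Suc i)
  have "K ^\<^sub>m i \<in> carrier_mat n n" using assms by simp
  then have d: "dim_row (K ^\<^sub>m i) = n" "dim_col (K ^\<^sub>m i) = n" "dim_row K = n" "dim_col K = n"
    using assms by (auto simp del: pow_carrier_mat)
  show ?case unfolding pow_mat.simps Suc.IH by (simp add: d mult_lin_dim) (rule eq_matI; simp add: d)
qed

text \<open>Under these equations the positive even powers of \<open>K\<close> are \<open>Q\<close>
  and the odd ones are \<open>K\<close>, so the exponential series splits into the cosine and sine
  series.\<close>

lemma mexp_partial_isometry:
  fixes K Q :: "complex mat"
  assumes K: "K \<in> carrier_mat n n" and KK: "K * K = Q" and QK: "Q * K = K"
  shows "mexp ((\<i> * complex_of_real x) \<cdot>\<^sub>m K)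
    = 1\<^sub>m n + (complex_of_real (cos x) - 1) \<cdot>\<^sub>m Q + (\<i> * complex_of_real (sin x)) \<cdot>\<^sub>m K"
proof (rule mat_eqI[of _ n n])
  have Q: "Q \<in> carrier_mat n n" using K KK by auto
  let ?c = "\<i> * complex_of_real x"
  have KQ: "K ^\<^sub>m i = (if i = 0 then 1\<^sub>m n else if even i then Q else K)" for i
  proof (induction i)
    case (Suc i)
    show ?case unfolding pow_mat.simps Suc.IH using K KK QK by auto
  qed (use K in simp)
  fix a b assume ab: "a < n" "b < n"
  define q k where "q = Q $$ (a, b)" and "k = K $$ (a, b)"
  define o1 :: complex where "o1 = (if a = b then 1 else 0)"
  have dQ: "dim_row Q = n" "dim_col Q = n" "dim_row K = n" "dim_col K = n" using Q K by auto
  \<comment> \<open>\<open>(Q + K) / 2\<close> and \<open>(Q - K) / 2\<close> belong to the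
    eigenvalues 1 and -1 of \<open>K\<close>. The extra term at \<open>i = 0\<close> is there
    because the zeroth power is the identity and not \<open>Q\<close>.\<close>
  have coeff: "((?c \<cdot>\<^sub>m K) ^\<^sub>m i) $$ (a, b) / fact i
     = (if i = 0 then o1 - q else 0) + ((q + k) / 2 * (?c ^ i /\<^sub>R fact i) + (q - k) / 2 * ((- ?c) ^ i /\<^sub>R fact i))" for i
  proof -
    have "((?c \<cdot>\<^sub>m K) ^\<^sub>m i) $$ (a, b) = ?c ^ i * (if i = 0 then o1 else if even i then q else k)"
      unfolding pow_mat_smult[OF K] KQ using ab dQ by (simp add: q_def k_def o1_def)
    then show ?thesis
      by (cases "i = 0"; cases "even i") (simp_all add: scaleR_conv_of_real field_simps)
  qed
  have s0: "(\<lambda>i. if i = (0::nat) then o1 - q else 0) sums (o1 - q)" by (rule sums_single)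
  have "(\<lambda>i. ((?c \<cdot>\<^sub>m K) ^\<^sub>m i) $$ (a, b) / fact i) sums
     ((o1 - q) + ((q + k) / 2 * exp ?c + (q - k) / 2 * exp (- ?c)))"
    unfolding coeff by (intro sums_add sums_mult exp_converges s0)
  then have "(\<Sum>i. ((?c \<cdot>\<^sub>m K) ^\<^sub>m i) $$ (a, b) / fact i) = (o1 - q) + ((q + k) / 2 * exp ?c + (q - k) / 2 * exp (- ?c))"
    by (rule sums_unique[symmetric])
  also have "exp ?c = complex_of_real (cos x) + \<i> * complex_of_real (sin x)"
    by (simp add: cis_conv_exp[symmetric] complex_eq_iff)
  also have "exp (- ?c) = complex_of_real (cos x) - \<i> * complex_of_real (sin x)"
    using cis_conv_exp[of "- x"] by (simp add: complex_eq_iff)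
  finally show "mexp (?c \<cdot>\<^sub>m K) $$ (a, b)
     = (1\<^sub>m n + (of_real (cos x) - 1) \<cdot>\<^sub>m Q + (\<i> * of_real (sin x)) \<cdot>\<^sub>m K) $$ (a, b)"
    using ab dQ by (simp add: mexp_def q_def k_def o1_def algebra_simps del: cos_of_real sin_of_real)
      (simp add: field_simps)
qed (use K KK in \<open>auto simp: mexp_def\<close>)

text \<open>The coefficient \<open>- \<i> * cis \<phi>\<close> cancels the \<i> of the exponent, so
  that \<open>exp (\<i> x K)\<close> sends \<open>e j\<close> to \<open>cos x\<close> times
  \<open>e j\<close> plus \<open>cis \<phi> * sin x\<close> times \<open>e k\<close>.\<close>

definition rotation_generator :: "nat \<Rightarrow> (nat \<Rightarrow> complex vec) \<Rightarrow> nat \<Rightarrow> nat \<Rightarrow> real \<Rightarrow> complex mat" where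
  "rotation_generator d e j k \<phi> =
     (- \<i> * cis \<phi>) \<cdot>\<^sub>m outer d (e k) (e j) + (\<i> * cnj (cis \<phi>)) \<cdot>\<^sub>m outer d (e j) (e k)"

context
  fixes d j k :: nat and e :: "nat \<Rightarrow> complex vec" and \<phi> :: real
  assumes e: "orthonormal_basis d e" and jk: "j < d" "k < d" "j \<noteq> k"
begin

lemma gen_carrier: "rotation_generator d e j k \<phi> \<in> carrier_mat d d"
  by (simp add: rotation_generator_def)

lemma gen_hermitian: "hermitian d (rotation_generator d e j k \<phi>)"
  unfolding hermitian_def rotation_generator_def
  by (simp add: adj_lin_dim adj_smult adj_outer) (rule eq_matI; simp)

lemma gen_apply:
  assumes l: "l < d"
  shows "rotation_generator d e j k \<phi> *\<^sub>v e l = (if l = j then (- \<i> * cis \<phi>) \<cdot>\<^sub>v e k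
     else if l = k then (\<i> * cnj (cis \<phi>)) \<cdot>\<^sub>v e j else 0\<^sub>v d)"
proof -
  note c = orthonormalD(1)[OF e jk(1)] orthonormalD(1)[OF e jk(2)] orthonormalD(1)[OF e l]
  have "rotation_generator d e j k \<phi> *\<^sub>v e l
     = (- \<i> * cis \<phi>) \<cdot>\<^sub>v (outer d (e k) (e j) *\<^sub>v e l) + (\<i> * cnj (cis \<phi>)) \<cdot>\<^sub>v (outer d (e j) (e k) *\<^sub>v e l)"
    unfolding rotation_generator_def using c
    by (simp add: add_mult_distrib_mat_vec[of _ d d] smult_mat_vec[of _ d d])
  also have "\<dots> = (if l = j then (- \<i> * cis \<phi>) \<cdot>\<^sub>v e k
     else if l = k then (\<i> * cnj (cis \<phi>)) \<cdot>\<^sub>v e j else 0\<^sub>v d)"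
    unfolding outer_mult_vec[OF c(2,1,3)] outer_mult_vec[OF c(1,2,3)]
      orthonormalD(2)[OF e l jk(1)] orthonormalD(2)[OF e l jk(2)]
    using c jk(3) by (auto intro!: eq_vecI)
  finally show ?thesis .
qed

lemma gen_square:
  "rotation_generator d e j k \<phi> * rotation_generator d e j k \<phi> = outer d (e j) (e j) + outer d (e k) (e k)" (is "?K * ?K = ?Q")
  and gen_cube: "(outer d (e j) (e j) + outer d (e k) (e k)) * rotation_generator d e j k \<phi> = rotation_generator d e j k \<phi>"
proof -
  note c = orthonormalD(1)[OF e jk(1)] orthonormalD(1)[OF e jk(2)]
  have w: "cis \<phi> * cnj (cis \<phi>) = 1" by (simp add: cis_cnj cis_mult)
  have mo: "A * outer d (e l) v = outer d (A *\<^sub>v e l) v" if "A \<in> carrier_mat d d" "l < d" for A l v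
    by (rule mult_outer[OF that(1) orthonormalD(1)[OF e that(2)]])
  have sm: "outer d (z \<cdot>\<^sub>v u) v = z \<cdot>\<^sub>m outer d u v" if "u \<in> carrier_vec d" for z u v
    by (rule eq_matI) (use that in auto)
  have "?K * ?K = (- \<i> * cis \<phi>) \<cdot>\<^sub>m (?K * outer d (e k) (e j)) + (\<i> * cnj (cis \<phi>)) \<cdot>\<^sub>m (?K * outer d (e j) (e k))"
    by (subst (2) rotation_generator_def) (simp add: mult_lin_dim carrier_matD[OF gen_carrier])
  also have "?K * outer d (e k) (e j) = (\<i> * cnj (cis \<phi>)) \<cdot>\<^sub>m outer d (e j) (e j)"
    unfolding mo[OF gen_carrier jk(2)] gen_apply[OF jk(2)] using jk(3) c by (simp add: sm)
  also have "?K * outer d (e j) (e k) = (- \<i> * cis \<phi>) \<cdot>\<^sub>m outer d (e k) (e k)"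
    unfolding mo[OF gen_carrier jk(1)] gen_apply[OF jk(1)] using c by (simp add: sm)
  also have "(- \<i> * cis \<phi>) \<cdot>\<^sub>m ((\<i> * cnj (cis \<phi>)) \<cdot>\<^sub>m outer d (e j) (e j)) + (\<i> * cnj (cis \<phi>)) \<cdot>\<^sub>m ((- \<i> * cis \<phi>) \<cdot>\<^sub>m outer d (e k) (e k)) = ?Q"
  proof -
    have z: "(- \<i> * cis \<phi>) * (\<i> * cnj (cis \<phi>)) = 1" "(\<i> * cnj (cis \<phi>)) * (- \<i> * cis \<phi>) = 1"
      using w by (simp_all add: algebra_simps)
    show ?thesis unfolding smult_smult_mat z by (rule eq_matI) auto
  qed
  finally show "?K * ?K = ?Q" .
  have "?Q *\<^sub>v e l = e l" if "l = j \<or> l = k" for l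
  proof -
    have l: "l < d" using that jk by auto
    have "?Q *\<^sub>v e l = (e l \<bullet>c e j) \<cdot>\<^sub>v e j + (e l \<bullet>c e k) \<cdot>\<^sub>v e k"
      using c orthonormalD(1)[OF e l] by (simp add: add_mult_distrib_mat_vec[of _ d d] outer_mult_vec)
    also have "\<dots> = e l"
      unfolding orthonormalD(2)[OF e l jk(1)] orthonormalD(2)[OF e l jk(2)]
      using that c jk(3) by (auto intro!: eq_vecI)
    finally show ?thesis .
  qed
  then have Qo: "?Q * outer d (e k) (e j) = outer d (e k) (e j)" "?Q * outer d (e j) (e k) = outer d (e j) (e k)"
    using mo[of ?Q k "e j"] mo[of ?Q j "e k"] jk by simp_all
  show "?Q * ?K = ?K"
    unfolding rotation_generator_def by (subst mult_lin_dim(1)) (simp_all add: mult_lin_dim(5) Qo)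
qed

text \<open>The right exponential is the adjoint of the left one, so conjugation carries the
  projection onto \<open>e l\<close> to the projection onto the image of \<open>e l\<close> under
  the exponential, which is the rotated vector.\<close>

lemma conj_path_two_level:
  assumes l: "l < d" and P: "P l = basis_pvm d e l"
  shows "conj_path P (rotation_generator d e j k \<phi>) x l = basis_pvm d (two_level_rotation e j k \<phi> x) l"
proof -
  let ?K = "rotation_generator d e j k \<phi>"
  let ?Q = "outer d (e j) (e j) + outer d (e k) (e k)"
  note c = orthonormalD(1)[OF e jk(1)] orthonormalD(1)[OF e jk(2)] orthonormalD(1)[OF e l]
  define E where "E y = 1\<^sub>m d + (complex_of_real (cos y) - 1) \<cdot>\<^sub>m ?Q + (\<i> * complex_of_real (sin y)) \<cdot>\<^sub>m ?K" for y
  have E: "mexp ((\<i> * complex_of_real y) \<cdot>\<^sub>m ?K) = E y" for y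
    unfolding E_def by (rule mexp_partial_isometry[OF gen_carrier gen_square gen_cube])
  have Ec: "E y \<in> carrier_mat d d" for y unfolding E_def using gen_carrier by simp
  have "adj (E x) = E (- x)"
    unfolding E_def using gen_hermitian gen_carrier
    by (simp add: adj_lin_dim adj_smult adj_outer hermitian_def)
  moreover have "mexp ((- \<i> * complex_of_real x) \<cdot>\<^sub>m ?K) = E (- x)"
    using E[of "- x"] by simp
  ultimately have "conj_path P ?K x l = E x * outer d (e l) (e l) * adj (E x)"
    unfolding conj_path_def P E basis_pvm_outer by simp
  also have "\<dots> = outer d (E x *\<^sub>v e l) (E x *\<^sub>v e l)"
    unfolding mult_outer[OF Ec c(3)] by (rule outer_mult_adj[OF Ec c(3)])
  also have "E x *\<^sub>v e l = two_level_rotation e j k \<phi> x l"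
  proof -
    have "E x *\<^sub>v e l = e l + (complex_of_real (cos x) - 1) \<cdot>\<^sub>v ((e l \<bullet>c e j) \<cdot>\<^sub>v e j + (e l \<bullet>c e k) \<cdot>\<^sub>v e k)
       + (\<i> * complex_of_real (sin x)) \<cdot>\<^sub>v (?K *\<^sub>v e l)"
      unfolding E_def using c gen_carrier
      by (simp add: add_mult_distrib_mat_vec[of _ d d] smult_mat_vec[of _ d d] outer_mult_vec)
    also have "\<dots> = two_level_rotation e j k \<phi> x l"
      unfolding orthonormalD(2)[OF e l jk(1)] orthonormalD(2)[OF e l jk(2)] gen_apply[OF l] two_level_rotation_def
      using c jk(3) by (auto intro!: eq_vecI simp: algebra_simps cis_cnj simp del: cos_of_real sin_of_real)
    finally show ?thesis .
  qed
  finally show ?thesis unfolding basis_pvm_outer .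
qed

text \<open>\<open>K\<close> maps each basis vector to a vector orthogonal to it. This makes the
  Hessian condition, which ranges over tangent directions, applicable to rotations.\<close>

lemma gen_tangent:
  assumes P: "\<And>l. l < d \<Longrightarrow> P l = basis_pvm d e l"
  shows "flag_tangent d P (rotation_generator d e j k \<phi>)"
  unfolding flag_tangent_def
proof (intro conjI gen_hermitian allI impI)
  fix l assume l: "l < d"
  let ?K = "rotation_generator d e j k \<phi>"
  note c = orthonormalD(1)[OF e jk(1)] orthonormalD(1)[OF e jk(2)] orthonormalD(1)[OF e l]
  have Kl: "?K *\<^sub>v e l \<in> carrier_vec d" using mult_mat_vec_carrier[OF gen_carrier c(3)] .
  have "P l * ?K * P l = P l * (?K * P l)"
    unfolding P[OF l] by (rule assoc_mult_mat[of _ d d _ d _ d]) (simp_all add: gen_carrier)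
  also have "\<dots> = outer d (((?K *\<^sub>v e l) \<bullet>c e l) \<cdot>\<^sub>v e l) (e l)"
    unfolding P[OF l] basis_pvm_outer mult_outer[OF gen_carrier c(3)]
    by (subst mult_outer[OF outer_dims(3) Kl]) (simp only: outer_mult_vec[OF c(3) c(3) Kl])
  also have "(?K *\<^sub>v e l) \<bullet>c e l = 0"
    unfolding gen_apply[OF l] using c jk l orthonormalD(2)[OF e jk(1) l] orthonormalD(2)[OF e jk(2) l]
    by auto
  also have "outer d (0 \<cdot>\<^sub>v e l) (e l) = 0\<^sub>m d d"
    by (rule eq_matI) (use c in auto)
  finally show "P l * ?K * P l = 0\<^sub>m d d" .
qed

lemma two_level_entry_tendsto:
  assumes l: "l < d" and a: "a < d"
  shows "((\<lambda>x. two_level_rotation e j k \<phi> x l $ a) \<longlongrightarrow> e l $ a) (at 0)"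
proof -
  note c = orthonormalD(1)[OF e jk(1)] orthonormalD(1)[OF e jk(2)]
  have "(\<lambda>x. two_level_rotation e j k \<phi> x l $ a) = (\<lambda>x. if l = j then complex_of_real (cos x) * e j $ a + cis \<phi> * complex_of_real (sin x) * e k $ a
     else if l = k then - cis (- \<phi>) * complex_of_real (sin x) * e j $ a + complex_of_real (cos x) * e k $ a else e l $ a)"
    using c a by (auto simp: two_level_rotation_def simp del: cos_of_real sin_of_real)
  moreover have "((\<lambda>x. if l = j then complex_of_real (cos x) * e j $ a + cis \<phi> * complex_of_real (sin x) * e k $ a
     else if l = k then - cis (- \<phi>) * complex_of_real (sin x) * e j $ a + complex_of_real (cos x) * e k $ a else e l $ a)
     \<longlongrightarrow> (if l = j then complex_of_real (cos 0) * e j $ a + cis \<phi> * complex_of_real (sin 0) * e k $ a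
     else if l = k then - cis (- \<phi>) * complex_of_real (sin 0) * e j $ a + complex_of_real (cos 0) * e k $ a else e l $ a)) (at 0)"
    by (cases "l = j"; cases "l = k") (auto intro!: tendsto_intros simp del: cos_of_real sin_of_real cos_zero sin_zero)
  ultimately show ?thesis by (auto split: if_splits)
qed

end

section \<open>Spectral projections in an eigenbasis\<close>

lemma udiag_psd:
  assumes "U \<in> carrier_mat n n" "\<And>i. i < n \<Longrightarrow> l i \<ge> 0"
  shows "psd n (udiag n U l)"
  unfolding psd_def
proof (intro conjI ballI udiag_hermitian assms)
  fix v :: "complex vec" assume v: "v \<in> carrier_vec n"
  define w where "w = adj U *\<^sub>v v"
  have w: "w \<in> carrier_vec n" unfolding w_def by (rule mult_mat_vec_carrier[OF adj_carrier[OF assms(1)] v])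
  have "bracket v (adj (adj U) * rdiag n l * adj U) v = bracket w (rdiag n l) w"
    unfolding w_def by (rule bracket_conj) (use assms v in auto)
  also have "\<dots> = (\<Sum>i<n. \<Sum>j<n. if j = i then cnj (w $ i) * l i * w $ i else 0)"
    unfolding bracket_sum[OF mat_diag_dim w w] by (intro sum.cong refl) (auto simp: mat_diag_def)
  also have "\<dots> = (\<Sum>i<n. complex_of_real (l i * (cmod (w $ i))\<^sup>2))"
    by (intro sum.cong refl) (simp add: complex_norm_square algebra_simps del: of_real_power)
  finally show "0 \<le> Re (bracket v (udiag n U l) v)"
    using assms(2) by (auto intro!: sum_nonneg simp del: of_real_mult)
qed

lemma msum_mult:
  assumes "\<And>y. y < m \<Longrightarrow> M y \<in> carrier_mat n n" "X \<in> carrier_mat n n"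
  shows "msum n m M * X = msum n m (\<lambda>y. M y * X)"
proof (rule mat_eqI[of _ n n])
  fix a b assume ab: "a < n" "b < n"
  have "(msum n m M * X) $$ (a, b) = (\<Sum>c<n. \<Sum>y<m. M y $$ (a, c) * X $$ (c, b))"
    unfolding mult_index[OF msum_carrier assms(2) ab] using ab by (simp add: msum_index sum_distrib_right)
  also have "\<dots> = (\<Sum>y<m. \<Sum>c<n. M y $$ (a, c) * X $$ (c, b))" by (rule sum.swap)
  also have "\<dots> = (\<Sum>y<m. (M y * X) $$ (a, b))"
    by (rule sum.cong[OF refl], rule mult_index[symmetric]) (use assms ab in auto)
  finally show "(msum n m M * X) $$ (a, b) = msum n m (\<lambda>y. M y * X) $$ (a, b)" using ab by (simp add: msum_index)
qed (use mult_carrier_mat[OF msum_carrier assms(2)] in auto)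

text \<open>Multiplying the decomposition by \<open>B \<beta>\<close> makes \<open>B \<beta>\<close>
  an eigenmatrix for \<open>s \<beta>\<close>, so in the eigenbasis its rows with another eigenvalue
  vanish. Since the projections add up to the identity, each row is carried entirely by the one
  projection with its eigenvalue.\<close>

lemma spectral_projection_diagonal:
  assumes U: "unitary n U" and sd: "spectral_decomposition n (udiag n U l) m s B"
  shows "\<alpha> < m \<Longrightarrow> B \<alpha> = udiag n U (\<lambda>i. if s \<alpha> = l i then 1 else 0)"
    and "i < n \<Longrightarrow> \<exists>\<beta><m. s \<beta> = l i"
proof -
  define G where "G = udiag n U l"
  have inj: "inj_on s {..<m}" and Bh: "\<And>\<beta>. \<beta> < m \<Longrightarrow> hermitian n (B \<beta>)" and BB: "\<And>\<beta>. \<beta> < m \<Longrightarrow> B \<beta> * B \<beta> = B \<beta>"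
    and orth: "\<And>\<beta> \<gamma>. \<beta> < m \<Longrightarrow> \<gamma> < m \<Longrightarrow> \<beta> \<noteq> \<gamma> \<Longrightarrow> B \<beta> * B \<gamma> = 0\<^sub>m n n"
    and one: "msum n m B = 1\<^sub>m n" and G: "G = msum n m (\<lambda>\<beta>. of_real (s \<beta>) \<cdot>\<^sub>m B \<beta>)"
    using sd unfolding spectral_decomposition_def G_def[symmetric] by blast+
  have Bc: "B \<beta> \<in> carrier_mat n n" if "\<beta> < m" for \<beta> using Bh[OF that] by (simp add: hermitian_def)
  define C where "C \<beta> = adj U * B \<beta> * U" for \<beta>
  note Uc = unitaryD(1)[OF U]
  have Cc: "C \<beta> \<in> carrier_mat n n" if "\<beta> < m" for \<beta>
    unfolding C_def using Uc Bc[OF that] by auto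
  have GB: "G * B \<beta> = of_real (s \<beta>) \<cdot>\<^sub>m B \<beta>" if b: "\<beta> < m" for \<beta>
  proof -
    have "G * B \<beta> = msum n m (\<lambda>\<gamma>. (of_real (s \<gamma>) \<cdot>\<^sub>m B \<gamma>) * B \<beta>)"
      unfolding G by (rule msum_mult) (use Bc b in auto)
    also have "\<dots> = of_real (s \<beta>) \<cdot>\<^sub>m B \<beta>"
    proof (rule mat_eqI[of _ n n])
      fix x y assume xy: "x < n" "y < n"
      have "((of_real (s \<gamma>) \<cdot>\<^sub>m B \<gamma>) * B \<beta>) $$ (x, y) = (if \<gamma> = \<beta> then s \<beta> * B \<beta> $$ (x, y) else 0)" if g: "\<gamma> < m" for \<gamma>
      proof -
        have "(of_real (s \<gamma>) \<cdot>\<^sub>m B \<gamma>) * B \<beta> = of_real (s \<gamma>) \<cdot>\<^sub>m (if \<gamma> = \<beta> then B \<beta> else 0\<^sub>m n n)"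
          using BB[OF b] orth[OF g b] carrier_matD[OF Bc[OF b]] carrier_matD[OF Bc[OF g]] by (simp add: mult_lin_dim(6))
        then show ?thesis using xy carrier_matD[OF Bc[OF b]] by (simp del: index_mult_mat(1))
      qed
      then show "msum n m (\<lambda>\<gamma>. (of_real (s \<gamma>) \<cdot>\<^sub>m B \<gamma>) * B \<beta>) $$ (x, y) = (of_real (s \<beta>) \<cdot>\<^sub>m B \<beta>) $$ (x, y)"
        using b xy carrier_matD[OF Bc[OF b]] by (simp add: msum_index del: index_mult_mat(1))
    qed (use Bc[OF b] in auto)
    finally show ?thesis .
  qed
  have C0: "C \<beta> $$ (i, j) = 0" if b: "\<beta> < m" and ij: "i < n" "j < n" and ne: "s \<beta> \<noteq> l i" for \<beta> i j
  proof -
    note dB = carrier_matD[OF Bc[OF b]]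
    have "rdiag n l * C \<beta> = adj U * (G * B \<beta>) * U"
      unfolding C_def G_def by (simp add: mat_dim_simps unitary_dims[OF U] dB unitary_cancel[OF U] del: assoc_mult_mat)
    also have "\<dots> = of_real (s \<beta>) \<cdot>\<^sub>m C \<beta>"
      unfolding GB[OF b] C_def by (simp add: mat_dim_simps mult_lin_dim unitary_dims[OF U] dB del: assoc_mult_mat)
    finally have "(rdiag n l * C \<beta>) $$ (i, j) = (of_real (s \<beta>) \<cdot>\<^sub>m C \<beta>) $$ (i, j)" by simp
    then have "of_real (l i) * C \<beta> $$ (i, j) = of_real (s \<beta>) * C \<beta> $$ (i, j)"
      using ij carrier_matD[OF Cc[OF b]] by (simp add: mat_diag_mult_left[OF Cc[OF b]])
    then show ?thesis using ne by simp
  qed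
  have Csum: "(\<Sum>\<beta><m. C \<beta> $$ (i, j)) = (if i = j then 1 else 0)" if ij: "i < n" "j < n" for i j
  proof -
    have cj: "col U i \<in> carrier_vec n" "col U j \<in> carrier_vec n" using Uc ij by auto
    have "(\<Sum>\<beta><m. C \<beta> $$ (i, j)) = (\<Sum>\<beta><m. bracket (col U i) (B \<beta>) (col U j))"
      by (rule sum.cong) (simp_all add: C_def bracket_cols[OF Bc Uc ij] del: index_mult_mat(1) assoc_mult_mat)
    also have "\<dots> = bracket (col U i) (1\<^sub>m n) (col U j)"
      unfolding one[symmetric] by (rule bracket_msum[OF Bc cj, symmetric])
    also have "\<dots> = (if i = j then 1 else 0)"
      unfolding bracket_cols[OF one_carrier_mat Uc ij] using ij
      by (simp add: mat_dim_simps unitary_dims[OF U] unitaryD(3)[OF U] del: assoc_mult_mat index_mult_mat(1))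
    finally show ?thesis .
  qed
  show "\<exists>\<beta><m. s \<beta> = l i" if i: "i < n"
  proof (rule ccontr)
    assume "\<not> (\<exists>\<beta><m. s \<beta> = l i)"
    then have "(\<Sum>\<beta><m. C \<beta> $$ (i, i)) = 0" by (intro sum.neutral ballI C0) (use i in auto)
    then show False using Csum[OF i i] by simp
  qed
  have C1: "C \<alpha> = rdiag n (\<lambda>i. if s \<alpha> = l i then 1 else 0)" if \<alpha>: "\<alpha> < m"
  proof (rule mat_eqI[of _ n n])
    fix i j assume ij: "i < n" "j < n"
    show "C \<alpha> $$ (i, j) = rdiag n (\<lambda>i. if s \<alpha> = l i then 1 else 0) $$ (i, j)"
    proof (cases "s \<alpha> = l i")
      case False
      then show ?thesis using C0[OF \<alpha> ij False] ij by (auto simp: mat_diag_def)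
    next
      case True
      have "(\<Sum>\<beta><m. C \<beta> $$ (i, j)) = (\<Sum>\<beta><m. if \<beta> = \<alpha> then C \<alpha> $$ (i, j) else 0)"
      proof (rule sum.cong[OF refl])
        fix \<beta> assume b: "\<beta> \<in> {..<m}"
        show "C \<beta> $$ (i, j) = (if \<beta> = \<alpha> then C \<alpha> $$ (i, j) else 0)"
        proof (cases "\<beta> = \<alpha>")
          case False
          then have "s \<beta> \<noteq> s \<alpha>" using inj_onD[OF inj _ b, of \<alpha>] \<alpha> by blast
          then have "s \<beta> \<noteq> l i" unfolding True .
          then show ?thesis using C0[of \<beta> i j] b ij False by simp
        qed simp
      qed
      also have "\<dots> = C \<alpha> $$ (i, j)" using \<alpha> by simp
      finally have "C \<alpha> $$ (i, j) = (if i = j then 1 else 0)" unfolding Csum[OF ij] ..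
      then show ?thesis using ij by (simp add: mat_diag_def True)
    qed
  qed (use Cc[OF \<alpha>] in auto)
  show "B \<alpha> = udiag n U (\<lambda>i. if s \<alpha> = l i then 1 else 0)" if \<alpha>: "\<alpha> < m"
    unfolding C1[OF \<alpha>, symmetric] C_def by (rule unitary_conj_cancel(1)[OF U Bc[OF \<alpha>], symmetric])
qed

section \<open>Spectral blocks and local optimality\<close>

context state_pair
begin

lemma pvm_value_cong:
  "(\<And>l. l < d \<Longrightarrow> P l = Q l) \<Longrightarrow> pvm_value d f \<rho> \<sigma> P = pvm_value d f \<rho> \<sigma> Q"
  unfolding pvm_value_def likelihood_ratio_def by (intro sum.cong refl) simp

lemma conj_path_value:
  assumes e: "orthonormal_basis d e" and jk: "j < d" "k < d" "j \<noteq> k"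
    and P: "\<forall>l<d. P l = basis_pvm d e l"
  shows "pvm_value d f \<rho> \<sigma> (conj_path P (rotation_generator d e j k \<phi>) x) = rot_val e j k \<phi> x"
  by (rule pvm_value_cong) (use P in \<open>simp add: conj_path_two_level[OF e jk]\<close>)

lemma critical_stationary:
  assumes e: "orthonormal_basis d e" and crit: "critical_pvm d f \<rho> \<sigma> P"
    and P: "\<forall>l<d. P l = basis_pvm d e l"
  shows "stationary e"
  unfolding stationary_def
proof (intro allI impI)
  fix j k \<phi> assume jk: "j < d" "k < d" "j \<noteq> k"
  show "(rot_val e j k \<phi> has_real_derivative 0) (at 0)"
    unfolding conj_path_value[OF e jk P, symmetric]
    using crit gen_hermitian[OF e jk] unfolding critical_pvm_def by blast
qed

text \<open>The condition in entries, with blocks given by equal ratios. In this form it refers to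
  the basis only and not to a chosen spectral decomposition.\<close>

definition block_condition :: "(nat \<Rightarrow> complex vec) \<Rightarrow> bool" where
  "block_condition e \<longleftrightarrow> (\<forall>j<d. \<forall>k<d. t e j = t e k \<longrightarrow>
     defect e (t e j) j k = 0)"

lemma block_condition_optimal:
  assumes "orthonormal_basis d e" "stationary e" "block_condition e"
  shows "ereal (val e) = measured_divergence d f \<rho> \<sigma>"
  by (rule stationary_block_optimal[OF assms(1,2)])
    (use assms(3) in \<open>simp add: block_condition_def\<close>)

lemma not_block_condition:
  assumes e: "orthonormal_basis d e" and nb: "\<not> block_condition e"
  obtains j k \<phi> D where "j < d" "k < d" "j \<noteq> k" "t e j = t e k"
    "has_second_derivative (rot_val e j k \<phi>) D 0"
    "D = 4 * deriv F' (t e j) * (cmod (defect e (t e j) j k))\<^sup>2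
        * (1 / q e j + 1 / q e k)"
    "D > 0" "\<exists>\<delta>>0. \<forall>x. 0 < x \<and> x < \<delta> \<longrightarrow> val e < rot_val e j k \<phi> x"
proof -
  obtain j k where jk: "j < d" "k < d" "t e j = t e k" and R: "defect e (t e j) j k \<noteq> 0"
    using nb unfolding block_condition_def by blast
  have ne: "j \<noteq> k"
  proof
    assume "j = k"
    with block_diagonal[OF e jk(1)] R show False by simp
  qed
  show thesis
    by (rule increasing_rotation[OF e jk(1,2) ne jk(3) R]) (rule that[OF jk(1,2) ne jk(3)])
qed

text \<open>A slightly rotated basis has a strictly larger value, and it is itself one of the
  measurements in the supremum.\<close>

lemma not_block_not_optimal:
  assumes e: "orthonormal_basis d e" and nb: "\<not> block_condition e"
  shows "ereal (val e) < measured_divergence d f \<rho> \<sigma>"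
proof -
  obtain j k \<phi> where jk: "j < d" "k < d" "j \<noteq> k"
    and "\<exists>\<delta>>0. \<forall>x. 0 < x \<and> x < \<delta> \<longrightarrow> val e < rot_val e j k \<phi> x"
    by (rule not_block_condition[OF e nb])
  then obtain x where "val e < rot_val e j k \<phi> x" by (meson dense)
  then have "ereal (val e) < ereal (rot_val e j k \<phi> x)" by simp
  also have "\<dots> \<le> measured_divergence d f \<rho> \<sigma>" by (rule val_le_measured[OF two_level_orthonormal[OF e jk]])
  finally show ?thesis .
qed

lemma optimal_iff:
  assumes "orthonormal_basis d e" "stationary e"
  shows "globally_optimal d f \<rho> \<sigma> (basis_pvm d e) \<longleftrightarrow> block_condition e"
  using block_condition_optimal[OF assms] not_block_not_optimal[OF assms(1)]
  unfolding globally_optimal_def by (metis less_irrefl)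

text \<open>If the block condition failed, the ascending rotation would be a tangent geodesic with
  positive second derivative, against the nonpositive one required by stationarity.\<close>

lemma second_order_optimal:
  assumes so: "second_order_stationary d f \<rho> \<sigma> P"
  shows "globally_optimal d f \<rho> \<sigma> P"
proof -
  have crit: "critical_pvm d f \<rho> \<sigma> P" using so by (simp add: second_order_stationary_def)
  then obtain e where e: "orthonormal_basis d e" and P: "\<forall>l<d. P l = basis_pvm d e l"
    unfolding critical_pvm_def rank_one_pvm_def by blast
  have st: "stationary e" by (rule critical_stationary[OF e crit P])
  have "block_condition e"
  proof (rule ccontr)
    assume "\<not> block_condition e"
    then obtain j k \<phi> D where jk: "j < d" "k < d" "j \<noteq> k"
      and D: "has_second_derivative (rot_val e j k \<phi>) D 0" "D > 0"
      by (rule not_block_condition[OF e])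
    have "flag_tangent d P (rotation_generator d e j k \<phi>)" by (rule gen_tangent[OF e jk]) (use P in blast)
    then obtain D' where "D' \<le> 0" "has_second_derivative (rot_val e j k \<phi>) D' 0"
      unfolding conj_path_value[OF e jk P, symmetric] using so unfolding second_order_stationary_def by blast
    then have "D' = D" using D(1) unfolding has_second_derivative_def by (blast intro: DERIV_unique)
    with \<open>D' \<le> 0\<close> D(2) show False by simp
  qed
  moreover have "pvm_value d f \<rho> \<sigma> P = val e" by (rule pvm_value_cong) (use P in blast)
  ultimately show ?thesis
    using block_condition_optimal[OF e st] unfolding globally_optimal_def by simp
qed

text \<open>Small rotations stay in the given neighbourhood, and this is used twice: the vanishing
  derivative at an interior maximum yields stationarity along rotations, and the ascending rotation
  of a violated block would beat the maximum.\<close>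

lemma local_max_optimal:
  assumes lm: "local_max_pvm d f \<rho> \<sigma> P"
  shows "globally_optimal d f \<rho> \<sigma> P"
proof -
  obtain e where e: "orthonormal_basis d e" and P: "\<And>l. l < d \<Longrightarrow> P l = basis_pvm d e l"
    using lm unfolding local_max_pvm_def rank_one_pvm_def by blast
  obtain \<delta> where \<delta>: "\<delta> > 0" and max: "\<And>Q. rank_one_pvm d Q \<Longrightarrow>
      (\<forall>j<d. \<forall>a<d. \<forall>b<d. cmod (Q j $$ (a, b) - P j $$ (a, b)) < \<delta>) \<Longrightarrow>
      pvm_value d f \<rho> \<sigma> Q \<le> pvm_value d f \<rho> \<sigma> P"
    using lm unfolding local_max_pvm_def by blast
  have vP: "pvm_value d f \<rho> \<sigma> P = val e" by (rule pvm_value_cong[OF P])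
  have near: "eventually (\<lambda>x. rot_val e j k \<phi> x \<le> val e) (at 0)"
    if jk: "j < d" "k < d" "j \<noteq> k" for j k \<phi>
  proof -
    let ?r = "two_level_rotation e j k \<phi>"
    have "eventually (\<lambda>x. cmod (basis_pvm d (?r x) l $$ (a, b) - P l $$ (a, b)) < \<delta>) (at 0)"
      if "l < d" "a < d" "b < d" for l a b
    proof -
      have "((\<lambda>x. ?r x l $ a * cnj (?r x l $ b)) \<longlongrightarrow> e l $ a * cnj (e l $ b)) (at 0)"
        by (intro tendsto_mult tendsto_cnj two_level_entry_tendsto[OF e jk] that)
      from tendstoD[OF this \<delta>] show ?thesis
        by (simp add: basis_pvm_index P that dist_norm)
    qed
    then have "eventually (\<lambda>x. \<forall>l\<in>{..<d}. \<forall>a\<in>{..<d}. \<forall>b\<in>{..<d}. cmod (basis_pvm d (?r x) l $$ (a, b) - P l $$ (a, b)) < \<delta>) (at 0)"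
      by (intro eventually_ball_finite finite_lessThan ballI) simp
    then show ?thesis
    proof eventually_elim
      case (elim x)
      have "rank_one_pvm d (basis_pvm d (?r x))"
        unfolding rank_one_pvm_def using two_level_orthonormal[OF e jk] by blast
      from max[OF this] show ?case using elim unfolding vP by simp
    qed
  qed
  have r0: "rot_val e j k \<phi> 0 = val e" if jk: "j < d" "k < d" "j \<noteq> k" for j k \<phi>
    by (rule pvm_value_cong) (simp add: basis_pvm_def two_level_0[OF e jk])
  have st: "stationary e"
    unfolding stationary_def
  proof (intro allI impI)
    fix j k \<phi> assume jk: "j < d" "k < d" "j \<noteq> k"
    define a where "a = Re (cis \<phi> * bracket (e j) \<rho> (e k))"
    define b where "b = Re (cis \<phi> * bracket (e j) \<sigma> (e k))"
    let ?G = "\<lambda>x. rot_val e j k \<phi> x"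
    have G: "(?G has_real_derivative G1 e j k a b 0) (at 0)"
      by (rule two_level_value_deriv[OF e jk a_def b_def])
    obtain \<eta> where "\<eta> > 0" "\<And>x. x \<noteq> 0 \<Longrightarrow> dist x 0 < \<eta> \<Longrightarrow> ?G x \<le> ?G 0"
      using near[OF jk, of \<phi>] unfolding eventually_at r0[OF jk] by auto
    then have "?G y \<le> ?G 0" if "\<bar>0 - y\<bar> < \<eta>" for y
      using that by (cases "y = 0") (auto simp: dist_real_def)
    then have "G1 e j k a b 0 = 0"
      by (intro DERIV_local_max[OF G \<open>\<eta> > 0\<close>]) blast
    with G show "(?G has_real_derivative 0) (at 0)" by simp
  qed
  have "block_condition e"
  proof (rule ccontr)
    assume "\<not> block_condition e"
    then obtain j k \<phi> where jk: "j < d" "k < d" "j \<noteq> k"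
      and "\<exists>\<delta>>0. \<forall>x. 0 < x \<and> x < \<delta> \<longrightarrow> val e < rot_val e j k \<phi> x"
      by (rule not_block_condition[OF e])
    then obtain \<eta> where \<eta>: "\<eta> > 0" "\<And>x. 0 < x \<Longrightarrow> x < \<eta> \<Longrightarrow> val e < rot_val e j k \<phi> x" by blast
    obtain \<eta>' where \<eta>': "\<eta>' > 0" "\<And>x. x \<noteq> 0 \<Longrightarrow> dist x 0 < \<eta>' \<Longrightarrow> rot_val e j k \<phi> x \<le> val e"
      using near[OF jk, of \<phi>] unfolding eventually_at by auto
    have "val e < rot_val e j k \<phi> (min \<eta> \<eta>' / 2)"
      by (rule \<eta>(2)) (use \<eta>(1) \<eta>'(1) in auto)
    moreover have "rot_val e j k \<phi> (min \<eta> \<eta>' / 2) \<le> val e"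
      by (rule \<eta>'(2)) (use \<eta>(1) \<eta>'(1) in auto)
    ultimately show False by simp
  qed
  with block_condition_optimal[OF e st] show ?thesis
    unfolding globally_optimal_def vP by simp
qed

lemma score_operator_eq:
  assumes e: "orthonormal_basis d e"
  shows "score_operator d f J \<psi> \<rho> \<sigma> (basis_pvm d e)
     = udiag d (basis_mat d e) (\<lambda>l. \<theta> (t e l))"
  unfolding udiag_basis_mat[OF e] score_operator_def likelihood_ratio_def ..

lemma basis_pvm_udiag:
  assumes j: "j < d"
  shows "basis_pvm d e j = udiag d (basis_mat d e) (\<lambda>l. if l = j then 1 else 0)"
proof (rule mat_eqI[of _ d d])
  fix a b assume ab: "a < d" "b < d"
  have "udiag d (basis_mat d e) (\<lambda>l. if l = j then 1 else 0) $$ (a, b)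
     = (\<Sum>l<d. if l = j then basis_pvm d e j $$ (a, b) else 0)"
    unfolding udiag_index[OF basis_mat_carrier ab]
    by (rule sum.cong) (use ab in \<open>auto simp: basis_mat_def basis_pvm_def\<close>)
  then show "basis_pvm d e j $$ (a, b) = udiag d (basis_mat d e) (\<lambda>l. if l = j then 1 else 0) $$ (a, b)"
    using j by simp
qed auto

context
  fixes e m s B
  assumes e: "orthonormal_basis d e"
    and sd: "spectral_decomposition d (score_operator d f J \<psi> \<rho> \<sigma> (basis_pvm d e)) m s B"
begin

lemma block_proj: "\<alpha> < m \<Longrightarrow> B \<alpha> = udiag d (basis_mat d e) (\<lambda>l. if s \<alpha> = \<theta> (t e l) then 1 else 0)"
    and block_exists: "j < d \<Longrightarrow> \<exists>\<alpha><m. s \<alpha> = \<theta> (t e j)"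
  using spectral_projection_diagonal[OF unitary_basis_mat[OF e] sd[unfolded score_operator_eq[OF e]]] by blast+

lemma block_ratio:
  assumes "j < d" "s \<alpha> = \<theta> (t e j)"
  shows "the_inv_into {0<..} \<theta> (s \<alpha>) = t e j"
  unfolding assms(2) by (rule the_inv_into_f_f[OF score_inj]) (use pos(3)[OF e assms(1)] in simp)

text \<open>In the basis \<open>e\<close> the difference of the two projections is diagonal with
  entries 0 or 1.\<close>

lemma pvm_le_block:
  assumes "\<alpha> < m" "j < d" "s \<alpha> = \<theta> (t e j)"
  shows "loewner_le d (basis_pvm d e j) (B \<alpha>)"
proof -
  let ?U = "basis_mat d e"
  let ?c = "\<lambda>l. (if s \<alpha> = \<theta> (t e l) then 1 else 0) - (if l = j then 1 else 0) :: real"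
  have "B \<alpha> - basis_pvm d e j = udiag d ?U ?c"
    unfolding block_proj[OF assms(1)] basis_pvm_udiag[OF assms(2)]
    by (rule udiag_diff[OF basis_mat_carrier])
  moreover have "psd d (udiag d ?U ?c)"
    by (rule udiag_psd) (use assms(3) in auto)
  moreover have "B \<alpha> \<in> carrier_mat d d" unfolding block_proj[OF assms(1)] by (rule udiag_carrier) simp
  ultimately show ?thesis by (simp add: loewner_le_def)
qed

text \<open>Conjugated into the basis \<open>e\<close>, each \<open>B \<alpha>\<close> is the
  diagonal indicator of its block, so the sandwiched matrix keeps exactly the entries inside the
  block. Injectivity of the score map makes equal scores the same as equal ratios.\<close>

lemma block_condition_iff:
  assumes tt: "\<And>\<alpha>. \<alpha> < m \<Longrightarrow> \<tau> \<alpha> = the_inv_into {0<..} \<theta> (s \<alpha>)"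
  shows "(\<forall>\<alpha><m. B \<alpha> * (\<rho> - of_real (\<tau> \<alpha>) \<cdot>\<^sub>m \<sigma>) * B \<alpha> = 0\<^sub>m d d) \<longleftrightarrow> block_condition e"
proof -
  define U where "U = basis_mat d e"
  define R where "R \<alpha> = \<rho> - of_real (\<tau> \<alpha>) \<cdot>\<^sub>m \<sigma>" for \<alpha>
  define \<chi> where "\<chi> \<alpha> l = (if s \<alpha> = \<theta> (t e l) then 1 else 0 :: real)" for \<alpha> l
  have U: "unitary d U" unfolding U_def by (rule unitary_basis_mat[OF e])
  have Rc: "R \<alpha> \<in> carrier_mat d d" for \<alpha>
    unfolding R_def using states_carrier by (intro minus_carrier_mat smult_carrier_mat)
  have br: "(adj U * R \<alpha> * U) $$ (j, k) = defect e (\<tau> \<alpha>) j k"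
    if "j < d" "k < d" for j k \<alpha>
  proof -
    note c = orthonormalD(1)[OF e that(1)] orthonormalD(1)[OF e that(2)]
    have "(adj U * R \<alpha> * U) $$ (j, k) = bracket (e j) (R \<alpha>) (e k)"
      unfolding bracket_cols[OF Rc unitaryD(1)[OF U] that, symmetric] unfolding U_def basis_mat_col[OF e that(1)] basis_mat_col[OF e that(2)] ..
    also have "\<dots> = defect e (\<tau> \<alpha>) j k"
      unfolding R_def using c states_carrier by (simp add: bracket_diff[of _ d] bracket_smult[of _ d])
    finally show ?thesis .
  qed
  have conj: "adj U * (B \<alpha> * R \<alpha> * B \<alpha>) * U = rdiag d (\<chi> \<alpha>) * (adj U * R \<alpha> * U) * rdiag d (\<chi> \<alpha>)" if "\<alpha> < m" for \<alpha>
    unfolding block_proj[OF that] U_def[symmetric] \<chi>_def[symmetric]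
    by (simp add: mat_dim_simps unitary_dims[OF U] unitary_cancel[OF U] unitaryD(3)[OF U] carrier_matD[OF Rc] del: assoc_mult_mat)
  have entry: "(rdiag d (\<chi> \<alpha>) * (adj U * R \<alpha> * U) * rdiag d (\<chi> \<alpha>)) $$ (j, k)
     = \<chi> \<alpha> j * \<chi> \<alpha> k * (defect e (\<tau> \<alpha>) j k)"
    if jk: "j < d" "k < d" for j k \<alpha>
  proof -
    define C where "C = adj U * R \<alpha> * U"
    have C: "C \<in> carrier_mat d d" unfolding C_def mem_carrier_mat by (simp add: unitary_dims[OF U])
    have "rdiag d (\<chi> \<alpha>) * C \<in> carrier_mat d d" by (simp add: mem_carrier_mat carrier_matD[OF C])
    then have "(rdiag d (\<chi> \<alpha>) * C * rdiag d (\<chi> \<alpha>)) $$ (j, k) = (rdiag d (\<chi> \<alpha>) * C) $$ (j, k) * \<chi> \<alpha> k"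
      using jk by (simp add: mat_diag_mult_right)
    also have "(rdiag d (\<chi> \<alpha>) * C) $$ (j, k) = \<chi> \<alpha> j * C $$ (j, k)"
      using jk by (simp add: mat_diag_mult_left[OF C])
    finally show ?thesis unfolding C_def br[OF jk] by simp
  qed
  have zero_iff: "B \<alpha> * R \<alpha> * B \<alpha> = 0\<^sub>m d d \<longleftrightarrow>
     (\<forall>j<d. \<forall>k<d. s \<alpha> = \<theta> (t e j) \<and> s \<alpha> = \<theta> (t e k) \<longrightarrow> defect e (\<tau> \<alpha>) j k = 0)" (is "_ \<longleftrightarrow> ?R")
    if \<alpha>: "\<alpha> < m" for \<alpha>
  proof -
    have Bc: "B \<alpha> \<in> carrier_mat d d" unfolding block_proj[OF \<alpha>] by (rule udiag_carrier) simp
    define X where "X = B \<alpha> * R \<alpha> * B \<alpha>"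
    define Y where "Y = rdiag d (\<chi> \<alpha>) * (adj U * R \<alpha> * U) * rdiag d (\<chi> \<alpha>)"
    have X: "X \<in> carrier_mat d d" unfolding X_def mem_carrier_mat by (simp add: carrier_matD[OF Bc])
    have XY: "adj U * X * U = Y" unfolding X_def Y_def by (rule conj[OF \<alpha>])
    have Y: "dim_row Y = d" "dim_col Y = d" by (simp_all add: Y_def)
    have "X = 0\<^sub>m d d \<longleftrightarrow> Y = 0\<^sub>m d d"
    proof
      assume "X = 0\<^sub>m d d"
      then show "Y = 0\<^sub>m d d" unfolding XY[symmetric] using unitaryD(1,2)[OF U] by simp
    next
      assume "Y = 0\<^sub>m d d"
      then have "U * (adj U * X * U) * adj U = U * 0\<^sub>m d d * adj U" unfolding XY by simp
      then show "X = 0\<^sub>m d d" unfolding unitary_conj_cancel(1)[OF U X] using unitaryD(1,2)[OF U] by simp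
    qed
    also have "\<dots> \<longleftrightarrow> (\<forall>j<d. \<forall>k<d. Y $$ (j, k) = 0)"
    proof
      assume "Y = 0\<^sub>m d d" then show "\<forall>j<d. \<forall>k<d. Y $$ (j, k) = 0" by simp
    next
      assume "\<forall>j<d. \<forall>k<d. Y $$ (j, k) = 0" then show "Y = 0\<^sub>m d d" by (intro eq_matI) (simp_all add: Y)
    qed
    also have "\<dots> \<longleftrightarrow> ?R"
    proof (intro all_cong1 imp_cong refl)
      fix j k assume jk: "j < d" "k < d"
      show "Y $$ (j, k) = 0 \<longleftrightarrow> (s \<alpha> = \<theta> (t e j) \<and> s \<alpha> = \<theta> (t e k) \<longrightarrow> defect e (\<tau> \<alpha>) j k = 0)"
        unfolding Y_def entry[OF jk] by (auto simp: \<chi>_def)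
    qed
    finally show ?thesis unfolding X_def .
  qed
  show ?thesis
  proof
    assume L: "\<forall>\<alpha><m. B \<alpha> * (\<rho> - of_real (\<tau> \<alpha>) \<cdot>\<^sub>m \<sigma>) * B \<alpha> = 0\<^sub>m d d"
    show "block_condition e" unfolding block_condition_def
    proof (intro allI impI)
      fix j k assume jk: "j < d" "k < d" "t e j = t e k"
      obtain \<alpha> where \<alpha>: "\<alpha> < m" "s \<alpha> = \<theta> (t e j)" using block_exists[OF jk(1)] by blast
      have "\<tau> \<alpha> = t e j" using tt[OF \<alpha>(1)] block_ratio[OF jk(1) \<alpha>(2)] by simp
      moreover have "B \<alpha> * R \<alpha> * B \<alpha> = 0\<^sub>m d d" using L \<alpha>(1) unfolding R_def by blast
      moreover have "s \<alpha> = \<theta> (t e k)" using \<alpha>(2) unfolding jk(3) .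
      ultimately show "defect e (t e j) j k = 0"
        using zero_iff[OF \<alpha>(1)] jk(1,2) \<alpha>(2) by metis
    qed
  next
    assume bc: "block_condition e"
    show "\<forall>\<alpha><m. B \<alpha> * (\<rho> - of_real (\<tau> \<alpha>) \<cdot>\<^sub>m \<sigma>) * B \<alpha> = 0\<^sub>m d d"
      unfolding R_def[symmetric]
    proof (intro allI impI)
      fix \<alpha> assume \<alpha>: "\<alpha> < m"
      show "B \<alpha> * R \<alpha> * B \<alpha> = 0\<^sub>m d d"
        unfolding zero_iff[OF \<alpha>]
      proof (intro allI impI)
        fix j k assume jk: "j < d" "k < d" and s: "s \<alpha> = \<theta> (t e j) \<and> s \<alpha> = \<theta> (t e k)"
        have "\<tau> \<alpha> = t e j" "\<tau> \<alpha> = t e k"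
          using tt[OF \<alpha>] block_ratio[OF jk(1) conjunct1[OF s]] block_ratio[OF jk(2) conjunct2[OF s]] by (simp_all only:)
        then show "defect e (\<tau> \<alpha>) j k = 0"
          using bc jk unfolding block_condition_def by metis
      qed
    qed
  qed
qed

lemma ascent_direction:
  assumes nb: "\<not> block_condition e"
    and tt: "\<And>\<alpha>. \<alpha> < m \<Longrightarrow> \<tau> \<alpha> = the_inv_into {0<..} \<theta> (s \<alpha>)"
  shows "\<exists>\<alpha><m. \<exists>j<d. \<exists>k<d. \<exists>\<phi>::real. \<exists>D::real. j \<noteq> k
      \<and> loewner_le d (basis_pvm d e j) (B \<alpha>) \<and> loewner_le d (basis_pvm d e k) (B \<alpha>)
      \<and> has_second_derivative (rot_val e j k \<phi>) D 0
      \<and> D = 4 * deriv F' (\<tau> \<alpha>)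
           * (cmod (bracket (e j) (\<rho> - of_real (\<tau> \<alpha>) \<cdot>\<^sub>m \<sigma>) (e k)))\<^sup>2 * (1 / q e j + 1 / q e k)
      \<and> D > 0"
proof -
  obtain j k \<phi> D where jk: "j < d" "k < d" "j \<noteq> k" "t e j = t e k"
    and D: "has_second_derivative (rot_val e j k \<phi>) D 0"
      "D = 4 * deriv F' (t e j) * (cmod (defect e (t e j) j k))\<^sup>2
        * (1 / q e j + 1 / q e k)" "D > 0"
    by (rule not_block_condition[OF e nb])
  obtain \<alpha> where \<alpha>: "\<alpha> < m" "s \<alpha> = \<theta> (t e j)" using block_exists[OF jk(1)] by blast
  have \<tau>: "\<tau> \<alpha> = t e j" using tt[OF \<alpha>(1)] block_ratio[OF jk(1) \<alpha>(2)] by simp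
  have sk: "s \<alpha> = \<theta> (t e k)" using \<alpha>(2) unfolding jk(4) .
  note c = orthonormalD(1)[OF e jk(1)] orthonormalD(1)[OF e jk(2)]
  have "bracket (e j) (\<rho> - of_real (\<tau> \<alpha>) \<cdot>\<^sub>m \<sigma>) (e k) = defect e (t e j) j k"
    unfolding \<tau> using c states_carrier by (simp add: bracket_diff[of _ d] bracket_smult[of _ d])
  then have D': "D = 4 * deriv F' (\<tau> \<alpha>)
           * (cmod (bracket (e j) (\<rho> - of_real (\<tau> \<alpha>) \<cdot>\<^sub>m \<sigma>) (e k)))\<^sup>2 * (1 / q e j + 1 / q e k)"
    using D(2) \<tau> by (simp only:)
  show ?thesis
    using \<alpha>(1) jk D(1,3) D' pvm_le_block[OF \<alpha>(1) jk(1) \<alpha>(2)] pvm_le_block[OF \<alpha>(1) jk(2) sk] by blast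
qed

end

end

theorem theorem4p1:
  fixes f :: "real \<Rightarrow> ereal" and J :: "real set" and \<psi> :: "real \<Rightarrow> real"
    and d :: nat and \<rho> \<sigma> :: "complex mat"
  assumes lift: "operator_Fenchel_lift f J \<psi>"
    and rho: "faithful_density d \<rho>"
    and sigma: "faithful_density d \<sigma>"
  shows
    "(\<forall>e P m s B t.
        orthonormal_basis d e \<and> P = basis_pvm d e \<and> critical_pvm d f \<rho> \<sigma> P
        \<and> spectral_decomposition d (score_operator d f J \<psi> \<rho> \<sigma> P) m s B
        \<and> (\<forall>\<alpha><m. t \<alpha> = the_inv_into {0<..} (score_map f J \<psi>) (s \<alpha>)) \<longrightarrow>
        (globally_optimal d f \<rho> \<sigma> P \<longleftrightarrow>
           (\<forall>\<alpha><m. B \<alpha> * (\<rho> - complex_of_real (t \<alpha>) \<cdot>\<^sub>m \<sigma>) * B \<alpha> = 0\<^sub>m d d))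
        \<and> (\<not> (\<forall>\<alpha><m. B \<alpha> * (\<rho> - complex_of_real (t \<alpha>) \<cdot>\<^sub>m \<sigma>) * B \<alpha> = 0\<^sub>m d d) \<longrightarrow>
           (\<exists>\<alpha><m. \<exists>j<d. \<exists>k<d. \<exists>\<phi>::real. \<exists>D::real. j \<noteq> k
              \<and> loewner_le d (P j) (B \<alpha>) \<and> loewner_le d (P k) (B \<alpha>)
              \<and> has_second_derivative
                  (\<lambda>\<theta>. pvm_value d f \<rho> \<sigma> (basis_pvm d (two_level_rotation e j k \<phi> \<theta>))) D 0
              \<and> D = 4 * deriv (deriv (finite_part f)) (t \<alpha>)
                     * (cmod (bracket (e j) (\<rho> - complex_of_real (t \<alpha>) \<cdot>\<^sub>m \<sigma>) (e k)))\<^sup>2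
                     * (1 / born \<sigma> (P j) + 1 / born \<sigma> (P k))
              \<and> D > 0)))
     \<and> (\<forall>P. local_max_pvm d f \<rho> \<sigma> P \<longrightarrow> globally_optimal d f \<rho> \<sigma> P)
     \<and> (\<forall>P. second_order_stationary d f \<rho> \<sigma> P \<longrightarrow> globally_optimal d f \<rho> \<sigma> P)
     \<and> (\<forall>e P m s B.
        orthonormal_basis d e \<and> P = basis_pvm d e \<and> critical_pvm d f \<rho> \<sigma> P
        \<and> \<not> globally_optimal d f \<rho> \<sigma> P
        \<and> spectral_decomposition d (score_operator d f J \<psi> \<rho> \<sigma> P) m s B \<longrightarrow>
        (\<exists>\<alpha><m. \<exists>j<d. \<exists>k<d. \<exists>\<phi>::real. \<exists>D::real. j \<noteq> k
           \<and> loewner_le d (P j) (B \<alpha>) \<and> loewner_le d (P k) (B \<alpha>)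
           \<and> has_second_derivative
               (\<lambda>\<theta>. pvm_value d f \<rho> \<sigma> (basis_pvm d (two_level_rotation e j k \<phi> \<theta>))) D 0
           \<and> D > 0))"
proof -
  interpret state_pair f J \<psi> d \<rho> \<sigma>
    by unfold_locales (fact lift rho sigma)+
  have blocks: "(\<forall>\<alpha><m. B \<alpha> * (\<rho> - complex_of_real (\<tau> \<alpha>) \<cdot>\<^sub>m \<sigma>) * B \<alpha> = 0\<^sub>m d d) \<longleftrightarrow> block_condition e"
    if "orthonormal_basis d e" "spectral_decomposition d (score_operator d f J \<psi> \<rho> \<sigma> (basis_pvm d e)) m s B"
      "\<forall>\<alpha><m. \<tau> \<alpha> = the_inv_into {0<..} (score_map f J \<psi>) (s \<alpha>)" for e m s B \<tau>
    by (rule block_condition_iff[OF that(1,2)]) (use that(3) in blast)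
  show ?thesis
  proof ((intro conjI allI impI; (elim conjE)?), goal_cases)
    case (1 e P m s B \<tau>)
    note P = 1(2) and e = 1(1)
    have "stationary e" by (rule critical_stationary[OF e 1(3)]) (simp add: P)
    then show ?case unfolding blocks[OF e 1(4)[unfolded P] 1(5)] unfolding P by (rule optimal_iff[OF e])
  next
    case (2 e P m s B \<tau>)
    note P = 2(3) and e = 2(2)
    have "\<not> block_condition e" using 2(1) unfolding blocks[OF e 2(5)[unfolded P] 2(6)] .
    then show ?case unfolding P by (rule ascent_direction[OF e 2(5)[unfolded P]]) (use 2(6) in blast)
  next
    case (3 P)
    then show ?case by (rule local_max_optimal)
  next
    case (4 P)
    then show ?case by (rule second_order_optimal)
  next
    case (5 e P m s B)
    note P = 5(2) and e = 5(1)
    have "stationary e" by (rule critical_stationary[OF e 5(3)]) (simp add: P)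
    then have "\<not> block_condition e" using 5(4) unfolding P by (simp add: optimal_iff[OF e])
    \<comment> \<open>This claim names no ratios; \<open>refl\<close> takes the inverse score itself
      as \<tau>.\<close>
    from ascent_direction[OF e 5(5)[unfolded P] this refl] show ?case unfolding P by blast
  qed
qed

end
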